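(* (In $\mathsf{ZF}$.) For every non-empty set $A$, there is no bijection between $\mathscr{P}(A)$ and $\mathscr{B}_{\mathrm{fin}}(A)$.
   Context: Work in $\mathsf{ZF}$. A partition is finitary if all its blocks are finite; $\mathscr{B}(A)$ is the set of finitary partitions of $A$; $\mathrm{ns}(P)$ is the set of blocks of $P$ with more than one element; $\mathscr{B}_{\mathrm{fin}}(A)=\{P\in\mathscr{B}(A)\mid\mathrm{ns}(P)\text{ finite}\}$. *)

theory Defs
  imports Main
begin

text \<open>
  Working in \<open>ZF\<close> is rendered semantically: the main theorem is about an arbitrary model
  \<open>(V, mem)\<close> of \<open>ZF\<close>, the universe \<open>V\<close> being the whole type \<open>'v\<close>. Separation and Replacement
  are first-order schemas, i.e. restricted to properties definable by a formula of the
  language of set theory with parameters. Allowing arbitrary HOL predicates in these schemas would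
  make every model satisfy the axiom of choice, through the choice operator of HOL.

  All notions below (finiteness in particular) are interpreted inside the model: every
  quantifier ranges over \<open>V\<close>, and nothing but \<open>mem\<close> and equality is used.
\<close>

text \<open>Formulas use de Bruijn indices: \<open>FAll\<close> binds variable 0.\<close>

datatype fm = FMem nat nat | FEq nat nat | FNot fm | FAnd fm fm | FAll fm

locale membership =
  fixes mem :: "'v \<Rightarrow> 'v \<Rightarrow> bool"  (infix "\<^bold>\<in>" 50)
begin

primrec sat :: "fm \<Rightarrow> (nat \<Rightarrow> 'v) \<Rightarrow> bool" where
  "sat (FMem i j) s \<longleftrightarrow> s i \<^bold>\<in> s j"
| "sat (FEq i j) s \<longleftrightarrow> s i = s j"
| "sat (FNot p) s \<longleftrightarrow> \<not> sat p s"
| "sat (FAnd p q) s \<longleftrightarrow> sat p s \<and> sat q s"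
| "sat (FAll p) s \<longleftrightarrow> (\<forall>a. sat p (case_nat a s))"

definition subset :: "'v \<Rightarrow> 'v \<Rightarrow> bool" where
  "subset x y \<longleftrightarrow> (\<forall>z. z \<^bold>\<in> x \<longrightarrow> z \<^bold>\<in> y)"

definition is_empty :: "'v \<Rightarrow> bool" where
  "is_empty x \<longleftrightarrow> (\<forall>z. \<not> z \<^bold>\<in> x)"

definition is_upair :: "'v \<Rightarrow> 'v \<Rightarrow> 'v \<Rightarrow> bool" where
  "is_upair p x y \<longleftrightarrow> (\<forall>z. z \<^bold>\<in> p \<longleftrightarrow> z = x \<or> z = y)"

text \<open>Kuratowski pairs.\<close>

definition is_opair :: "'v \<Rightarrow> 'v \<Rightarrow> 'v \<Rightarrow> bool" where
  "is_opair p x y \<longleftrightarrow> (\<forall>z. z \<^bold>\<in> p \<longleftrightarrow> is_upair z x x \<or> is_upair z x y)"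

definition is_succ :: "'v \<Rightarrow> 'v \<Rightarrow> bool" where
  "is_succ y x \<longleftrightarrow> (\<forall>z. z \<^bold>\<in> y \<longleftrightarrow> z \<^bold>\<in> x \<or> z = x)"

definition is_inductive :: "'v \<Rightarrow> bool" where
  "is_inductive w \<longleftrightarrow> (\<exists>e. is_empty e \<and> e \<^bold>\<in> w) \<and> (\<forall>x. x \<^bold>\<in> w \<longrightarrow> (\<exists>y. is_succ y x \<and> y \<^bold>\<in> w))"

definition natural :: "'v \<Rightarrow> bool" where
  "natural n \<longleftrightarrow> (\<forall>w. is_inductive w \<longrightarrow> n \<^bold>\<in> w)"

definition maps_to :: "'v \<Rightarrow> 'v \<Rightarrow> 'v \<Rightarrow> bool" where
  "maps_to f x y \<longleftrightarrow> (\<exists>p. is_opair p x y \<and> p \<^bold>\<in> f)"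

definition bijection :: "'v \<Rightarrow> 'v \<Rightarrow> 'v \<Rightarrow> bool" where
  "bijection f X Y \<longleftrightarrow>
     (\<forall>p. p \<^bold>\<in> f \<longrightarrow> (\<exists>x y. x \<^bold>\<in> X \<and> y \<^bold>\<in> Y \<and> is_opair p x y)) \<and>
     (\<forall>x. x \<^bold>\<in> X \<longrightarrow> (\<exists>!y. maps_to f x y)) \<and>
     (\<forall>y. y \<^bold>\<in> Y \<longrightarrow> (\<exists>!x. maps_to f x y))"

definition fin :: "'v \<Rightarrow> bool" where
  "fin x \<longleftrightarrow> (\<exists>n f. natural n \<and> bijection f x n)"

text \<open>
  The set \<open>{x. Q x}\<close> of the model; arbitrary if that class is not a set. For the three
  uses below it is a set in every model of \<open>ZF\<close>, see \<open>mem_power_set\<close>, \<open>mem_ns\<close>, \<open>mem_B_fin\<close>.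
\<close>

definition set_of :: "('v \<Rightarrow> bool) \<Rightarrow> 'v" where
  "set_of Q = (THE z. \<forall>x. x \<^bold>\<in> z \<longleftrightarrow> Q x)"

definition power_set :: "'v \<Rightarrow> 'v" where
  "power_set A = set_of (\<lambda>x. subset x A)"

definition partition :: "'v \<Rightarrow> 'v \<Rightarrow> bool" where
  "partition P A \<longleftrightarrow>
     (\<forall>b. b \<^bold>\<in> P \<longrightarrow> \<not> is_empty b) \<and>
     (\<forall>b c. b \<^bold>\<in> P \<and> c \<^bold>\<in> P \<and> b \<noteq> c \<longrightarrow> \<not> (\<exists>x. x \<^bold>\<in> b \<and> x \<^bold>\<in> c)) \<and>
     (\<forall>x. x \<^bold>\<in> A \<longleftrightarrow> (\<exists>b. x \<^bold>\<in> b \<and> b \<^bold>\<in> P))"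

definition finitary_partition :: "'v \<Rightarrow> 'v \<Rightarrow> bool" where
  "finitary_partition P A \<longleftrightarrow> partition P A \<and> (\<forall>b. b \<^bold>\<in> P \<longrightarrow> fin b)"

definition ns :: "'v \<Rightarrow> 'v" where
  "ns P = set_of (\<lambda>b. b \<^bold>\<in> P \<and> (\<exists>x y. x \<^bold>\<in> b \<and> y \<^bold>\<in> b \<and> x \<noteq> y))"

definition B_fin :: "'v \<Rightarrow> 'v" where
  "B_fin A = set_of (\<lambda>P. finitary_partition P A \<and> fin (ns P))"

end

text \<open>
  The assignment \<open>s\<close> supplies the parameters of the schemas. The formula of Separation has
  variable 0 for the element; that of Replacement has 0 for the argument, 1 for the value.
\<close>

locale ZF = membership +
  assumes Extensionality: "\<forall>x y. (\<forall>z. z \<^bold>\<in> x \<longleftrightarrow> z \<^bold>\<in> y) \<longrightarrow> x = y"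
    and Foundation: "\<forall>x. \<not> is_empty x \<longrightarrow> (\<exists>y. y \<^bold>\<in> x \<and> \<not> (\<exists>z. z \<^bold>\<in> x \<and> z \<^bold>\<in> y))"
    and Pairing: "\<forall>x y. \<exists>p. is_upair p x y"
    and Union: "\<forall>x. \<exists>u. \<forall>z. z \<^bold>\<in> u \<longleftrightarrow> (\<exists>y. y \<^bold>\<in> x \<and> z \<^bold>\<in> y)"
    and Power_set: "\<forall>x. \<exists>p. \<forall>z. z \<^bold>\<in> p \<longleftrightarrow> subset z x"
    and Infinity: "\<exists>w. is_inductive w"
    and Separation: "\<forall>\<phi> s a. \<exists>b. \<forall>x. x \<^bold>\<in> b \<longleftrightarrow> x \<^bold>\<in> a \<and> sat \<phi> (case_nat x s)"
    and Replacement: "\<forall>\<phi> s a.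
      (\<forall>x y z. x \<^bold>\<in> a \<and> sat \<phi> (case_nat x (case_nat y s)) \<and> sat \<phi> (case_nat x (case_nat z s))
         \<longrightarrow> y = z) \<longrightarrow>
      (\<exists>b. \<forall>y. y \<^bold>\<in> b \<longleftrightarrow> (\<exists>x. x \<^bold>\<in> a \<and> sat \<phi> (case_nat x (case_nat y s))))"

context membership
begin

definition definable :: "((nat \<Rightarrow> 'v) \<Rightarrow> bool) \<Rightarrow> bool" where
  "definable Q \<longleftrightarrow> (\<exists>\<phi>. \<forall>s. sat \<phi> s \<longleftrightarrow> Q s)"

lemma definable_mem: "definable (\<lambda>s. s i \<^bold>\<in> s j)"
  unfolding definable_def by (rule exI[of _ "FMem i j"]) simp

lemma definable_eq: "definable (\<lambda>s. s i = s j)"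
  unfolding definable_def by (rule exI[of _ "FEq i j"]) simp

lemma definable_not: "definable Q \<Longrightarrow> definable (\<lambda>s. \<not> Q s)"
  unfolding definable_def by (metis sat.simps(3))

lemma definable_conj: "definable Q \<Longrightarrow> definable R \<Longrightarrow> definable (\<lambda>s. Q s \<and> R s)"
  unfolding definable_def by (metis sat.simps(4))

lemma definable_imp:
  assumes "definable Q" "definable R"
  shows "definable (\<lambda>s. Q s \<longrightarrow> R s)"
proof -
  have "definable (\<lambda>s. \<not> (Q s \<and> \<not> R s))" by (intro definable_not definable_conj assms)
  then show ?thesis by simp
qed

lemma definable_disj:
  assumes "definable Q" "definable R"
  shows "definable (\<lambda>s. Q s \<or> R s)"
proof -
  have "definable (\<lambda>s. \<not> Q s \<longrightarrow> R s)" by (intro definable_not definable_imp assms)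
  then show ?thesis by (simp add: disj_imp)
qed

lemma definable_iff:
  assumes "definable Q" "definable R"
  shows "definable (\<lambda>s. Q s \<longleftrightarrow> R s)"
  unfolding iff_conv_conj_imp by (intro definable_conj definable_imp assms)

lemma definable_all:
  assumes "definable (\<lambda>s. Q (s 0) (\<lambda>n. s (Suc n)))"
  shows "definable (\<lambda>s. \<forall>a. Q a s)"
proof -
  from assms obtain \<phi> where "\<forall>s. sat \<phi> s \<longleftrightarrow> Q (s 0) (\<lambda>n. s (Suc n))"
    unfolding definable_def by blast
  then have "\<forall>s. sat (FAll \<phi>) s \<longleftrightarrow> (\<forall>a. Q a s)" by simp
  then show ?thesis unfolding definable_def by blast
qed

lemma definable_ex:
  assumes "definable (\<lambda>s. Q (s 0) (\<lambda>n. s (Suc n)))"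
  shows "definable (\<lambda>s. \<exists>a. Q a s)"
proof -
  have "definable (\<lambda>s. \<not> (\<forall>a. \<not> Q a s))" by (intro definable_not definable_all assms)
  then show ?thesis by simp
qed

lemmas definable_intros = definable_mem definable_eq definable_not definable_conj definable_disj
  definable_imp definable_iff definable_all definable_ex

lemma definable_is_empty: "definable (\<lambda>s. is_empty (s i))"
  unfolding is_empty_def by (intro definable_intros)

lemma definable_is_upair: "definable (\<lambda>s. is_upair (s i) (s j) (s k))"
  unfolding is_upair_def by (intro definable_intros)

lemma definable_is_opair: "definable (\<lambda>s. is_opair (s i) (s j) (s k))"
  unfolding is_opair_def by (intro definable_intros definable_is_upair)

lemma definable_is_succ: "definable (\<lambda>s. is_succ (s i) (s j))"
  unfolding is_succ_def by (intro definable_intros)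

lemma definable_natural: "definable (\<lambda>s. natural (s i))"
  unfolding natural_def is_inductive_def
  by (intro definable_intros definable_is_empty definable_is_succ)

lemma definable_maps_to: "definable (\<lambda>s. maps_to (s i) (s j) (s k))"
  unfolding maps_to_def by (intro definable_intros definable_is_opair)

lemma definable_bijection: "definable (\<lambda>s. bijection (s i) (s j) (s k))"
  unfolding bijection_def Ex1_def
  by (intro definable_intros definable_is_opair definable_maps_to)

lemma definable_fin: "definable (\<lambda>s. fin (s i))"
  unfolding fin_def by (intro definable_intros definable_natural definable_bijection)

end

context ZF
begin

lemma separation_definable:
  assumes "definable Q"
  shows "\<exists>b. \<forall>x. x \<^bold>\<in> b \<longleftrightarrow> x \<^bold>\<in> a \<and> Q (case_nat x s)"
  using assms Separation unfolding definable_def by metis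

lemma mem_set_of:
  assumes "\<exists>z. \<forall>x. x \<^bold>\<in> z \<longleftrightarrow> Q x"
  shows "x \<^bold>\<in> set_of Q \<longleftrightarrow> Q x"
proof -
  have "\<exists>!z. \<forall>x. x \<^bold>\<in> z \<longleftrightarrow> Q x" using assms Extensionality by metis
  from theI'[OF this] show ?thesis unfolding set_of_def by blast
qed

lemma mem_power_set: "x \<^bold>\<in> power_set A \<longleftrightarrow> subset x A"
  unfolding power_set_def by (rule mem_set_of) (use Power_set in blast)

lemma mem_ns: "b \<^bold>\<in> ns P \<longleftrightarrow> b \<^bold>\<in> P \<and> (\<exists>x y. x \<^bold>\<in> b \<and> y \<^bold>\<in> b \<and> x \<noteq> y)"
proof -
  have "definable (\<lambda>s. \<exists>x y. x \<^bold>\<in> s 0 \<and> y \<^bold>\<in> s 0 \<and> x \<noteq> y)" by (intro definable_intros)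
  from separation_definable[OF this] show ?thesis
    unfolding ns_def by (intro mem_set_of) simp
qed

lemma mem_B_fin: "P \<^bold>\<in> B_fin A \<longleftrightarrow> finitary_partition P A \<and> fin (ns P)"
proof -
  have ns: "fin (ns P) \<longleftrightarrow>
      (\<exists>n. (\<forall>b. b \<^bold>\<in> n \<longleftrightarrow> b \<^bold>\<in> P \<and> (\<exists>x y. x \<^bold>\<in> b \<and> y \<^bold>\<in> b \<and> x \<noteq> y)) \<and> fin n)" (is "_ \<longleftrightarrow> ?R")
    for P
  proof
    show "fin (ns P) \<Longrightarrow> ?R" using mem_ns by blast
  next
    assume ?R
    then obtain n where n: "\<forall>b. b \<^bold>\<in> n \<longleftrightarrow> b \<^bold>\<in> ns P" and "fin n" unfolding mem_ns by blast
    then show "fin (ns P)" using Extensionality by metis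
  qed
  have "definable (\<lambda>s. finitary_partition (s 0) (s 1) \<and> fin (ns (s 0)))"
    unfolding ns finitary_partition_def partition_def
    by (intro definable_intros definable_is_empty definable_fin)
  from separation_definable[OF this, of "power_set (power_set A)" "\<lambda>_. A"]
  have *: "\<exists>z. \<forall>P. P \<^bold>\<in> z \<longleftrightarrow>
      P \<^bold>\<in> power_set (power_set A) \<and> finitary_partition P A \<and> fin (ns P)" by simp
  have "P \<^bold>\<in> power_set (power_set A)" if "finitary_partition P A" for P
    using that unfolding mem_power_set subset_def finitary_partition_def partition_def by blast
  with * have "\<exists>z. \<forall>P. P \<^bold>\<in> z \<longleftrightarrow> finitary_partition P A \<and> fin (ns P)" by metis
  then show ?thesis unfolding B_fin_def by (rule mem_set_of)
qed

end

end

theory Submission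
  imports Defs
begin

text \<open>
  Suppose \<open>f\<close> is a bijection from \<open>\<P>(A)\<close> to \<open>\<B>\<^sub>f\<^sub>i\<^sub>n(A)\<close> and \<open>A\<close> has three distinct elements \<open>a, b, c\<close>.
  The support of a partition is the union of its non-singleton blocks. By recursion, without any
  choice, one defines non-empty finite pairwise disjoint subsets (layers) of \<open>A\<close>, one for each
  finite set of ordinals; in particular the ordinals would inject into \<open>\<P>(A)\<close>, contradicting
  Burali-Forti. Each layer consists of the new elements in the supports of suitable \<open>f(S)\<close>, and
  the point is that some \<open>f(S)\<close> has a support not covered by the set \<open>F\<close> of the elements used so far.

  As long as \<open>F\<close> is finite, let \<open>S\<close> range over the sets generated, as a Boolean algebra, by the
  singletons of \<open>F\<close> and the finitely many sets \<open>T\<close> for which \<open>f(T)\<close> has support in \<open>F\<close>. If all these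
  \<open>f(S)\<close> had support in \<open>F\<close>, then this algebra, whose cardinality is divisible by 8 since
  \<open>a, b, c \<in> F\<close>, would have as many elements as there are partitions of \<open>F\<close>. But no Bell number is
  divisible by 8.

  At a later stage \<open>k\<close>, with largest element \<open>i \<ge> \<omega>\<close>, one diagonalises. A set \<open>T\<close> for which \<open>f(T)\<close> has
  support in \<open>F\<close> is one of finitely many attached to a pair \<open>(e, n)\<close>, where \<open>e \<subseteq> i - \<omega>\<close> is finite
  and \<open>n \<in> \<omega>\<close>: all layers meeting the support have indices contained in \<open>e \<union> n \<union> {i}\<close>. The layers
  with indices \<open>e \<union> {n, m}\<close>, \<open>n < m < \<omega>\<close>, are reserved for this pair; exactly one of them is put
  into \<open>S\<close>, so as to differ from all these \<open>T\<close>.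
\<close>

section \<open>Definability with parameters\<close>

primrec ren :: "(nat \<Rightarrow> nat) \<Rightarrow> fm \<Rightarrow> fm" where
  "ren r (FMem i j) = FMem (r i) (r j)"
| "ren r (FEq i j) = FEq (r i) (r j)"
| "ren r (FNot p) = FNot (ren r p)"
| "ren r (FAnd p q) = FAnd (ren r p) (ren r q)"
| "ren r (FAll p) = FAll (ren (case_nat 0 (\<lambda>n. Suc (r n))) p)"

named_theorems dfs

context membership
begin

lemma sat_ren: "sat (ren r p) s \<longleftrightarrow> sat p (\<lambda>n. s (r n))"
proof (induction p arbitrary: r s)
  case (FAll p)
  have "(\<lambda>n. case_nat a s (case_nat 0 (\<lambda>n. Suc (r n)) n)) = case_nat a (\<lambda>n. s (r n))" for a
    by (auto split: nat.split)
  then show ?case by (simp add: FAll)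
qed auto

text \<open>In \<open>df Q\<close>, each variable of the formula stands either for a variable of \<open>Q\<close> (\<open>Inl\<close>)
  or for a parameter (\<open>Inr\<close>).\<close>

definition df :: "((nat \<Rightarrow> 'v) \<Rightarrow> bool) \<Rightarrow> bool" where
  "df Q \<longleftrightarrow> (\<exists>p r. \<forall>s. Q s \<longleftrightarrow> sat p (\<lambda>n. case_sum s (\<lambda>v. v) (r n)))"

text \<open>A function is definable through its graph: variable 0 stands for the value, so the
  arguments of \<open>t\<close> are shifted by one.\<close>

definition dt :: "((nat \<Rightarrow> 'v) \<Rightarrow> 'v) \<Rightarrow> bool" where
  "dt t \<longleftrightarrow> df (\<lambda>s. s 0 = t (\<lambda>n. s (Suc n)))"

lemma df_definable: "definable Q \<Longrightarrow> df Q"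
  unfolding definable_def df_def by (metis (no_types, lifting) ext sum.case(1))

lemma df_subst:
  assumes "df Q"
  shows "df (\<lambda>s. Q (\<lambda>n. case_sum s (\<lambda>v. v) (q n)))"
proof -
  from assms obtain p r where pr: "Q s \<longleftrightarrow> sat p (\<lambda>n. case_sum s (\<lambda>v. v) (r n))" for s
    unfolding df_def by blast
  have *: "case_sum (\<lambda>n. case_sum s (\<lambda>v. v) (q n)) (\<lambda>v. v) (r n)
      = case_sum s (\<lambda>v. v) (case r n of Inl i \<Rightarrow> q i | Inr v \<Rightarrow> Inr v)" for s n
    by (simp split: sum.split)
  show ?thesis unfolding df_def
    by (rule exI[of _ p], rule exI[of _ "\<lambda>n. case r n of Inl i \<Rightarrow> q i | Inr v \<Rightarrow> Inr v"])
       (simp add: pr *)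
qed

lemma df_ren: "df Q \<Longrightarrow> df (\<lambda>s. Q (\<lambda>n. s (r n)))"
  using df_subst[of Q "\<lambda>n. Inl (r n)"] by simp

text \<open>Prepares the binding of \<open>x\<close>: after renaming, \<open>x\<close> is variable 0
  of the formula and occurs at no other position, as \<open>FAll\<close> and the axiom schemas
  require.\<close>

lemma df_push:
  assumes "df Q"
  shows "\<exists>p r. \<forall>s x. Q (case_nat x s) \<longleftrightarrow> sat p (case_nat x (\<lambda>n. case_sum s (\<lambda>v. v) (r n)))"
proof -
  from assms obtain p r where pr: "Q s \<longleftrightarrow> sat p (\<lambda>n. case_sum s (\<lambda>v. v) (r n))" for s
    unfolding df_def by blast
  \<comment> \<open>For \<open>Inl 0\<close> the truncated \<open>i - 1\<close> is harmless: the
    variables sent there by \<open>r\<close> are renamed to 0 and refer to \<open>x\<close>.\<close>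
  define r' where "r' n = (case r n of Inl i \<Rightarrow> Inl (i - 1) | Inr v \<Rightarrow> Inr v)" for n
  have "(\<lambda>n. case_sum (case_nat x s) (\<lambda>v. v) (r n)) =
    (\<lambda>n. case_nat x (\<lambda>n. case_sum s (\<lambda>v. v) (r' n)) (if r n = Inl 0 then 0 else Suc n))" for x s
    by (rule ext) (auto simp: r'_def split: sum.split nat.split)
  then have "Q (case_nat x s) \<longleftrightarrow> sat (ren (\<lambda>n. if r n = Inl 0 then 0 else Suc n) p)
      (case_nat x (\<lambda>n. case_sum s (\<lambda>v. v) (r' n)))" for s x
    unfolding pr sat_ren by simp
  then show ?thesis by blast
qed

lemma df_not [dfs]:
  assumes "df Q"
  shows "df (\<lambda>s. \<not> Q s)"
proof -
  from assms obtain p r where "Q s \<longleftrightarrow> sat p (\<lambda>n. case_sum s (\<lambda>v. v) (r n))" for s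
    unfolding df_def by blast
  then have "\<not> Q s \<longleftrightarrow> sat (FNot p) (\<lambda>n. case_sum s (\<lambda>v. v) (r n))" for s by simp
  then show ?thesis unfolding df_def by blast
qed

lemma df_conj [dfs]:
  assumes "df Q" "df R"
  shows "df (\<lambda>s. Q s \<and> R s)"
proof -
  from assms(1) obtain p r where 1: "Q s \<longleftrightarrow> sat p (\<lambda>n. case_sum s (\<lambda>v. v) (r n))" for s
    unfolding df_def by blast
  from assms(2) obtain p' r' where 2: "R s \<longleftrightarrow> sat p' (\<lambda>n. case_sum s (\<lambda>v. v) (r' n))" for s
    unfolding df_def by blast
  \<comment> \<open>The two formulas come with different tables of parameters; these are
    interleaved, \<open>r\<close> on the even and \<open>r'\<close> on the odd variables.\<close>
  define r'' where "r'' n = (if even n then r (n div 2) else r' (n div 2))" for n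
  have "Q s \<and> R s \<longleftrightarrow> sat (FAnd (ren (\<lambda>n. 2 * n) p) (ren (\<lambda>n. 2 * n + 1) p'))
      (\<lambda>n. case_sum s (\<lambda>v. v) (r'' n))" for s
    by (simp add: 1 2 sat_ren r''_def)
  then show ?thesis unfolding df_def by blast
qed

lemma df_all [dfs]:
  assumes "df (\<lambda>s. Q (s 0) (\<lambda>n. s (Suc n)))"
  shows "df (\<lambda>s. \<forall>a. Q a s)"
proof -
  from df_push[OF assms] obtain p r where "\<forall>s x. Q (case_nat x s 0) (\<lambda>n. case_nat x s (Suc n)) \<longleftrightarrow>
      sat p (case_nat x (\<lambda>n. case_sum s (\<lambda>v. v) (r n)))" by (elim exE)
  then have "(\<forall>a. Q a s) \<longleftrightarrow> sat (FAll p) (\<lambda>n. case_sum s (\<lambda>v. v) (r n))" for s by simp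
  then show ?thesis unfolding df_def by blast
qed

lemma df_imp [dfs]:
  assumes "df Q" "df R"
  shows "df (\<lambda>s. Q s \<longrightarrow> R s)"
proof -
  have "df (\<lambda>s. \<not> (Q s \<and> \<not> R s))" by (intro dfs assms)
  then show ?thesis by simp
qed

lemma df_disj [dfs]:
  assumes "df Q" "df R"
  shows "df (\<lambda>s. Q s \<or> R s)"
proof -
  have "df (\<lambda>s. \<not> Q s \<longrightarrow> R s)" by (intro dfs assms)
  then show ?thesis by (simp add: disj_imp)
qed

lemma df_iff [dfs]:
  assumes "df Q" "df R"
  shows "df (\<lambda>s. Q s \<longleftrightarrow> R s)"
  unfolding iff_conv_conj_imp by (intro dfs assms)

lemma df_ex [dfs]:
  assumes "df (\<lambda>s. Q (s 0) (\<lambda>n. s (Suc n)))"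
  shows "df (\<lambda>s. \<exists>a. Q a s)"
proof -
  have "df (\<lambda>s. \<not> (\<forall>a. \<not> Q a s))" by (intro dfs assms)
  then show ?thesis by simp
qed

text \<open>\<open>c\<close> is a truth value of HOL that does not depend on the assignment, so side
  conditions of the metalogic may occur inside definable properties.\<close>

lemma df_const [dfs]: "df (\<lambda>s. c)"
proof -
  have "df (\<lambda>s. s 0 = s 0)" by (rule df_definable, rule definable_eq)
  from this df_not[OF this] show ?thesis by (cases c) simp_all
qed

text \<open>The quantifier ranges over HOL numbers, not over the model. It unfolds to a finite
  conjunction, in which every \<open>Q i\<close> may be a different formula.\<close>

lemma df_all_less [dfs]:
  assumes "\<And>i. df (Q i)"
  shows "df (\<lambda>s. \<forall>i<(k::nat). Q i s)"
proof (induction k)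
  case (Suc k)
  have "(\<forall>i<Suc k. Q i s) \<longleftrightarrow> Q k s \<and> (\<forall>i<k. Q i s)" for s using less_Suc_eq by auto
  then show ?case using df_conj[OF assms Suc] by simp
qed (simp add: df_const)

lemma df_ex_less [dfs]:
  assumes "\<And>i. df (Q i)"
  shows "df (\<lambda>s. \<exists>i<(k::nat). Q i s)"
proof -
  have "df (\<lambda>s. \<not> (\<forall>i<k. \<not> Q i s))" by (intro dfs assms)
  then show ?thesis by simp
qed

lemma dt_var [dfs]: "dt (\<lambda>s. s i)"
  unfolding dt_def by (rule df_definable, rule definable_eq)

lemma dt_const [dfs]: "dt (\<lambda>s. c)"
proof -
  have "df (\<lambda>s. s 0 = s (Suc 0))" by (rule df_definable, rule definable_eq)
  from df_subst[OF this, of "\<lambda>n. if n = 0 then Inl 0 else Inr c"] show ?thesis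
    unfolding dt_def by simp
qed

text \<open>Formulas have no function symbols; a term is eliminated by naming its value with an
  existential quantifier.\<close>

lemma df_term:
  assumes "df (\<lambda>s. P (s 0))" "dt t"
  shows "df (\<lambda>s. P (t s))"
proof -
  have "df (\<lambda>s. \<exists>a. a = t s \<and> P a)"
    by (intro df_ex df_conj) (use assms df_ren[OF assms(1), of "\<lambda>_. 0"] in \<open>simp_all add: dt_def\<close>)
  then show ?thesis by simp
qed

lemma df_term2:
  assumes "df (\<lambda>s. P (s 0) (s 1))" "dt t" "dt u"
  shows "df (\<lambda>s. P (t s) (u s))"
proof -
  have u: "df (\<lambda>s. s 0 = u (\<lambda>n. s (Suc (Suc n))))"
    using df_ren[OF assms(3)[unfolded dt_def], of "\<lambda>n. if n = 0 then 0 else Suc n"] by simp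
  have P: "df (\<lambda>s. P (s 1) (s 0))"
    using df_ren[OF assms(1), of "\<lambda>n. 1 - n"] by simp
  have "df (\<lambda>s. \<exists>a. a = t s \<and> (\<exists>b. b = u s \<and> P a b))"
    by (intro df_ex df_conj) (use assms u P in \<open>simp_all add: dt_def\<close>)
  then show ?thesis by simp
qed

lemma df_term3:
  assumes "df (\<lambda>s. P (s 0) (s 1) (s 2))" "dt t" "dt u" "dt v"
  shows "df (\<lambda>s. P (t s) (u s) (v s))"
proof -
  have u: "df (\<lambda>s. s 0 = u (\<lambda>n. s (Suc (Suc n))))"
    using df_ren[OF assms(3)[unfolded dt_def], of "\<lambda>n. if n = 0 then 0 else Suc n"] by simp
  have v: "df (\<lambda>s. s 0 = v (\<lambda>n. s (Suc (Suc (Suc n)))))"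
    using df_ren[OF assms(4)[unfolded dt_def], of "\<lambda>n. if n = 0 then 0 else Suc (Suc n)"] by simp
  have P: "df (\<lambda>s. P (s 2) (s 1) (s 0))"
    using df_ren[OF assms(1), of "\<lambda>n. 2 - n"] by simp
  have "df (\<lambda>s. \<exists>a. a = t s \<and> (\<exists>b. b = u s \<and> (\<exists>c. c = v s \<and> P a b c)))"
    by (intro df_ex df_conj) (use assms u v P in \<open>simp_all add: dt_def numeral_2_eq_2\<close>)
  then show ?thesis by simp
qed

lemma df_mem [dfs]: "dt t \<Longrightarrow> dt u \<Longrightarrow> df (\<lambda>s. t s \<^bold>\<in> u s)"
  by (rule df_term2[where P = "\<lambda>x y. x \<^bold>\<in> y"]) (rule df_definable, rule definable_mem)

lemma df_eq [dfs]: "dt t \<Longrightarrow> dt u \<Longrightarrow> df (\<lambda>s. t s = u s)"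
  by (rule df_term2[where P = "\<lambda>x y. x = y"]) (rule df_definable, rule definable_eq)

lemma df_subset [dfs]: "dt t \<Longrightarrow> dt u \<Longrightarrow> df (\<lambda>s. subset (t s) (u s))"
proof (erule (1) df_term2[where P = subset, rotated])
  show "df (\<lambda>s. subset (s 0) (s 1))" unfolding subset_def by (intro dfs)
qed

lemma df_fin [dfs]: "dt t \<Longrightarrow> df (\<lambda>s. fin (t s))"
  by (erule df_term[where P = fin, rotated]) (rule df_definable, rule definable_fin)

lemma df_natural [dfs]: "dt t \<Longrightarrow> df (\<lambda>s. natural (t s))"
  by (erule df_term[where P = natural, rotated]) (rule df_definable, rule definable_natural)

lemma df_bijection [dfs]: "dt t \<Longrightarrow> dt u \<Longrightarrow> dt v \<Longrightarrow> df (\<lambda>s. bijection (t s) (u s) (v s))"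
  by (rule df_term3[where P = bijection]) (rule df_definable, rule definable_bijection)

text \<open>Unique existence ensures that \<open>THE\<close> yields the intended set, so the graph
  is described by the elements of the value.\<close>

lemma dt_set_of [dfs]:
  assumes "df (\<lambda>s. Q (s 0) (\<lambda>n. s (Suc n)))" "\<And>s. \<exists>!z. \<forall>x. x \<^bold>\<in> z \<longleftrightarrow> Q x s"
  shows "dt (\<lambda>s. set_of (\<lambda>x. Q x s))"
proof -
  have *: "z = set_of (\<lambda>x. Q x s) \<longleftrightarrow> (\<forall>x. x \<^bold>\<in> z \<longleftrightarrow> Q x s)" for z s
  proof
    assume "z = set_of (\<lambda>x. Q x s)"
    then show "\<forall>x. x \<^bold>\<in> z \<longleftrightarrow> Q x s" unfolding set_of_def using theI'[OF assms(2)] by simp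
  next
    assume "\<forall>x. x \<^bold>\<in> z \<longleftrightarrow> Q x s"
    then have "set_of (\<lambda>x. Q x s) = z" unfolding set_of_def by (rule the1_equality[OF assms(2)])
    then show "z = set_of (\<lambda>x. Q x s)" ..
  qed
  have "df (\<lambda>s. Q (s 0) (\<lambda>n. s (Suc (Suc n))))"
    using df_ren[OF assms(1), of "\<lambda>n. if n = 0 then 0 else Suc n"] by simp
  then have "df (\<lambda>s. \<forall>x. x \<^bold>\<in> s 0 \<longleftrightarrow> Q x (\<lambda>n. s (Suc n)))"
    by (intro df_all df_iff df_mem dt_var)
  then show ?thesis unfolding dt_def * .
qed

end

section \<open>Set operations as definable terms\<close>

context membership
begin

lemma dt_shift:
  assumes "dt t"
  shows "dt (\<lambda>s. t (\<lambda>n. s (Suc n)))"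
  unfolding dt_def
  using df_ren[OF assms[unfolded dt_def], of "\<lambda>n. if n = 0 then 0 else Suc n"] by simp

lemma dt_op1:
  assumes "df (\<lambda>s. s 0 = g (s 1))" "dt t"
  shows "dt (\<lambda>s. g (t s))"
  unfolding dt_def
  by (rule df_term2[where P = "\<lambda>a b. a = g b", OF assms(1) dt_var dt_shift[OF assms(2)]])

lemma dt_op2:
  assumes "df (\<lambda>s. s 0 = g (s 1) (s 2))" "dt t" "dt u"
  shows "dt (\<lambda>s. g (t s) (u s))"
  unfolding dt_def
  by (rule df_term3[where P = "\<lambda>a b c. a = g b c",
        OF assms(1) dt_var dt_shift[OF assms(2)] dt_shift[OF assms(3)]])

definition SEP :: "'v \<Rightarrow> ('v \<Rightarrow> bool) \<Rightarrow> 'v" where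
  "SEP a Q = set_of (\<lambda>x. x \<^bold>\<in> a \<and> Q x)"

definition emp :: 'v where
  "emp = set_of (\<lambda>x. False)"

definition ins :: "'v \<Rightarrow> 'v \<Rightarrow> 'v" where
  "ins y x = set_of (\<lambda>z. z = y \<or> z \<^bold>\<in> x)"

definition rem :: "'v \<Rightarrow> 'v \<Rightarrow> 'v" where
  "rem y x = set_of (\<lambda>z. z \<^bold>\<in> x \<and> z \<noteq> y)"

definition Uni :: "'v \<Rightarrow> 'v" where
  "Uni x = set_of (\<lambda>z. \<exists>y. y \<^bold>\<in> x \<and> z \<^bold>\<in> y)"

definition upr :: "'v \<Rightarrow> 'v \<Rightarrow> 'v" where
  "upr x y = ins x (ins y emp)"

definition un :: "'v \<Rightarrow> 'v \<Rightarrow> 'v" where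
  "un x y = Uni (upr x y)"

definition pr :: "'v \<Rightarrow> 'v \<Rightarrow> 'v" where
  "pr x y = upr (upr x x) (upr x y)"

definition times :: "'v \<Rightarrow> 'v \<Rightarrow> 'v" where
  "times a b = SEP (power_set (power_set (un a b))) (\<lambda>p. \<exists>x y. x \<^bold>\<in> a \<and> y \<^bold>\<in> b \<and> p = pr x y)"

end

context ZF
begin

section \<open>Elementary set operations\<close>

lemma set_eqI: "(\<And>z. z \<^bold>\<in> x \<longleftrightarrow> z \<^bold>\<in> y) \<Longrightarrow> x = y"
  using Extensionality by blast

lemma separation:
  assumes "df (\<lambda>s. Q (s 0))"
  shows "\<exists>b. \<forall>x. x \<^bold>\<in> b \<longleftrightarrow> x \<^bold>\<in> a \<and> Q x"
proof -
  from df_push[OF assms] obtain p r where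
    "\<forall>s x. Q (case_nat x s 0) \<longleftrightarrow> sat p (case_nat x (\<lambda>n. case_sum s (\<lambda>v. v) (r n)))"
    by (elim exE)
  \<comment> \<open>\<open>Q\<close> looks at variable 0 only, so all other variables can receive
    the default value \<open>a\<close>.\<close>
  then have "Q x \<longleftrightarrow> sat p (case_nat x (\<lambda>n. case_sum (\<lambda>_. a) (\<lambda>v. v) (r n)))" for x by simp
  with Separation show ?thesis by simp
qed

lemma replacement:
  assumes "df (\<lambda>s. Q (s 0) (s 1))" "\<And>x y z. x \<^bold>\<in> a \<Longrightarrow> Q x y \<Longrightarrow> Q x z \<Longrightarrow> y = z"
  shows "\<exists>b. \<forall>y. y \<^bold>\<in> b \<longleftrightarrow> (\<exists>x. x \<^bold>\<in> a \<and> Q x y)"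
proof -
  from assms(1) obtain p and r :: "nat \<Rightarrow> nat + 'a" where pr: "\<forall>s. Q (s 0) (s 1) \<longleftrightarrow> sat p (\<lambda>n. case_sum s (\<lambda>v. v) (r n))"
    unfolding df_def by blast
  \<comment> \<open>Argument and value receive the numbers 0 and 1 prescribed by Replacement; every
    other variable is shifted by two and evaluated in \<open>s'\<close>, with \<open>a\<close> as
    the default.\<close>
  define q where "q n = (if r n = Inl 0 then 0 else if r n = Inl 1 then 1 else Suc (Suc n))" for n
  define s' where "s' n = case_sum (\<lambda>_. a) (\<lambda>v. v) (r n)" for n
  have "(\<lambda>n. case_sum (case_nat x (case_nat y (\<lambda>_. a))) (\<lambda>v. v) (r n))
      = (\<lambda>n. case_nat x (case_nat y s') (q n))" for x y
    by (rule ext) (auto simp: q_def s'_def split: sum.split nat.split)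
  then have "Q x y \<longleftrightarrow> sat (ren q p) (case_nat x (case_nat y s'))" for x y
    using pr[rule_format, of "case_nat x (case_nat y (\<lambda>_. a))"] unfolding sat_ren by simp
  note Q = this
  show ?thesis unfolding Q
    by (rule Replacement[rule_format]) (use assms(2) in \<open>unfold Q, blast\<close>)
qed

lemma set_of_unique: "\<exists>z. \<forall>x. x \<^bold>\<in> z \<longleftrightarrow> Q x \<Longrightarrow> \<exists>!z. \<forall>x. x \<^bold>\<in> z \<longleftrightarrow> Q x"
  using Extensionality by metis

lemma mem_SEP:
  assumes "df (\<lambda>s. Q (s 0))"
  shows "x \<^bold>\<in> SEP a Q \<longleftrightarrow> x \<^bold>\<in> a \<and> Q x"
  unfolding SEP_def by (rule mem_set_of, rule separation, rule assms)

lemma dt_SEP [dfs]: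
  assumes "dt u" "df (\<lambda>s. Q (s 0) (\<lambda>n. s (Suc n)))"
  shows "dt (\<lambda>s. SEP (u s) (\<lambda>x. Q x s))"
  unfolding SEP_def
proof (rule dt_set_of)
  show "df (\<lambda>s. s 0 \<^bold>\<in> u (\<lambda>n. s (Suc n)) \<and> Q (s 0) (\<lambda>n. s (Suc n)))"
    by (intro dfs dt_shift assms)
  fix s
  have "df (\<lambda>t. Q (t 0) s)"
    using df_subst[OF assms(2), of "\<lambda>n. case n of 0 \<Rightarrow> Inl 0 | Suc n \<Rightarrow> Inr (s n)"] by simp
  then show "\<exists>!z. \<forall>x. x \<^bold>\<in> z \<longleftrightarrow> x \<^bold>\<in> u s \<and> Q x s" by (intro set_of_unique separation)
qed

lemma mem_emp [simp]: "\<not> x \<^bold>\<in> emp"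
proof -
  have "\<exists>z. \<forall>x. x \<^bold>\<in> z \<longleftrightarrow> False" using separation[OF df_const, of a False] by blast
  from mem_set_of[OF this] show ?thesis unfolding emp_def by simp
qed

lemma subset_emp [simp]: "subset x emp \<longleftrightarrow> x = emp"
  unfolding subset_def using set_eqI[of x emp] by auto

lemma mem_Uni [simp]: "z \<^bold>\<in> Uni x \<longleftrightarrow> (\<exists>y. y \<^bold>\<in> x \<and> z \<^bold>\<in> y)"
  unfolding Uni_def by (rule mem_set_of) (use Union in blast)

lemma ex_pair: "\<exists>p. \<forall>z. z \<^bold>\<in> p \<longleftrightarrow> z = x \<or> z = y"
  using Pairing unfolding is_upair_def by blast

lemma mem_ins [simp]: "z \<^bold>\<in> ins y x \<longleftrightarrow> z = y \<or> z \<^bold>\<in> x"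
  unfolding ins_def
proof (rule mem_set_of)
  obtain s where "z \<^bold>\<in> s \<longleftrightarrow> z = y" for z using ex_pair[of y y] by blast
  moreover obtain p where "z \<^bold>\<in> p \<longleftrightarrow> z = s \<or> z = x" for z using ex_pair[of s x] by blast
  ultimately have "\<forall>z. z \<^bold>\<in> Uni p \<longleftrightarrow> z = y \<or> z \<^bold>\<in> x" by auto
  then show "\<exists>b. \<forall>z. z \<^bold>\<in> b \<longleftrightarrow> z = y \<or> z \<^bold>\<in> x" by blast
qed

lemma ins_neq_emp [simp]: "ins y x \<noteq> emp"
proof
  assume "ins y x = emp"
  moreover have "y \<^bold>\<in> ins y x" by simp
  ultimately show False by (simp del: mem_ins)
qed

lemma mem_rem [simp]: "z \<^bold>\<in> rem y x \<longleftrightarrow> z \<^bold>\<in> x \<and> z \<noteq> y"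
  unfolding rem_def by (intro mem_set_of separation dfs)

lemma mem_upr [simp]: "z \<^bold>\<in> upr x y \<longleftrightarrow> z = x \<or> z = y"
  by (simp add: upr_def)

lemma upr_neq_emp [simp]: "upr x y \<noteq> emp"
  by (simp add: upr_def)

lemma mem_un [simp]: "z \<^bold>\<in> un x y \<longleftrightarrow> z \<^bold>\<in> x \<or> z \<^bold>\<in> y"
  by (auto simp: un_def)

lemma dt_ins [dfs]:
  assumes "dt t" "dt u"
  shows "dt (\<lambda>s. ins (t s) (u s))"
proof (rule dt_op2[OF _ assms])
  have "a = ins y x \<longleftrightarrow> (\<forall>z. z \<^bold>\<in> a \<longleftrightarrow> z = y \<or> z \<^bold>\<in> x)" for a x y using set_eqI[of a "ins y x"] by auto
  then show "df (\<lambda>s. s 0 = ins (s 1) (s 2))" by (simp only:) (intro dfs)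
qed

lemma dt_rem [dfs]:
  assumes "dt t" "dt u"
  shows "dt (\<lambda>s. rem (t s) (u s))"
proof (rule dt_op2[OF _ assms])
  have "a = rem y x \<longleftrightarrow> (\<forall>z. z \<^bold>\<in> a \<longleftrightarrow> z \<^bold>\<in> x \<and> z \<noteq> y)" for a x y using set_eqI[of a "rem y x"] by auto
  then show "df (\<lambda>s. s 0 = rem (s 1) (s 2))" by (simp only:) (intro dfs)
qed

lemma dt_Uni [dfs]:
  assumes "dt t"
  shows "dt (\<lambda>s. Uni (t s))"
proof (rule dt_op1[OF _ assms])
  have "a = Uni x \<longleftrightarrow> (\<forall>z. z \<^bold>\<in> a \<longleftrightarrow> (\<exists>y. y \<^bold>\<in> x \<and> z \<^bold>\<in> y))" for a x using set_eqI[of a "Uni x"] by auto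
  then show "df (\<lambda>s. s 0 = Uni (s 1))" by (simp only:) (intro dfs)
qed

lemma dt_power_set [dfs]:
  assumes "dt t"
  shows "dt (\<lambda>s. power_set (t s))"
proof (rule dt_op1[OF _ assms])
  have "a = power_set x \<longleftrightarrow> (\<forall>z. z \<^bold>\<in> a \<longleftrightarrow> subset z x)" for a x
    using set_eqI[of a "power_set x"] by (auto simp: mem_power_set)
  then show "df (\<lambda>s. s 0 = power_set (s 1))" by (simp only:) (intro dfs)
qed

lemma dt_upr [dfs]: "dt t \<Longrightarrow> dt u \<Longrightarrow> dt (\<lambda>s. upr (t s) (u s))"
  unfolding upr_def by (intro dfs)

lemma dt_un [dfs]: "dt t \<Longrightarrow> dt u \<Longrightarrow> dt (\<lambda>s. un (t s) (u s))"
  unfolding un_def by (intro dfs)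

lemma dt_pr [dfs]: "dt t \<Longrightarrow> dt u \<Longrightarrow> dt (\<lambda>s. pr (t s) (u s))"
  unfolding pr_def by (intro dfs)

lemma upr_eq_iff: "upr x y = upr u v \<longleftrightarrow> (x = u \<and> y = v) \<or> (x = v \<and> y = u)"
proof
  assume "upr x y = upr u v"
  then have "z = x \<or> z = y \<longleftrightarrow> z = u \<or> z = v" for z using mem_upr[of z x y] mem_upr[of z u v] by simp
  from this[of x] this[of y] this[of u] this[of v]
  show "x = u \<and> y = v \<or> x = v \<and> y = u" by blast
qed (auto intro: set_eqI)

lemma pr_eq_iff [simp]: "pr x y = pr u v \<longleftrightarrow> x = u \<and> y = v"
  unfolding pr_def upr_eq_iff by auto

lemma mem_times [simp]: "p \<^bold>\<in> times a b \<longleftrightarrow> (\<exists>x y. x \<^bold>\<in> a \<and> y \<^bold>\<in> b \<and> p = pr x y)"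
proof -
  have "p \<^bold>\<in> power_set (power_set (un a b))" if "x \<^bold>\<in> a" "y \<^bold>\<in> b" "p = pr x y" for x y
    using that by (auto simp: mem_power_set subset_def pr_def)
  then show ?thesis unfolding times_def by (subst mem_SEP) (intro dfs, blast)
qed

lemma is_upair_iff [simp]: "is_upair p x y \<longleftrightarrow> p = upr x y"
  unfolding is_upair_def using set_eqI[of p "upr x y"] by auto

lemma is_opair_iff [simp]: "is_opair p x y \<longleftrightarrow> p = pr x y"
  unfolding is_opair_def pr_def using set_eqI[of p "upr (upr x x) (upr x y)"] by auto

lemma is_empty_iff [simp]: "is_empty x \<longleftrightarrow> x = emp"
  unfolding is_empty_def using set_eqI[of x emp] by auto

lemma is_succ_iff [simp]: "is_succ y x \<longleftrightarrow> y = ins x x"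
  unfolding is_succ_def using set_eqI[of y "ins x x"] by auto

lemma maps_to_iff [simp]: "maps_to f x y \<longleftrightarrow> pr x y \<^bold>\<in> f"
  unfolding maps_to_def by simp

lemma mem_irrefl [simp]: "\<not> x \<^bold>\<in> x"
  using Foundation[rule_format, of "upr x x"] by (auto simp: is_empty_def simp del: is_empty_iff)

lemma mem_asym: "x \<^bold>\<in> y \<Longrightarrow> \<not> y \<^bold>\<in> x"
  using Foundation[rule_format, of "upr x y"] by (auto simp: is_empty_def simp del: is_empty_iff)

text \<open>This is Foundation for the subset of \<open>a\<close> cut out by \<open>Q\<close>;
  induction on ordinals rests on it.\<close>

lemma ex_minimal:
  assumes "df (\<lambda>s. Q (s 0))" "x \<^bold>\<in> a" "Q x"
  shows "\<exists>y. y \<^bold>\<in> a \<and> Q y \<and> (\<forall>z. z \<^bold>\<in> y \<and> z \<^bold>\<in> a \<longrightarrow> \<not> Q z)"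
proof -
  have m: "y \<^bold>\<in> SEP a Q \<longleftrightarrow> y \<^bold>\<in> a \<and> Q y" for y by (rule mem_SEP[OF assms(1)])
  show ?thesis using Foundation[rule_format, of "SEP a Q"] assms(2,3) m
    unfolding is_empty_def by blast
qed

section \<open>Natural numbers and finite sets\<close>

lemma natural_emp: "natural emp"
  by (simp add: natural_def is_inductive_def)

lemma natural_succ: "natural n \<Longrightarrow> natural (ins n n)"
  by (simp add: natural_def is_inductive_def)

lemma ex_omega: "\<exists>w. \<forall>n. n \<^bold>\<in> w \<longleftrightarrow> natural n"
proof -
  obtain w where "is_inductive w" using Infinity by blast
  moreover have "df (\<lambda>s. natural (s 0))" by (intro dfs)
  ultimately show ?thesis using separation[of natural w] unfolding natural_def by blast
qed

definition om :: 'a where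
  "om = set_of natural"

lemma mem_om: "n \<^bold>\<in> om \<longleftrightarrow> natural n"
  unfolding om_def by (rule mem_set_of[OF ex_omega])

text \<open>A natural number lies in every inductive set, so it suffices that the subset of
  \<open>om\<close> cut out by \<open>Q\<close> is inductive. Forming this subset by Separation
  restricts \<open>Q\<close> to definable properties.\<close>

lemma nat_induct:
  assumes "df (\<lambda>s. Q (s 0))" "natural n" "Q emp" "\<And>n. natural n \<Longrightarrow> Q n \<Longrightarrow> Q (ins n n)"
  shows "Q n"
proof -
  have m: "n \<^bold>\<in> SEP om Q \<longleftrightarrow> natural n \<and> Q n" for n by (simp add: mem_SEP[OF assms(1)] mem_om)
  have "is_inductive (SEP om Q)"
    unfolding is_inductive_def m using assms(3,4) natural_emp natural_succ by auto
  with assms(2) m show ?thesis unfolding natural_def by blast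
qed

lemma bijection_iff: "bijection f X Y \<longleftrightarrow>
     (\<forall>p. p \<^bold>\<in> f \<longrightarrow> (\<exists>x y. x \<^bold>\<in> X \<and> y \<^bold>\<in> Y \<and> p = pr x y)) \<and>
     (\<forall>x. x \<^bold>\<in> X \<longrightarrow> (\<exists>!y. pr x y \<^bold>\<in> f)) \<and> (\<forall>y. y \<^bold>\<in> Y \<longrightarrow> (\<exists>!x. pr x y \<^bold>\<in> f))"
  unfolding bijection_def is_opair_iff maps_to_iff ..

lemma fin_emp [simp]: "fin emp"
proof -
  have "bijection emp emp emp" by (simp add: bijection_iff)
  then show ?thesis unfolding fin_def using natural_emp by blast
qed

lemma bijection_ins:
  assumes "bijection f X Y" "\<not> x \<^bold>\<in> X" "\<not> y \<^bold>\<in> Y"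
  shows "bijection (ins (pr x y) f) (ins x X) (ins y Y)"
proof -
  have 1: "pr u v \<^bold>\<in> f \<Longrightarrow> u \<^bold>\<in> X \<and> v \<^bold>\<in> Y" for u v using assms(1) unfolding bijection_iff by fastforce
  have 2: "\<exists>!y. pr x y \<^bold>\<in> f" if "x \<^bold>\<in> X" for x using assms(1) that unfolding bijection_iff by blast
  have 3: "\<exists>!x. pr x y \<^bold>\<in> f" if "y \<^bold>\<in> Y" for y using assms(1) that unfolding bijection_iff by blast
  show ?thesis unfolding bijection_iff
  proof (intro conjI allI impI)
    fix p assume "p \<^bold>\<in> ins (pr x y) f"
    then show "\<exists>u v. u \<^bold>\<in> ins x X \<and> v \<^bold>\<in> ins y Y \<and> p = pr u v"
      using assms(1) unfolding bijection_iff by fastforce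
  next
    fix u assume "u \<^bold>\<in> ins x X"
    then show "\<exists>!v. pr u v \<^bold>\<in> ins (pr x y) f" using 1 2[of u] assms(2) by auto
  next
    fix v assume "v \<^bold>\<in> ins y Y"
    then show "\<exists>!u. pr u v \<^bold>\<in> ins (pr x y) f" using 1 3[of v] assms(3) by auto
  qed
qed

lemma bijection_rem:
  assumes "bijection f X Y" "pr x y \<^bold>\<in> f"
  shows "bijection (rem (pr x y) f) (rem x X) (rem y Y)"
proof -
  have 1: "pr u v \<^bold>\<in> f \<Longrightarrow> u \<^bold>\<in> X \<and> v \<^bold>\<in> Y" for u v using assms(1) unfolding bijection_iff by fastforce
  have 2: "\<exists>!y. pr x y \<^bold>\<in> f" if "x \<^bold>\<in> X" for x using assms(1) that unfolding bijection_iff by blast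
  have 3: "\<exists>!x. pr x y \<^bold>\<in> f" if "y \<^bold>\<in> Y" for y using assms(1) that unfolding bijection_iff by blast
  show ?thesis unfolding bijection_iff
  proof (intro conjI allI impI)
    fix p assume p: "p \<^bold>\<in> rem (pr x y) f"
    then obtain u v where "p = pr u v" using assms(1) unfolding bijection_iff by fastforce
    then show "\<exists>u v. u \<^bold>\<in> rem x X \<and> v \<^bold>\<in> rem y Y \<and> p = pr u v"
      using p 1[of u v] 1[OF assms(2)] 2[of x] 3[of y] assms(2) by auto
  next
    fix u assume "u \<^bold>\<in> rem x X"
    then show "\<exists>!v. pr u v \<^bold>\<in> rem (pr x y) f" using 2[of u] by auto
  next
    fix v assume "v \<^bold>\<in> rem y Y"
    then show "\<exists>!u. pr u v \<^bold>\<in> rem (pr x y) f" using 3[of v] by auto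
  qed
qed

lemma fin_ins:
  assumes "fin X"
  shows "fin (ins x X)"
proof (cases "x \<^bold>\<in> X")
  case True
  then have "ins x X = X" by (intro set_eqI) auto
  with assms show ?thesis by simp
next
  case False
  obtain n f where "natural n" "bijection f X n" using assms unfolding fin_def by blast
  then show ?thesis
    unfolding fin_def using bijection_ins[OF _ False, of f n n] natural_succ by auto
qed

lemma fin_induct:
  assumes "df (\<lambda>s. Q (s 0))" "fin x" "Q emp"
    and step: "\<And>x y. fin x \<Longrightarrow> Q x \<Longrightarrow> \<not> y \<^bold>\<in> x \<Longrightarrow> Q (ins y x)"
  shows "Q x"
proof -
  obtain n f where n: "natural n" "bijection f x n" using assms(2) unfolding fin_def by blast
  \<comment> \<open>Induction on the number of elements, for all sets of that size at once. In the
    step, the preimage of the last element \<open>n\<close> of \<open>ins n n\<close> is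
    removed.\<close>
  define P where "P n \<longleftrightarrow> (\<forall>x f. bijection f x n \<longrightarrow> Q x)" for n
  have Q: "df (\<lambda>s. Q (s i))" for i using df_ren[OF assms(1), of "\<lambda>_. i"] .
  have "P n"
  proof (rule nat_induct)
    show "df (\<lambda>s. P (s 0))" unfolding P_def by (intro dfs Q)
    show "P emp" unfolding P_def bijection_iff
      using assms(3) by (metis set_eqI mem_emp)
    fix n assume n: "natural n" "P n"
    show "P (ins n n)" unfolding P_def
    proof (intro allI impI)
      fix x f assume b: "bijection f x (ins n n)"
      then obtain y where y: "pr y n \<^bold>\<in> f" unfolding bijection_iff by auto
      have "y \<^bold>\<in> x" using b y unfolding bijection_iff by fastforce
      have "rem n (ins n n) = n" by (intro set_eqI) auto
      with bijection_rem[OF b y] have b': "bijection (rem (pr y n) f) (rem y x) n" by simp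
      then have "Q (rem y x)" using n unfolding P_def by blast
      moreover have "fin (rem y x)" using b' n unfolding fin_def by blast
      ultimately have "Q (ins y (rem y x))" by (intro step) auto
      moreover have "ins y (rem y x) = x" using \<open>y \<^bold>\<in> x\<close> by (intro set_eqI) auto
      ultimately show "Q x" by simp
    qed
  qed fact
  with n show ?thesis unfolding P_def by blast
qed

lemma fin_subset:
  assumes "fin x" "subset y x"
  shows "fin y"
proof -
  have "\<forall>y. subset y x \<longrightarrow> fin y"
  proof (rule fin_induct[OF _ assms(1)])
    show "df (\<lambda>s. \<forall>y. subset y (s 0) \<longrightarrow> fin y)" by (intro dfs)
    show "\<forall>y. subset y emp \<longrightarrow> fin y" by simp
    fix x z assume IH: "\<forall>y. subset y x \<longrightarrow> fin y"
    show "\<forall>y. subset y (ins z x) \<longrightarrow> fin y"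
    proof (intro allI impI)
      fix y assume y: "subset y (ins z x)"
      then have "subset (rem z y) x" by (auto simp: subset_def)
      then have "fin (rem z y)" using IH by blast
      then have "fin (ins z (rem z y))" by (rule fin_ins)
      moreover have "z \<^bold>\<in> y \<Longrightarrow> ins z (rem z y) = y" by (intro set_eqI) auto
      moreover have "\<not> z \<^bold>\<in> y \<Longrightarrow> rem z y = y" by (intro set_eqI) auto
      ultimately show "fin y" using \<open>fin (rem z y)\<close> by metis
    qed
  qed
  with assms(2) show ?thesis by blast
qed

lemma fin_un:
  assumes "fin x" "fin y"
  shows "fin (un x y)"
proof (rule fin_induct[OF _ assms(2), of "\<lambda>y. fin (un x y)"])
  show "df (\<lambda>s. fin (un x (s 0)))" by (intro dfs)
  have "un x emp = x" by (intro set_eqI) auto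
  then show "fin (un x emp)" using assms by simp
  fix y z assume "fin (un x y)"
  moreover have "un x (ins z y) = ins z (un x y)" by (intro set_eqI) auto
  ultimately show "fin (un x (ins z y))" by (simp add: fin_ins)
qed

lemma fin_upr: "fin (upr x y)"
  by (simp add: upr_def fin_ins)

text \<open>Finite classes: a definable class contained in a finite set is itself a finite set.\<close>

definition bnd :: "('a \<Rightarrow> bool) \<Rightarrow> bool" where
  "bnd P \<longleftrightarrow> (\<exists>d. fin d \<and> (\<forall>x. P x \<longrightarrow> x \<^bold>\<in> d))"

lemma bnd_mono: "bnd P \<Longrightarrow> (\<And>x. Q x \<Longrightarrow> P x) \<Longrightarrow> bnd Q"
  unfolding bnd_def by blast

lemma bnd_fin: "fin d \<Longrightarrow> bnd (\<lambda>x. x \<^bold>\<in> d)"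
  unfolding bnd_def by blast

lemma bnd_finD: "bnd (\<lambda>x. x \<^bold>\<in> d) \<Longrightarrow> fin d"
  unfolding bnd_def using fin_subset by (auto simp: subset_def)

lemma bnd_disj: "bnd P \<Longrightarrow> bnd Q \<Longrightarrow> bnd (\<lambda>x. P x \<or> Q x)"
  unfolding bnd_def by (metis fin_un mem_un)

lemma bnd_eq: "bnd (\<lambda>x. x = y)"
  unfolding bnd_def using fin_upr[of y y] by (intro exI[of _ "upr y y"]) auto

lemma df_bnd:
  assumes "df (\<lambda>s. P (s 0) (\<lambda>n. s (Suc n)))"
  shows "df (\<lambda>s. bnd (\<lambda>x. P x s))"
proof -
  have "df (\<lambda>s. P (s 0) (\<lambda>n. s (Suc (Suc n))))"
    using df_ren[OF assms, of "\<lambda>n. if n = 0 then 0 else Suc n"] by simp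
  then show ?thesis unfolding bnd_def by (intro dfs)
qed

text \<open>Induction on the index set takes the place of choosing a bound for every index. It runs
  over the subsets of \<open>a\<close>, since bounds are given only for indices in
  \<open>a\<close>.\<close>

lemma bnd_UN:
  assumes \<rho>: "df (\<lambda>s. \<rho> (s 0) (s 1))" and a: "fin a"
    and b: "\<And>k. k \<^bold>\<in> a \<Longrightarrow> bnd (\<rho> k)"
  shows "bnd (\<lambda>x. \<exists>k. k \<^bold>\<in> a \<and> \<rho> k x)"
proof -
  have \<rho>': "df (\<lambda>s. \<rho> (s i) (s j))" for i j
    using df_ren[OF \<rho>, of "\<lambda>n. if n = 0 then i else j"] by simp
  have "subset a a \<longrightarrow> bnd (\<lambda>x. \<exists>k. k \<^bold>\<in> a \<and> \<rho> k x)"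
  proof (rule fin_induct[OF _ a, of "\<lambda>c. subset c a \<longrightarrow> bnd (\<lambda>x. \<exists>k. k \<^bold>\<in> c \<and> \<rho> k x)"])
    show "df (\<lambda>s. subset (s 0) a \<longrightarrow> bnd (\<lambda>x. \<exists>k. k \<^bold>\<in> s 0 \<and> \<rho> k x))"
      by (intro dfs df_bnd \<rho>')
    show "subset emp a \<longrightarrow> bnd (\<lambda>x. \<exists>k. k \<^bold>\<in> emp \<and> \<rho> k x)"
      using bnd_mono[OF bnd_fin[OF fin_emp]] by simp
    fix c k assume IH: "subset c a \<longrightarrow> bnd (\<lambda>x. \<exists>k. k \<^bold>\<in> c \<and> \<rho> k x)"
    show "subset (ins k c) a \<longrightarrow> bnd (\<lambda>x. \<exists>l. l \<^bold>\<in> ins k c \<and> \<rho> l x)"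
    proof
      assume s: "subset (ins k c) a"
      then have "bnd (\<lambda>x. \<exists>k. k \<^bold>\<in> c \<and> \<rho> k x)" "bnd (\<rho> k)" using IH b by (auto simp: subset_def)
      from bnd_disj[OF this] show "bnd (\<lambda>x. \<exists>l. l \<^bold>\<in> ins k c \<and> \<rho> l x)"
        by (rule bnd_mono) auto
    qed
  qed
  then show ?thesis by (simp add: subset_def)
qed

lemma bnd_image:
  assumes "df (\<lambda>s. \<rho> (s 0) (s 1))" "bnd P"
    and inj: "\<And>k x y. P k \<Longrightarrow> \<rho> k x \<Longrightarrow> \<rho> k y \<Longrightarrow> x = y"
    and dP: "df (\<lambda>s. P (s 0))"
  shows "bnd (\<lambda>x. \<exists>k. P k \<and> \<rho> k x)"
proof -
  obtain d where d: "fin d" "\<And>k. P k \<Longrightarrow> k \<^bold>\<in> d" using assms(2) unfolding bnd_def by blast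
  define c where "c = SEP d P"
  have c: "k \<^bold>\<in> c \<longleftrightarrow> P k" for k unfolding c_def using mem_SEP[OF dP] d(2) by blast
  have "fin c" by (rule fin_subset[OF d(1)]) (auto simp: subset_def c d(2))
  have "bnd (\<lambda>x. \<exists>k. k \<^bold>\<in> c \<and> \<rho> k x)"
  proof (rule bnd_UN[OF assms(1) \<open>fin c\<close>])
    fix k assume "k \<^bold>\<in> c"
    then have P: "P k" using c by simp
    \<comment> \<open>At most one \<open>x\<close> is related to \<open>k\<close>.
      \<open>SOME\<close> merely names it in the metalogic; if there is none, any value serves as a
      bound.\<close>
    show "bnd (\<rho> k)"
      by (rule bnd_mono[OF bnd_eq[of "SOME x. \<rho> k x"]]) (blast intro: inj[OF P] someI)
  qed
  then show ?thesis by (simp add: c)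
qed

lemma fin_power_set:
  assumes "fin x"
  shows "fin (power_set x)"
proof (rule fin_induct[OF _ assms, of "\<lambda>x. fin (power_set x)"])
  show "df (\<lambda>s. fin (power_set (s 0)))" by (intro dfs)
  have "power_set emp = ins emp emp" by (intro set_eqI) (auto simp: mem_power_set subset_def intro: set_eqI)
  then show "fin (power_set emp)" by (simp add: fin_ins)
  fix x y assume f: "fin (power_set x)"
  have "bnd (\<lambda>w. \<exists>z. z \<^bold>\<in> power_set x \<and> (w = z \<or> w = ins y z))"
    by (rule bnd_UN[OF _ f]) (intro dfs bnd_disj bnd_eq)+
  then have "bnd (\<lambda>w. w \<^bold>\<in> power_set (ins y x))"
  proof (rule bnd_mono)
    fix w assume w: "w \<^bold>\<in> power_set (ins y x)"
    then have "rem y w \<^bold>\<in> power_set x" by (auto simp: mem_power_set subset_def)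
    moreover have "w = rem y w \<or> w = ins y (rem y w)"
      by (cases "y \<^bold>\<in> w") (auto intro!: set_eqI)
    ultimately show "\<exists>z. z \<^bold>\<in> power_set x \<and> (w = z \<or> w = ins y z)" by blast
  qed
  then show "fin (power_set (ins y x))" by (rule bnd_finD)
qed

lemma bnd_Pow:
  assumes "bnd P"
  shows "bnd (\<lambda>x. \<forall>z. z \<^bold>\<in> x \<longrightarrow> P z)"
proof -
  obtain d where "fin d" "\<And>k. P k \<Longrightarrow> k \<^bold>\<in> d" using assms unfolding bnd_def by blast
  then show ?thesis
    using fin_power_set[of d] unfolding bnd_def
    by (intro exI[of _ "power_set d"]) (auto simp: mem_power_set subset_def)
qed

end

context ZF
begin

section \<open>Cardinality of finite sets modulo 8\<close>

text \<open>Distinct elements of the model that stand for HOL numbers: the Zermelo numerals.\<close>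

primrec lab :: "nat \<Rightarrow> 'a" where
  "lab 0 = emp"
| "lab (Suc i) = upr (lab i) (lab i)"

lemma lab_inj [simp]: "lab i = lab j \<longleftrightarrow> i = j"
proof (induction i arbitrary: j)
  case 0
  show ?case by (cases j) (simp_all add: upr_neq_emp[symmetric])
next
  case (Suc i)
  then show ?case by (cases j) (simp_all add: upr_neq_emp upr_eq_iff)
qed

text \<open>A counter assigns to every finite subset of \<open>X\<close> (the label of) its cardinality modulo 8.\<close>

definition counter :: "'a \<Rightarrow> 'a \<Rightarrow> bool" where
  "counter c X \<longleftrightarrow> (\<forall>i<8. pr emp (lab i) \<^bold>\<in> c \<longleftrightarrow> i = 0) \<and>
     (\<forall>i<8. \<forall>Y y. subset (ins y Y) X \<and> \<not> y \<^bold>\<in> Y \<longrightarrow>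
        (pr (ins y Y) (lab (Suc i mod 8)) \<^bold>\<in> c \<longleftrightarrow> pr Y (lab i) \<^bold>\<in> c))"

lemma df_counter [dfs]: "dt t \<Longrightarrow> dt u \<Longrightarrow> df (\<lambda>s. counter (t s) (u s))"
proof (rule df_term2[where P = counter])
  show "df (\<lambda>s. counter (s 0) (s 1))" unfolding counter_def by (intro dfs)
qed

definition card8_is :: "'a \<Rightarrow> nat \<Rightarrow> bool" where
  "card8_is X i \<longleftrightarrow> (\<exists>c. counter c X \<and> pr X (lab i) \<^bold>\<in> c)"

lemma df_card8_is [dfs]: "dt t \<Longrightarrow> df (\<lambda>s. card8_is (t s) i)"
proof (rule df_term[where P = "\<lambda>x. card8_is x i"])
  show "df (\<lambda>s. card8_is (s 0) i)" unfolding card8_is_def by (intro dfs)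
qed

text \<open>The disjunct \<open>8 \<le> i\<close> makes 8 the default for sets without a residue. So
  the value is always below 9, and every property of it is a finite case distinction, hence
  definable.\<close>

definition card8 :: "'a \<Rightarrow> nat" where
  "card8 X = (LEAST i. 8 \<le> i \<or> card8_is X i)"

lemma card8_eq_iff: "card8 X = i \<longleftrightarrow> (8 \<le> i \<or> card8_is X i) \<and> (\<forall>j<i. \<not> (8 \<le> j \<or> card8_is X j))"
proof
  assume i: "card8 X = i"
  have "8 \<le> card8 X \<or> card8_is X (card8 X)" unfolding card8_def
    by (rule LeastI[of _ 8]) simp
  moreover have "\<not> (8 \<le> j \<or> card8_is X j)" if "j < card8 X" for j
    using not_less_Least[of j "\<lambda>i. 8 \<le> i \<or> card8_is X i"] that unfolding card8_def by blast
  ultimately show "(8 \<le> i \<or> card8_is X i) \<and> (\<forall>j<i. \<not> (8 \<le> j \<or> card8_is X j))" using i by blast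
next
  assume "(8 \<le> i \<or> card8_is X i) \<and> (\<forall>j<i. \<not> (8 \<le> j \<or> card8_is X j))"
  then show "card8 X = i" unfolding card8_def by (intro Least_equality) (auto simp: not_less[symmetric])
qed

lemma card8_le: "card8 X < 9"
  unfolding card8_def by (rule le_less_trans[OF Least_le[of _ 8]]) simp_all

lemma df_card8_eq: "dt t \<Longrightarrow> df (\<lambda>s. card8 (t s) = i)"
  unfolding card8_eq_iff by (intro dfs)

lemma df_card8_2:
  assumes "dt t" "dt u"
  shows "df (\<lambda>s. P (card8 (t s)) (card8 (u s)))"
proof -
  have "P (card8 X) (card8 Y) \<longleftrightarrow> (\<exists>i<9. \<exists>j<9. card8 X = i \<and> card8 Y = j \<and> P i j)" for X Y
    using card8_le by blast
  then show ?thesis by (simp only:) (intro dfs df_card8_eq assms)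
qed

lemma df_card8 [dfs]: "dt t \<Longrightarrow> df (\<lambda>s. P (card8 (t s)))"
  using df_card8_2[of t t "\<lambda>x y. P x"] by simp

text \<open>Adding 7 inverts the successor modulo 8, so the recursion of a counter can be read
  backwards.\<close>

lemma counter_step:
  assumes "counter c X" "subset (ins y Y) X" "\<not> y \<^bold>\<in> Y" "i < 8"
  shows "pr (ins y Y) (lab i) \<^bold>\<in> c \<longleftrightarrow> pr Y (lab ((i + 7) mod 8)) \<^bold>\<in> c"
proof -
  have "Suc ((i + 7) mod 8) mod 8 = i" using assms(4) by presburger
  with assms show ?thesis
    unfolding counter_def by (metis mod_less_divisor zero_less_numeral)
qed

lemma counter_unique:
  assumes "counter c X" "counter d X'" "fin Y" "subset Y X" "subset Y X'" "i < 8"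
  shows "pr Y (lab i) \<^bold>\<in> c \<longleftrightarrow> pr Y (lab i) \<^bold>\<in> d"
proof -
  have "subset Y X \<and> subset Y X' \<longrightarrow> (\<forall>i<8. pr Y (lab i) \<^bold>\<in> c \<longleftrightarrow> pr Y (lab i) \<^bold>\<in> d)"
  proof (rule fin_induct[OF _ assms(3)])
    show "df (\<lambda>s. subset (s 0) X \<and> subset (s 0) X' \<longrightarrow> (\<forall>i<8. pr (s 0) (lab i) \<^bold>\<in> c \<longleftrightarrow> pr (s 0) (lab i) \<^bold>\<in> d))"
      by (intro dfs)
    show "subset emp X \<and> subset emp X' \<longrightarrow> (\<forall>i<8. pr emp (lab i) \<^bold>\<in> c \<longleftrightarrow> pr emp (lab i) \<^bold>\<in> d)"
      using assms(1,2) unfolding counter_def by blast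
    fix Y y
    assume IH: "subset Y X \<and> subset Y X' \<longrightarrow> (\<forall>i<8. pr Y (lab i) \<^bold>\<in> c \<longleftrightarrow> pr Y (lab i) \<^bold>\<in> d)"
      and y: "\<not> y \<^bold>\<in> Y"
    show "subset (ins y Y) X \<and> subset (ins y Y) X' \<longrightarrow>
        (\<forall>i<8. pr (ins y Y) (lab i) \<^bold>\<in> c \<longleftrightarrow> pr (ins y Y) (lab i) \<^bold>\<in> d)"
    proof (intro impI allI)
      fix i :: nat assume s: "subset (ins y Y) X \<and> subset (ins y Y) X'" and i: "i < 8"
      have "subset Y X \<and> subset Y X'" using s by (auto simp: subset_def)
      then show "pr (ins y Y) (lab i) \<^bold>\<in> c \<longleftrightarrow> pr (ins y Y) (lab i) \<^bold>\<in> d"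
        using IH counter_step[OF assms(1) _ y i] counter_step[OF assms(2) _ y i] s by simp
    qed
  qed
  with assms show ?thesis by blast
qed

lemma counter_ex1:
  assumes "counter c X" "fin Y" "subset Y X"
  shows "\<exists>i<8. \<forall>j<8. pr Y (lab j) \<^bold>\<in> c \<longleftrightarrow> j = i"
proof -
  have "subset Y X \<longrightarrow> (\<exists>i<8. \<forall>j<8. pr Y (lab j) \<^bold>\<in> c \<longleftrightarrow> j = i)"
  proof (rule fin_induct[OF _ assms(2)])
    show "df (\<lambda>s. subset (s 0) X \<longrightarrow> (\<exists>i<8. \<forall>j<8. pr (s 0) (lab j) \<^bold>\<in> c \<longleftrightarrow> j = i))"
      by (intro dfs)
    show "subset emp X \<longrightarrow> (\<exists>i<8. \<forall>j<8. pr emp (lab j) \<^bold>\<in> c \<longleftrightarrow> j = i)"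
      using assms(1) unfolding counter_def by (intro impI exI[of _ 0]) simp
    fix Y y
    assume IH: "subset Y X \<longrightarrow> (\<exists>i<8. \<forall>j<8. pr Y (lab j) \<^bold>\<in> c \<longleftrightarrow> j = i)" and y: "\<not> y \<^bold>\<in> Y"
    show "subset (ins y Y) X \<longrightarrow> (\<exists>i<8. \<forall>j<8. pr (ins y Y) (lab j) \<^bold>\<in> c \<longleftrightarrow> j = i)"
    proof
      assume s: "subset (ins y Y) X"
      then have "subset Y X" by (auto simp: subset_def)
      then obtain i where i: "i < 8" "\<forall>j<8. pr Y (lab j) \<^bold>\<in> c \<longleftrightarrow> j = i" using IH by blast
      have "pr (ins y Y) (lab j) \<^bold>\<in> c \<longleftrightarrow> j = Suc i mod 8" if "j < 8" for j
      proof -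
        have "(j + 7) mod 8 = i \<longleftrightarrow> j = Suc i mod 8" using that i(1) by (auto simp: mod_if)
        then show ?thesis using counter_step[OF assms(1) s y that] i(2) by simp
      qed
      then show "\<exists>i<8. \<forall>j<8. pr (ins y Y) (lab j) \<^bold>\<in> c \<longleftrightarrow> j = i"
        by (intro exI[of _ "Suc i mod 8"]) simp
    qed
  qed
  with assms show ?thesis by blast
qed

lemma counter_exists: "fin X \<Longrightarrow> \<exists>c. counter c X"
proof (rule fin_induct[of "\<lambda>X. \<exists>c. counter c X"])
  show "df (\<lambda>s. \<exists>c. counter c (s 0))" by (intro dfs)
  have "counter (ins (pr emp emp) emp) emp"
    using lab_inj[of _ 0] by (simp add: counter_def del: lab_inj)
  then show "\<exists>c. counter c emp" by blast
  fix X x assume "\<exists>c. counter c X" and x: "\<not> x \<^bold>\<in> X"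
  then obtain c where c: "counter c X" by blast
  define L where "L = ins (lab 0) (ins (lab 1) (ins (lab 2) (ins (lab 3)
    (ins (lab 4) (ins (lab 5) (ins (lab 6) (ins (lab 7) emp)))))))"
  have L: "lab i \<^bold>\<in> L" if "i < 8" for i
    using that unfolding L_def by (auto simp: eval_nat_numeral less_Suc_eq simp del: lab.simps)
  \<comment> \<open>Sets without \<open>x\<close> keep their value. For sets with \<open>x\<close>,
    the value of \<open>rem x Y\<close> is increased by one, hence the test at \<open>i + 7\<close>
    modulo 8.\<close>
  define c' where "c' = SEP (times (power_set (ins x X)) L)
    (\<lambda>p. \<exists>Y. \<exists>i<8. p = pr Y (lab i) \<and>
      (\<not> x \<^bold>\<in> Y \<and> pr Y (lab i) \<^bold>\<in> c \<or> x \<^bold>\<in> Y \<and> pr (rem x Y) (lab ((i + 7) mod 8)) \<^bold>\<in> c))"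
  have m: "pr Y (lab i) \<^bold>\<in> c' \<longleftrightarrow>
      (\<not> x \<^bold>\<in> Y \<and> pr Y (lab i) \<^bold>\<in> c \<or> x \<^bold>\<in> Y \<and> pr (rem x Y) (lab ((i + 7) mod 8)) \<^bold>\<in> c)"
    if "subset Y (ins x X)" "i < 8" for Y i
    unfolding c'_def by (subst mem_SEP, intro dfs) (use that L in \<open>auto simp: mem_power_set\<close>)
  have "counter c' (ins x X)" unfolding counter_def
  proof (intro conjI allI impI)
    fix i :: nat assume "i < 8"
    then show "pr emp (lab i) \<^bold>\<in> c' \<longleftrightarrow> i = 0"
      using c m[of emp i] unfolding counter_def by (simp add: subset_def)
  next
    fix i :: nat and Y y assume i: "i < 8" and Y: "subset (ins y Y) (ins x X) \<and> \<not> y \<^bold>\<in> Y"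
    have i': "(Suc i mod 8 + 7) mod 8 = i" "Suc ((i + 7) mod 8) mod 8 = i"
      using i by presburger+
    have Y': "subset Y (ins x X)" using Y by (auto simp: subset_def)
    consider "y = x" | "y \<noteq> x" "x \<^bold>\<in> Y" | "y \<noteq> x" "\<not> x \<^bold>\<in> Y" by blast
    then show "pr (ins y Y) (lab (Suc i mod 8)) \<^bold>\<in> c' \<longleftrightarrow> pr Y (lab i) \<^bold>\<in> c'"
    proof cases
      case 1
      then have "rem x (ins y Y) = Y" using Y by (intro set_eqI) auto
      then show ?thesis using 1 Y i' i m[OF Y' i] m[of "ins y Y" "Suc i mod 8"] by simp
    next
      case 2
      then have r: "rem x (ins y Y) = ins y (rem x Y)" using Y by (intro set_eqI) auto
      have "subset (ins y (rem x Y)) X" using 2 Y by (auto simp: subset_def)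
      then have "pr (ins y (rem x Y)) (lab (Suc ((i + 7) mod 8) mod 8)) \<^bold>\<in> c \<longleftrightarrow>
          pr (rem x Y) (lab ((i + 7) mod 8)) \<^bold>\<in> c"
        using c Y unfolding counter_def by (meson mem_rem mod_less_divisor zero_less_numeral)
      then show ?thesis using 2 Y i i' m[OF Y' i] m[of "ins y Y" "Suc i mod 8"] r by simp
    next
      case 3
      then have "subset (ins y Y) X" using Y by (auto simp: subset_def)
      then have "pr (ins y Y) (lab (Suc i mod 8)) \<^bold>\<in> c \<longleftrightarrow> pr Y (lab i) \<^bold>\<in> c"
        using c Y i unfolding counter_def by blast
      then show ?thesis using 3 Y i m[OF Y' i] m[of "ins y Y" "Suc i mod 8"] by simp
    qed
  qed
  then show "\<exists>c. counter c (ins x X)" by blast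
qed

text \<open>A counter on \<open>X\<close> is also a counter on the subset \<open>Y\<close>, and all
  counters agree there by \<open>counter_unique\<close>; so any of them computes the
  residue.\<close>

lemma card8_eq:
  assumes "counter c X" "fin Y" "subset Y X" "i < 8" "pr Y (lab i) \<^bold>\<in> c"
  shows "card8 Y = i"
proof -
  obtain i' where i': "i' < 8" "\<forall>j<8. pr Y (lab j) \<^bold>\<in> c \<longleftrightarrow> j = i'"
    using counter_ex1[OF assms(1-3)] by blast
  then have [simp]: "i' = i" using assms by blast
  have "counter c Y" using assms(1,3) unfolding counter_def
    by (auto simp: subset_def)
  have "card8_is Y j \<longleftrightarrow> j = i" if "j < 8" for j
  proof -
    have "pr Y (lab j) \<^bold>\<in> d \<longleftrightarrow> j = i" if "counter d Y" for d
      using counter_unique[OF that \<open>counter c Y\<close> assms(2) _ _ \<open>j < 8\<close>] i' \<open>j < 8\<close>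
      by (simp add: subset_def)
    then show ?thesis unfolding card8_is_def using \<open>counter c Y\<close> by blast
  qed
  then show ?thesis unfolding card8_eq_iff using assms(4) by auto
qed

lemma card8_emp [simp]: "card8 emp = 0"
proof -
  obtain c where c: "counter c emp" using counter_exists[OF fin_emp] by blast
  from c have "\<forall>i<8. pr emp (lab i) \<^bold>\<in> c \<longleftrightarrow> i = 0" unfolding counter_def by blast
  from this[rule_format, of 0] have "pr emp (lab 0) \<^bold>\<in> c" by simp
  then show ?thesis by (intro card8_eq[OF c fin_emp]) simp_all
qed

lemma card8_ins [simp]:
  assumes "fin X" "\<not> x \<^bold>\<in> X"
  shows "card8 (ins x X) = Suc (card8 X) mod 8"
proof -
  obtain c where c: "counter c (ins x X)" using counter_exists[OF fin_ins[OF assms(1)]] by blast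
  have s: "subset X (ins x X)" "subset (ins x X) (ins x X)" by (auto simp: subset_def)
  obtain i where i: "i < 8" "pr X (lab i) \<^bold>\<in> c" using counter_ex1[OF c assms(1) s(1)] by blast
  have "card8 X = i" by (rule card8_eq[OF c assms(1) s(1) i])
  moreover have "pr (ins x X) (lab (Suc i mod 8)) \<^bold>\<in> c"
    using c s(2) assms(2) i unfolding counter_def by blast
  then have "card8 (ins x X) = Suc i mod 8"
    by (intro card8_eq[OF c fin_ins[OF assms(1)] s(2)]) simp_all
  ultimately show ?thesis by simp
qed

lemma card8_less: "fin X \<Longrightarrow> card8 X < 8"
proof (rule fin_induct[of "\<lambda>X. card8 X < 8"])
  show "df (\<lambda>s. card8 (s 0) < 8)" by (intro dfs)
qed simp_all

lemma card8_un:
  assumes "fin X" "fin Y" "\<And>z. z \<^bold>\<in> X \<Longrightarrow> \<not> z \<^bold>\<in> Y"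
  shows "card8 (un X Y) = (card8 X + card8 Y) mod 8"
proof -
  have "(\<forall>z. z \<^bold>\<in> Y \<longrightarrow> \<not> z \<^bold>\<in> X) \<longrightarrow> card8 (un X Y) = (card8 X + card8 Y) mod 8"
  proof (rule fin_induct[OF _ assms(2)])
    show "df (\<lambda>s. (\<forall>z. z \<^bold>\<in> s 0 \<longrightarrow> \<not> z \<^bold>\<in> X) \<longrightarrow> card8 (un X (s 0)) = (card8 X + card8 (s 0)) mod 8)"
      by (intro dfs df_card8_2[where P = "\<lambda>i j. i = (card8 X + j) mod 8"])
    have "un X emp = X" by (intro set_eqI) auto
    then show "(\<forall>z. z \<^bold>\<in> emp \<longrightarrow> \<not> z \<^bold>\<in> X) \<longrightarrow> card8 (un X emp) = (card8 X + card8 emp) mod 8"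
      using card8_less[OF assms(1)] by simp
    fix Y y assume Y: "fin Y" "\<not> y \<^bold>\<in> Y"
      and IH: "(\<forall>z. z \<^bold>\<in> Y \<longrightarrow> \<not> z \<^bold>\<in> X) \<longrightarrow> card8 (un X Y) = (card8 X + card8 Y) mod 8"
    have "un X (ins y Y) = ins y (un X Y)" by (intro set_eqI) auto
    then show "(\<forall>z. z \<^bold>\<in> ins y Y \<longrightarrow> \<not> z \<^bold>\<in> X) \<longrightarrow> card8 (un X (ins y Y)) = (card8 X + card8 (ins y Y)) mod 8"
      using Y IH by (auto simp: fin_un assms(1) mod_simps)
  qed
  with assms show ?thesis by blast
qed

text \<open>Images under the class relation are formed inside \<open>Y\<close> by Separation. The
  induction adds one element to a part of \<open>X\<close> and, by injectivity, one new element to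
  its image.\<close>

lemma card8_bij:
  assumes \<rho>: "df (\<lambda>s. \<rho> (s 0) (s 1))" and X: "fin X"
    and tot: "\<And>x. x \<^bold>\<in> X \<Longrightarrow> \<exists>y. y \<^bold>\<in> Y \<and> \<rho> x y"
    and func: "\<And>x y y'. x \<^bold>\<in> X \<Longrightarrow> y \<^bold>\<in> Y \<Longrightarrow> y' \<^bold>\<in> Y \<Longrightarrow> \<rho> x y \<Longrightarrow> \<rho> x y' \<Longrightarrow> y = y'"
    and inj: "\<And>x x' y. x \<^bold>\<in> X \<Longrightarrow> x' \<^bold>\<in> X \<Longrightarrow> y \<^bold>\<in> Y \<Longrightarrow> \<rho> x y \<Longrightarrow> \<rho> x' y \<Longrightarrow> x = x'"
    and onto: "\<And>y. y \<^bold>\<in> Y \<Longrightarrow> \<exists>x. x \<^bold>\<in> X \<and> \<rho> x y"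
  shows "card8 X = card8 Y"
proof -
  have \<rho>': "df (\<lambda>s. \<rho> (s i) (s j))" for i j
    using df_ren[OF \<rho>, of "\<lambda>n. if n = 0 then i else j"] by simp
  define im where "im V = SEP Y (\<lambda>y. \<exists>x. x \<^bold>\<in> V \<and> \<rho> x y)" for V
  have im: "y \<^bold>\<in> im V \<longleftrightarrow> y \<^bold>\<in> Y \<and> (\<exists>x. x \<^bold>\<in> V \<and> \<rho> x y)" for y V
    unfolding im_def by (rule mem_SEP) (intro dfs \<rho>')
  have "subset X X \<longrightarrow> fin (im X) \<and> card8 X = card8 (im X)"
  proof (rule fin_induct[OF _ X, of "\<lambda>V. subset V X \<longrightarrow> fin (im V) \<and> card8 V = card8 (im V)"])
    show "df (\<lambda>s. subset (s 0) X \<longrightarrow> fin (im (s 0)) \<and> card8 (s 0) = card8 (im (s 0)))"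
      unfolding im_def by (intro dfs df_card8_2[where P = "\<lambda>i j. i = j"] \<rho>')
    have "im emp = emp" by (rule set_eqI) (simp add: im)
    then show "subset emp X \<longrightarrow> fin (im emp) \<and> card8 emp = card8 (im emp)" by simp
    fix V x assume V: "fin V" "\<not> x \<^bold>\<in> V" and IH: "subset V X \<longrightarrow> fin (im V) \<and> card8 V = card8 (im V)"
    show "subset (ins x V) X \<longrightarrow> fin (im (ins x V)) \<and> card8 (ins x V) = card8 (im (ins x V))"
    proof
      assume "subset (ins x V) X"
      then have V': "\<And>v. v \<^bold>\<in> V \<Longrightarrow> v \<^bold>\<in> X" "subset V X" "x \<^bold>\<in> X" by (auto simp: subset_def)
      obtain y where y: "y \<^bold>\<in> Y" "\<rho> x y" using tot[OF V'(3)] by blast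
      have "im (ins x V) = ins y (im V)"
        using y func[OF V'(3)] by (intro set_eqI) (auto simp: im)
      moreover have "\<not> y \<^bold>\<in> im V" using y inj V' V(2) im by metis
      ultimately show "fin (im (ins x V)) \<and> card8 (ins x V) = card8 (im (ins x V))"
        using IH V' V by (simp add: fin_ins)
    qed
  qed
  moreover have "im X = Y" using onto by (intro set_eqI) (auto simp: im)
  ultimately show ?thesis by (simp add: subset_def)
qed

text \<open>Every new index contributes a fibre of size \<open>w\<close> modulo 8 that is disjoint
  from the previous ones.\<close>

lemma card8_UN:
  assumes \<rho>: "df (\<lambda>s. \<rho> (s 0) (s 1))" and Y: "fin Y" and Z: "fin Z"
    and disj: "\<And>z z' T. z \<^bold>\<in> Z \<Longrightarrow> z' \<^bold>\<in> Z \<Longrightarrow> T \<^bold>\<in> Y \<Longrightarrow> \<rho> z T \<Longrightarrow> \<rho> z' T \<Longrightarrow> z = z'"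
    and card: "\<And>z. z \<^bold>\<in> Z \<Longrightarrow> card8 (SEP Y (\<rho> z)) = w"
  shows "card8 (SEP Y (\<lambda>T. \<exists>z. z \<^bold>\<in> Z \<and> \<rho> z T)) = (card8 Z * w) mod 8"
proof -
  have \<rho>': "df (\<lambda>s. \<rho> (s i) (s j))" "df (\<lambda>s. \<rho> z (s j))" for i j z
    using df_ren[OF \<rho>, of "\<lambda>n. if n = 0 then i else j"]
      df_subst[OF \<rho>, of "\<lambda>n. if n = 0 then Inr z else Inl j"] by simp_all
  define im where "im V = SEP Y (\<lambda>T. \<exists>z. z \<^bold>\<in> V \<and> \<rho> z T)" for V
  have im: "T \<^bold>\<in> im V \<longleftrightarrow> T \<^bold>\<in> Y \<and> (\<exists>z. z \<^bold>\<in> V \<and> \<rho> z T)" for T V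
    unfolding im_def by (rule mem_SEP) (intro dfs \<rho>')
  have X: "T \<^bold>\<in> SEP Y (\<rho> z) \<longleftrightarrow> T \<^bold>\<in> Y \<and> \<rho> z T" for z T by (rule mem_SEP) (rule \<rho>')
  have fin_im: "fin (im V)" for V by (rule fin_subset[OF Y]) (simp add: subset_def im)
  have fin_X: "fin (SEP Y (\<rho> z))" for z by (rule fin_subset[OF Y]) (simp add: subset_def X)
  have "subset Z Z \<longrightarrow> card8 (im Z) = (card8 Z * w) mod 8"
  proof (rule fin_induct[OF _ Z, of "\<lambda>V. subset V Z \<longrightarrow> card8 (im V) = (card8 V * w) mod 8"])
    show "df (\<lambda>s. subset (s 0) Z \<longrightarrow> card8 (im (s 0)) = (card8 (s 0) * w) mod 8)"
      unfolding im_def by (intro dfs df_card8_2[where P = "\<lambda>i j. i = (j * w) mod 8"] \<rho>')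
    have "im emp = emp" by (rule set_eqI) (simp add: im)
    then show "subset emp Z \<longrightarrow> card8 (im emp) = (card8 emp * w) mod 8" by simp
    fix V x assume V: "fin V" "\<not> x \<^bold>\<in> V" and IH: "subset V Z \<longrightarrow> card8 (im V) = (card8 V * w) mod 8"
    show "subset (ins x V) Z \<longrightarrow> card8 (im (ins x V)) = (card8 (ins x V) * w) mod 8"
    proof
      assume "subset (ins x V) Z"
      then have V': "\<And>v. v \<^bold>\<in> V \<Longrightarrow> v \<^bold>\<in> Z" "subset V Z" "x \<^bold>\<in> Z" by (auto simp: subset_def)
      have "im (ins x V) = un (im V) (SEP Y (\<rho> x))" by (intro set_eqI) (auto simp: im X)
      moreover have "card8 (un (im V) (SEP Y (\<rho> x))) = (card8 (im V) + card8 (SEP Y (\<rho> x))) mod 8"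
        by (rule card8_un[OF fin_im fin_X]) (use disj V' V(2) in \<open>auto simp: im X\<close>)
      ultimately show "card8 (im (ins x V)) = (card8 (ins x V) * w) mod 8"
        using IH V V' card by (simp add: mod_simps add.commute)
    qed
  qed
  then show ?thesis by (simp add: subset_def im_def)
qed

end

section \<open>Bell numbers modulo 8\<close>

text \<open>\<open>bell8 n ! r\<close> is, modulo 8, the number of partitions of a set of \<open>n + r\<close> elements of which
  \<open>r\<close> distinguished ones lie in distinct blocks. It depends on \<open>r\<close> only modulo 8.\<close>

definition bell8_step :: "nat list \<Rightarrow> nat list" where
  "bell8_step b = map (\<lambda>r. (r * b ! r + b ! (Suc r mod 8)) mod 8) [0..<8]"

primrec bell8 :: "nat \<Rightarrow> nat list" where
  "bell8 0 = [1, 1, 1, 1, 1, 1, 1, 1]"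
| "bell8 (Suc n) = bell8_step (bell8 n)"

lemma bell8_nth_Suc:
  "r < 8 \<Longrightarrow> bell8 (Suc n) ! r = (r * bell8 n ! r + bell8 n ! (Suc r mod 8)) mod 8"
  by (simp add: bell8_step_def)

text \<open>Each list is a function of the preceding one, so the sequence repeats with period 24,
  and divisibility of Bell numbers by 8 becomes a finite check.\<close>

lemma bell8_period: "bell8 24 = bell8 0"
  by code_simp

lemma bell8_nonzero: "n < 24 \<Longrightarrow> bell8 n ! 0 \<noteq> 0"
proof -
  have "\<forall>n\<in>set [0..<24]. bell8 n ! 0 \<noteq> 0" by code_simp
  then show "n < 24 \<Longrightarrow> bell8 n ! 0 \<noteq> 0" by simp
qed

section \<open>Finitary partitions coded by subsets\<close>

text \<open>\<open>E T x y\<close> says that \<open>x\<close> and \<open>y\<close> lie in the same block of the partition coded by \<open>T\<close>.\<close>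

locale coded_partitions = ZF +
  fixes A :: 'a and E :: "'a \<Rightarrow> 'a \<Rightarrow> 'a \<Rightarrow> bool"
  assumes df_E0: "df (\<lambda>s. E (s 0) (s 1) (s 2))"
    and E_in: "E T x y \<Longrightarrow> subset T A \<and> x \<^bold>\<in> A \<and> y \<^bold>\<in> A"
    and E_refl: "subset T A \<Longrightarrow> x \<^bold>\<in> A \<Longrightarrow> E T x x"
    and E_sym: "E T x y \<Longrightarrow> E T y x"
    and E_trans: "E T x y \<Longrightarrow> E T y z \<Longrightarrow> E T x z"
    and E_fin: "subset T A \<Longrightarrow> bnd (\<lambda>x. \<exists>y. y \<noteq> x \<and> E T x y)"
    and E_inj: "subset T A \<Longrightarrow> subset T' A \<Longrightarrow> (\<And>x y. E T x y \<longleftrightarrow> E T' x y) \<Longrightarrow> T = T'"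
    and E_surj: "df (\<lambda>s. Q (s 0) (s 1)) \<Longrightarrow> (\<And>x y. Q x y \<Longrightarrow> x \<^bold>\<in> A) \<Longrightarrow> (\<And>x. x \<^bold>\<in> A \<Longrightarrow> Q x x) \<Longrightarrow>
      (\<And>x y. Q x y \<Longrightarrow> Q y x) \<Longrightarrow> (\<And>x y z. Q x y \<Longrightarrow> Q y z \<Longrightarrow> Q x z) \<Longrightarrow>
      bnd (\<lambda>x. \<exists>y. y \<noteq> x \<and> Q x y) \<Longrightarrow> \<exists>T. subset T A \<and> (\<forall>x y. E T x y \<longleftrightarrow> Q x y)"
begin

lemma df_E [dfs]: "dt t \<Longrightarrow> dt u \<Longrightarrow> dt v \<Longrightarrow> df (\<lambda>s. E (t s) (u s) (v s))"
  by (rule df_term3[where P = E, OF df_E0])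

definition supp :: "'a \<Rightarrow> 'a \<Rightarrow> bool" where
  "supp T x \<longleftrightarrow> (\<exists>y. y \<noteq> x \<and> E T x y)"

lemma df_supp [dfs]: "dt t \<Longrightarrow> dt u \<Longrightarrow> df (\<lambda>s. supp (t s) (u s))"
proof (rule df_term2[where P = supp])
  show "df (\<lambda>s. supp (s 0) (s 1))" unfolding supp_def by (intro dfs)
qed

lemma suppD: "E T x y \<Longrightarrow> x \<noteq> y \<Longrightarrow> supp T x" "E T x y \<Longrightarrow> x \<noteq> y \<Longrightarrow> supp T y"
  unfolding supp_def by (metis E_sym)+

lemma supp_in: "supp T x \<Longrightarrow> x \<^bold>\<in> A"
  unfolding supp_def using E_in by blast

lemma bnd_supp: "subset T A \<Longrightarrow> bnd (supp T)"
  unfolding supp_def[abs_def] by (rule E_fin)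

text \<open>A code is determined by the set of unordered pairs of distinct equivalent elements. If
  the support lies in the finite set \<open>d\<close>, this set of pairs is included in the finite
  set \<open>power_set d\<close>.\<close>

lemma bnd_supported:
  assumes "bnd P"
  shows "bnd (\<lambda>T. subset T A \<and> (\<forall>x. supp T x \<longrightarrow> P x))"
proof -
  obtain d where d: "fin d" "\<And>x. P x \<Longrightarrow> x \<^bold>\<in> d" using assms unfolding bnd_def by blast
  define \<rho> where "\<rho> c T \<longleftrightarrow> subset T A \<and> (\<forall>p. p \<^bold>\<in> c \<longleftrightarrow> (\<exists>x y. x \<noteq> y \<and> E T x y \<and> p = upr x y))" for c T
  have E_iff: "E T x y \<longleftrightarrow> x = y \<and> x \<^bold>\<in> A \<or> x \<noteq> y \<and> upr x y \<^bold>\<in> c" if "\<rho> c T" for c T x y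
    using that E_in E_refl E_sym unfolding \<rho>_def by (metis upr_eq_iff)
  have "bnd (\<lambda>T. \<exists>c. c \<^bold>\<in> power_set (power_set d) \<and> \<rho> c T)"
  proof (rule bnd_image)
    show "df (\<lambda>s. \<rho> (s 0) (s 1))" unfolding \<rho>_def by (intro dfs)
    show "bnd (\<lambda>c. c \<^bold>\<in> power_set (power_set d))"
      by (intro bnd_fin fin_power_set d)
    fix c T T' assume *: "\<rho> c T" "\<rho> c T'"
    show "T = T'"
    proof (rule E_inj)
      show "subset T A" "subset T' A" using * unfolding \<rho>_def by blast+
      show "E T x y \<longleftrightarrow> E T' x y" for x y
        using E_iff[OF *(1), of x y] E_iff[OF *(2), of x y] by simp
    qed
  qed (intro dfs)
  then show ?thesis
  proof (rule bnd_mono)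
    fix T assume T: "subset T A \<and> (\<forall>x. supp T x \<longrightarrow> P x)"
    define c where "c = SEP (power_set d) (\<lambda>p. \<exists>x y. x \<noteq> y \<and> E T x y \<and> p = upr x y)"
    have c: "p \<^bold>\<in> c \<longleftrightarrow> p \<^bold>\<in> power_set d \<and> (\<exists>x y. x \<noteq> y \<and> E T x y \<and> p = upr x y)" for p
      unfolding c_def by (rule mem_SEP) (intro dfs)
    have "upr x y \<^bold>\<in> power_set d" if "E T x y" "x \<noteq> y" for x y
      using suppD[OF that] T d(2) by (auto simp: mem_power_set subset_def)
    then have "\<rho> c T" unfolding \<rho>_def c using T by blast
    moreover have "c \<^bold>\<in> power_set (power_set d)" by (simp add: mem_power_set[of c] subset_def c)
    ultimately show "\<exists>c. c \<^bold>\<in> power_set (power_set d) \<and> \<rho> c T" by blast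
  qed
qed

text \<open>For disjoint \<open>F\<close> and \<open>Z\<close>, these are the partitions counted by
  \<open>bell8\<close>: the elements of \<open>F\<close> are free, those of \<open>Z\<close> are the
  distinguished ones.\<close>

definition sep_ptns :: "'a \<Rightarrow> 'a \<Rightarrow> 'a" where
  "sep_ptns F Z = SEP (power_set A) (\<lambda>T. (\<forall>y. supp T y \<longrightarrow> y \<^bold>\<in> F \<or> y \<^bold>\<in> Z) \<and>
     (\<forall>z z'. z \<^bold>\<in> Z \<and> z' \<^bold>\<in> Z \<and> E T z z' \<longrightarrow> z = z'))"

lemma mem_sep_ptns: "T \<^bold>\<in> sep_ptns F Z \<longleftrightarrow> subset T A \<and> (\<forall>y. supp T y \<longrightarrow> y \<^bold>\<in> F \<or> y \<^bold>\<in> Z) \<and>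
     (\<forall>z z'. z \<^bold>\<in> Z \<and> z' \<^bold>\<in> Z \<and> E T z z' \<longrightarrow> z = z')"
  unfolding sep_ptns_def by (subst mem_SEP) (intro dfs, simp add: mem_power_set)

lemma dt_sep_ptns [dfs]:
  assumes "dt t" "dt u"
  shows "dt (\<lambda>s. sep_ptns (t s) (u s))"
proof (rule dt_op2[OF _ assms])
  show "df (\<lambda>s. s 0 = sep_ptns (s 1) (s 2))" unfolding sep_ptns_def by (intro dfs)
qed

lemma fin_sep_ptns:
  assumes "fin F" "fin Z"
  shows "fin (sep_ptns F Z)"
  by (rule bnd_finD, rule bnd_mono[OF bnd_supported[OF bnd_disj[OF bnd_fin[OF assms(1)] bnd_fin[OF assms(2)]]]])
     (auto simp: mem_sep_ptns)

text \<open>Distinct equivalent elements would both lie in \<open>Z\<close>, which is excluded; only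
  the partition into singletons remains. This accounts for the ones in
  \<open>bell8 0\<close>.\<close>

lemma card8_sep_ptns_emp:
  assumes "fin Z"
  shows "card8 (sep_ptns emp Z) = 1"
proof -
  have "\<exists>T. subset T A \<and> (\<forall>x y. E T x y \<longleftrightarrow> x = y \<and> x \<^bold>\<in> A)"
    by (rule E_surj) (intro dfs | auto intro!: bnd_mono[OF bnd_fin[OF fin_emp]])+
  then obtain T where T: "subset T A" "\<And>x y. E T x y \<longleftrightarrow> x = y \<and> x \<^bold>\<in> A" by blast
  have "sep_ptns emp Z = ins T emp"
  proof (rule set_eqI)
    fix T'
    show "T' \<^bold>\<in> sep_ptns emp Z \<longleftrightarrow> T' \<^bold>\<in> ins T emp"
    proof
      assume T': "T' \<^bold>\<in> sep_ptns emp Z"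
      have "E T' x y \<longleftrightarrow> x = y \<and> x \<^bold>\<in> A" for x y
        using T' suppD[of T' x y] E_in[of T' x y] E_refl[of T' x] unfolding mem_sep_ptns by auto
      with T T' have "T' = T" by (intro E_inj) (auto simp: mem_sep_ptns)
      then show "T' \<^bold>\<in> ins T emp" by simp
    qed (auto simp: mem_sep_ptns T supp_def)
  qed
  then show ?thesis by simp
qed

text \<open>Turning \<open>x\<close> into a singleton is a bijection, whose inverse puts
  \<open>x\<close> into the block of \<open>z\<close>. Equivalence among the elements other than
  \<open>x\<close> is preserved both ways, and this is the relation \<open>?\<rho>\<close>.\<close>

lemma card8_sep_ptns_join:
  assumes F: "fin F" "subset F A" and Z: "fin Z" "subset Z A" "\<And>z. z \<^bold>\<in> Z \<Longrightarrow> \<not> z \<^bold>\<in> F"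
    and x: "x \<^bold>\<in> A" "\<not> x \<^bold>\<in> F" "\<not> x \<^bold>\<in> Z" and z: "z \<^bold>\<in> Z"
  shows "card8 (SEP (sep_ptns (ins x F) Z) (\<lambda>T. E T x z)) = card8 (sep_ptns F Z)"
proof (rule card8_bij)
  have S: "T \<^bold>\<in> SEP (sep_ptns (ins x F) Z) (\<lambda>T. E T x z) \<longleftrightarrow> T \<^bold>\<in> sep_ptns (ins x F) Z \<and> E T x z" for T
    by (rule mem_SEP) (intro dfs)
  let ?\<rho> = "\<lambda>T T'. \<forall>u v. u \<noteq> x \<and> v \<noteq> x \<longrightarrow> (E T u v \<longleftrightarrow> E T' u v)"
  have zx: "z \<noteq> x" "z \<^bold>\<in> A" using x z Z by (auto simp: subset_def)
  have E': "E T' x v \<longleftrightarrow> v = x" if "T' \<^bold>\<in> sep_ptns F Z" for T' v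
    using that suppD(1)[of T' x v] x E_refl[of T' x] unfolding mem_sep_ptns by metis
  show "df (\<lambda>s. ?\<rho> (s 0) (s 1))" by (intro dfs)
  show "fin (SEP (sep_ptns (ins x F) Z) (\<lambda>T. E T x z))"
    by (rule fin_subset[OF fin_sep_ptns[of "ins x F" Z]]) (auto simp: fin_ins F Z subset_def S)
  fix T T' assume T: "T \<^bold>\<in> SEP (sep_ptns (ins x F) Z) (\<lambda>T. E T x z)" and T': "T' \<^bold>\<in> sep_ptns F Z"
  fix T1 T1' assume T1: "T1 \<^bold>\<in> SEP (sep_ptns (ins x F) Z) (\<lambda>T. E T x z)" and T1': "T1' \<^bold>\<in> sep_ptns F Z"
  show "T' = T1'" if \<rho>: "?\<rho> T T'" "?\<rho> T T1'"
  proof (rule E_inj)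
    fix u v show "E T' u v \<longleftrightarrow> E T1' u v"
      using \<rho> E'[OF T'] E'[OF T1'] E_sym by metis
  qed (use T' T1' in \<open>auto simp: mem_sep_ptns\<close>)
  show "T = T1" if \<rho>: "?\<rho> T T'" "?\<rho> T1 T'"
  proof (rule E_inj)
    \<comment> \<open>The block of \<open>x\<close> is recovered from that of \<open>z\<close>, so
      what happens away from \<open>x\<close> determines the code.\<close>
    have ex: "E T2 x v \<longleftrightarrow> v = x \<or> v \<noteq> x \<and> E T2 z v"
      if "T2 \<^bold>\<in> SEP (sep_ptns (ins x F) Z) (\<lambda>T. E T x z)" for T2 v
      using that E_sym E_trans x(1) E_refl unfolding S mem_sep_ptns by metis
    fix u v
    have "E T u v \<longleftrightarrow> E T1 u v" if "u \<noteq> x" "v \<noteq> x" for u v using \<rho> that by blast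
    moreover from this have "E T x v \<longleftrightarrow> E T1 x v" for v using zx ex[OF T] ex[OF T1] by metis
    ultimately show "E T u v \<longleftrightarrow> E T1 u v" using E_sym by metis
  qed (use T T1 in \<open>auto simp: S mem_sep_ptns\<close>)
next
  have S: "T \<^bold>\<in> SEP (sep_ptns (ins x F) Z) (\<lambda>T. E T x z) \<longleftrightarrow> T \<^bold>\<in> sep_ptns (ins x F) Z \<and> E T x z" for T
    by (rule mem_SEP) (intro dfs)
  let ?\<rho> = "\<lambda>T T'. \<forall>u v. u \<noteq> x \<and> v \<noteq> x \<longrightarrow> (E T u v \<longleftrightarrow> E T' u v)"
  have bF: "bnd (\<lambda>y. y \<^bold>\<in> F \<or> y \<^bold>\<in> Z)" by (intro bnd_disj bnd_fin F Z)
  have zx: "z \<noteq> x" "z \<^bold>\<in> A" using x z Z by (auto simp: subset_def)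
  {
    fix T assume "T \<^bold>\<in> SEP (sep_ptns (ins x F) Z) (\<lambda>T. E T x z)"
    then have T: "T \<^bold>\<in> sep_ptns (ins x F) Z" "E T x z" by (auto simp: S)
    then have TA: "subset T A" by (simp add: mem_sep_ptns)
    define Q where "Q u v \<longleftrightarrow> u = v \<and> u \<^bold>\<in> A \<or> u \<noteq> x \<and> v \<noteq> x \<and> E T u v" for u v
    have supp_Q: "u \<^bold>\<in> F \<or> u \<^bold>\<in> Z" if "Q u v" "v \<noteq> u" for u v
      using that suppD(1)[of T u v] T unfolding Q_def mem_sep_ptns by auto
    have "\<exists>T'. subset T' A \<and> (\<forall>u v. E T' u v \<longleftrightarrow> Q u v)"
    proof (rule E_surj)
      show "df (\<lambda>s. Q (s 0) (s 1))" unfolding Q_def by (intro dfs)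
      show "bnd (\<lambda>u. \<exists>v. v \<noteq> u \<and> Q u v)" by (rule bnd_mono[OF bF]) (use supp_Q in blast)
    qed (use E_in E_sym E_trans in \<open>unfold Q_def, blast+\<close>)
    then obtain T' where T': "subset T' A" "\<And>u v. E T' u v \<longleftrightarrow> Q u v" by blast
    have "T' \<^bold>\<in> sep_ptns F Z" unfolding mem_sep_ptns
    proof (intro conjI allI impI)
      fix y assume "supp T' y"
      then show "y \<^bold>\<in> F \<or> y \<^bold>\<in> Z" unfolding supp_def T'(2) using supp_Q by blast
    next
      fix z z' assume "z \<^bold>\<in> Z \<and> z' \<^bold>\<in> Z \<and> E T' z z'"
      then show "z = z'" using T unfolding T'(2) Q_def mem_sep_ptns by blast
    qed fact
    moreover have "?\<rho> T T'" unfolding T'(2) Q_def using TA E_refl by blast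
    ultimately show "\<exists>T'. T' \<^bold>\<in> sep_ptns F Z \<and> ?\<rho> T T'" by blast
  }
  {
    fix T' assume T': "T' \<^bold>\<in> sep_ptns F Z"
    then have TA: "subset T' A" by (simp add: mem_sep_ptns)
    \<comment> \<open>The inverse pulls the equivalence relation back along the map that sends
      \<open>x\<close> to \<open>z\<close> and fixes everything else.\<close>
    define \<pi> where "\<pi> u w \<longleftrightarrow> (u = x \<and> w = z) \<or> (u \<noteq> x \<and> w = u)" for u w
    define Q where "Q u v \<longleftrightarrow> (\<exists>u' v'. \<pi> u u' \<and> \<pi> v v' \<and> E T' u' v')" for u v
    have \<pi>: "\<exists>w. \<pi> u w" "\<pi> u w \<Longrightarrow> \<pi> u w' \<Longrightarrow> w = w'" "\<pi> u w \<Longrightarrow> u \<^bold>\<in> A \<longleftrightarrow> w \<^bold>\<in> A" for u w w'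
      unfolding \<pi>_def using zx x by auto
    have supp_Q: "u = x \<or> u \<^bold>\<in> F \<or> u \<^bold>\<in> Z" if "Q u v" "v \<noteq> u" for u v
      using that suppD(1)[of T' u v] T' suppD(1)[of T' u z] z unfolding Q_def mem_sep_ptns \<pi>_def by metis
    have "\<exists>T. subset T A \<and> (\<forall>u v. E T u v \<longleftrightarrow> Q u v)"
    proof (rule E_surj)
      show "df (\<lambda>s. Q (s 0) (s 1))" unfolding Q_def \<pi>_def by (intro dfs)
      show "bnd (\<lambda>u. \<exists>v. v \<noteq> u \<and> Q u v)"
        by (rule bnd_mono[OF bnd_disj[OF bnd_eq[of x] bF]]) (use supp_Q in blast)
      show "\<And>u v. Q u v \<Longrightarrow> u \<^bold>\<in> A" unfolding Q_def using E_in \<pi> by blast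
      show "\<And>u. u \<^bold>\<in> A \<Longrightarrow> Q u u" unfolding Q_def using E_refl[OF TA] \<pi> by blast
      show "\<And>u v. Q u v \<Longrightarrow> Q v u" unfolding Q_def using E_sym by blast
      show "\<And>u v w. Q u v \<Longrightarrow> Q v w \<Longrightarrow> Q u w" unfolding Q_def using E_trans \<pi>(2) by metis
    qed
    then obtain T where T: "subset T A" "\<And>u v. E T u v \<longleftrightarrow> Q u v" by blast
    have T_eq: "E T u v \<longleftrightarrow> E T' u v" if "u \<noteq> x" "v \<noteq> x" for u v
      unfolding T(2) Q_def \<pi>_def using that by auto
    have "T \<^bold>\<in> sep_ptns (ins x F) Z" unfolding mem_sep_ptns
    proof (intro conjI allI impI)
      fix y assume "supp T y"
      then show "y \<^bold>\<in> ins x F \<or> y \<^bold>\<in> Z" unfolding supp_def T(2) using supp_Q by auto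
    next
      fix z z' assume "z \<^bold>\<in> Z \<and> z' \<^bold>\<in> Z \<and> E T z z'"
      moreover from this have "z \<noteq> x" "z' \<noteq> x" using x by auto
      ultimately show "z = z'" using T' T_eq unfolding mem_sep_ptns by blast
    qed fact
    moreover have "E T x z" unfolding T(2) Q_def \<pi>_def using zx E_refl[OF TA] by blast
    ultimately have "T \<^bold>\<in> SEP (sep_ptns (ins x F) Z) (\<lambda>T. E T x z)" by (simp add: S)
    then show "\<exists>T. T \<^bold>\<in> SEP (sep_ptns (ins x F) Z) (\<lambda>T. E T x z) \<and> ?\<rho> T T'" using T_eq by blast
  }
qed

text \<open>Either \<open>x\<close> joins exactly one element of \<open>Z\<close>, which gives the
  product, or it is equivalent to none of them and becomes a further distinguished element. This is
  the recurrence in \<open>bell8_step\<close>.\<close>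

lemma card8_sep_ptns_ins:
  assumes F: "fin F" "subset F A" and Z: "fin Z" "subset Z A" "\<And>z. z \<^bold>\<in> Z \<Longrightarrow> \<not> z \<^bold>\<in> F"
    and x: "x \<^bold>\<in> A" "\<not> x \<^bold>\<in> F" "\<not> x \<^bold>\<in> Z"
  shows "card8 (sep_ptns (ins x F) Z) =
    (card8 Z * card8 (sep_ptns F Z) + card8 (sep_ptns F (ins x Z))) mod 8"
proof -
  define U where "U = SEP (sep_ptns (ins x F) Z) (\<lambda>T. \<exists>z. z \<^bold>\<in> Z \<and> E T x z)"
  have U: "T \<^bold>\<in> U \<longleftrightarrow> T \<^bold>\<in> sep_ptns (ins x F) Z \<and> (\<exists>z. z \<^bold>\<in> Z \<and> E T x z)" for T
    unfolding U_def by (rule mem_SEP) (intro dfs)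
  have fin: "fin (sep_ptns (ins x F) Z)" "fin (sep_ptns F (ins x Z))"
    using F Z by (auto intro: fin_sep_ptns fin_ins)
  have "card8 U = (card8 Z * card8 (sep_ptns F Z)) mod 8" unfolding U_def
  proof (rule card8_UN[where \<rho> = "\<lambda>z T. E T x z", OF _ fin(1) Z(1)])
    show "df (\<lambda>s. E (s 1) x (s 0))" by (intro dfs)
    fix z z' T assume "z \<^bold>\<in> Z" "z' \<^bold>\<in> Z" "T \<^bold>\<in> sep_ptns (ins x F) Z" "E T x z" "E T x z'"
    then show "z = z'" using E_sym E_trans unfolding mem_sep_ptns by blast
  qed (rule card8_sep_ptns_join[OF F Z x])
  moreover have "sep_ptns (ins x F) Z = un U (sep_ptns F (ins x Z))"
  proof (rule set_eqI)
    fix T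
    have "T \<^bold>\<in> sep_ptns F (ins x Z) \<longleftrightarrow> T \<^bold>\<in> sep_ptns (ins x F) Z \<and> \<not> (\<exists>z. z \<^bold>\<in> Z \<and> E T x z)"
      using x E_sym[of T] unfolding mem_sep_ptns by auto
    then show "T \<^bold>\<in> sep_ptns (ins x F) Z \<longleftrightarrow> T \<^bold>\<in> un U (sep_ptns F (ins x Z))" using U by auto
  qed
  moreover have "card8 (un U (sep_ptns F (ins x Z))) = (card8 U + card8 (sep_ptns F (ins x Z))) mod 8"
  proof (rule card8_un[OF _ fin(2)])
    show "fin U" by (rule fin_subset[OF fin(1)]) (simp add: subset_def U)
    show "\<And>T. T \<^bold>\<in> U \<Longrightarrow> \<not> T \<^bold>\<in> sep_ptns F (ins x Z)" using x unfolding U mem_sep_ptns by auto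
  qed
  ultimately show ?thesis by (simp add: mod_simps)
qed

text \<open>The witness \<open>n\<close> is the cardinality of \<open>F\<close> modulo 24, wrapped
  around by \<open>bell8_period\<close>. It has to be the same for all \<open>Z\<close>, as the
  induction step moves an element from \<open>F\<close> to \<open>Z\<close>.\<close>

lemma card8_sep_ptns:
  assumes "fin F" "subset F A"
  shows "\<exists>n<24. \<forall>Z. fin Z \<and> subset Z A \<and> (\<forall>z. z \<^bold>\<in> Z \<longrightarrow> \<not> z \<^bold>\<in> F) \<longrightarrow>
    card8 (sep_ptns F Z) = bell8 n ! card8 Z"
proof -
  have "subset F A \<longrightarrow> (\<exists>n<24. \<forall>Z. fin Z \<and> subset Z A \<and> (\<forall>z. z \<^bold>\<in> Z \<longrightarrow> \<not> z \<^bold>\<in> F) \<longrightarrow>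
    card8 (sep_ptns F Z) = bell8 n ! card8 Z)"
  proof (rule fin_induct[OF _ assms(1)])
    show "df (\<lambda>s. subset (s 0) A \<longrightarrow> (\<exists>n<24. \<forall>Z. fin Z \<and> subset Z A \<and>
        (\<forall>z. z \<^bold>\<in> Z \<longrightarrow> \<not> z \<^bold>\<in> s 0) \<longrightarrow> card8 (sep_ptns (s 0) Z) = bell8 n ! card8 Z))"
      by (intro dfs df_card8_2[where P = "\<lambda>i j. i = bell8 _ ! j"])
    have "bell8 0 ! j = 1" if "j < 8" for j
      using that by (auto simp: less_Suc_eq eval_nat_numeral nth_Cons')
    then show "subset emp A \<longrightarrow> (\<exists>n<24. \<forall>Z. fin Z \<and> subset Z A \<and> (\<forall>z. z \<^bold>\<in> Z \<longrightarrow> \<not> z \<^bold>\<in> emp) \<longrightarrow>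
        card8 (sep_ptns emp Z) = bell8 n ! card8 Z)"
      using card8_sep_ptns_emp card8_less by (intro impI exI[of _ 0]) auto
  next
    fix F x assume F: "fin F" "\<not> x \<^bold>\<in> F"
      and IH: "subset F A \<longrightarrow> (\<exists>n<24. \<forall>Z. fin Z \<and> subset Z A \<and> (\<forall>z. z \<^bold>\<in> Z \<longrightarrow> \<not> z \<^bold>\<in> F) \<longrightarrow>
        card8 (sep_ptns F Z) = bell8 n ! card8 Z)"
    show "subset (ins x F) A \<longrightarrow> (\<exists>n<24. \<forall>Z. fin Z \<and> subset Z A \<and> (\<forall>z. z \<^bold>\<in> Z \<longrightarrow> \<not> z \<^bold>\<in> ins x F) \<longrightarrow>
        card8 (sep_ptns (ins x F) Z) = bell8 n ! card8 Z)"
    proof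
      assume "subset (ins x F) A"
      then have FA: "subset F A" "x \<^bold>\<in> A" by (auto simp: subset_def)
      then obtain n where n: "n < 24" "\<And>Z. fin Z \<Longrightarrow> subset Z A \<Longrightarrow> (\<And>z. z \<^bold>\<in> Z \<Longrightarrow> \<not> z \<^bold>\<in> F) \<Longrightarrow>
        card8 (sep_ptns F Z) = bell8 n ! card8 Z" using IH by blast
      have *: "card8 (sep_ptns (ins x F) Z) = bell8 (Suc n) ! card8 Z"
        if Z: "fin Z" "subset Z A" "\<forall>z. z \<^bold>\<in> Z \<longrightarrow> \<not> z \<^bold>\<in> ins x F" for Z
      proof -
        have "card8 (sep_ptns F Z) = bell8 n ! card8 Z" using Z by (intro n) auto
        moreover have "card8 (sep_ptns F (ins x Z)) = bell8 n ! card8 (ins x Z)"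
          using Z F FA by (intro n fin_ins) (auto simp: subset_def)
        moreover have "card8 (ins x Z) = Suc (card8 Z) mod 8" using Z by (intro card8_ins) auto
        ultimately show ?thesis
          using Z F FA by (subst card8_sep_ptns_ins) (auto simp: bell8_nth_Suc card8_less simp del: bell8.simps)
      qed
      show "\<exists>n<24. \<forall>Z. fin Z \<and> subset Z A \<and> (\<forall>z. z \<^bold>\<in> Z \<longrightarrow> \<not> z \<^bold>\<in> ins x F) \<longrightarrow>
        card8 (sep_ptns (ins x F) Z) = bell8 n ! card8 Z"
      proof (cases "Suc n = 24")
        case True
        then show ?thesis using * bell8_period by (intro exI[of _ 0]) auto
      next
        case False
        then show ?thesis using * n(1) by (intro exI[of _ "Suc n"]) auto
      qed
    qed
  qed
  with assms show ?thesis by blast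
qed

lemma card8_supported_nonzero:
  assumes "fin F" "subset F A"
  shows "card8 (sep_ptns F emp) \<noteq> 0"
proof -
  obtain n where n: "n < 24" "\<forall>Z. fin Z \<and> subset Z A \<and> (\<forall>z. z \<^bold>\<in> Z \<longrightarrow> \<not> z \<^bold>\<in> F) \<longrightarrow>
      card8 (sep_ptns F Z) = bell8 n ! card8 Z"
    using card8_sep_ptns[OF assms] by blast
  from n(2)[rule_format, of emp] have "card8 (sep_ptns F emp) = bell8 n ! 0"
    by (simp add: subset_def)
  with bell8_nonzero[OF n(1)] show ?thesis by simp
qed

end

section \<open>Counting families closed under toggling an element\<close>

context ZF
begin

text \<open>Insertion of \<open>e\<close> is a bijection from the members without \<open>e\<close>
  onto those with \<open>e\<close>.\<close>

lemma card8_toggle: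
  assumes G: "fin G" and cl: "\<And>S. S \<^bold>\<in> G \<Longrightarrow> ins e S \<^bold>\<in> G \<and> rem e S \<^bold>\<in> G"
  shows "card8 G = (2 * card8 (SEP G (\<lambda>S. \<not> e \<^bold>\<in> S))) mod 8"
proof -
  define G0 where "G0 = SEP G (\<lambda>S. \<not> e \<^bold>\<in> S)"
  define G1 where "G1 = SEP G (\<lambda>S. e \<^bold>\<in> S)"
  have G0: "S \<^bold>\<in> G0 \<longleftrightarrow> S \<^bold>\<in> G \<and> \<not> e \<^bold>\<in> S" for S unfolding G0_def by (rule mem_SEP) (intro dfs)
  have G1: "S \<^bold>\<in> G1 \<longleftrightarrow> S \<^bold>\<in> G \<and> e \<^bold>\<in> S" for S unfolding G1_def by (rule mem_SEP) (intro dfs)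
  have fin: "fin G0" "fin G1" by (rule fin_subset[OF G]; simp add: subset_def G0 G1)+
  have ri: "rem e (ins e S) = S" if "\<not> e \<^bold>\<in> S" for S using that by (intro set_eqI) auto
  have ir: "ins e (rem e S) = S" if "e \<^bold>\<in> S" for S using that by (intro set_eqI) auto
  have "card8 G0 = card8 G1"
  proof (rule card8_bij[where \<rho> = "\<lambda>S S'. S' = ins e S", OF _ fin(1)])
    show "df (\<lambda>s. s 1 = ins e (s 0))" by (intro dfs)
    show "\<And>S. S \<^bold>\<in> G0 \<Longrightarrow> \<exists>S'. S' \<^bold>\<in> G1 \<and> S' = ins e S" using cl by (simp add: G0 G1)
    show "\<And>S' . S' \<^bold>\<in> G1 \<Longrightarrow> \<exists>S. S \<^bold>\<in> G0 \<and> S' = ins e S" using cl ir by (metis G0 G1 mem_rem)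
    show "\<And>S S1 S'. S \<^bold>\<in> G0 \<Longrightarrow> S1 \<^bold>\<in> G0 \<Longrightarrow> S' \<^bold>\<in> G1 \<Longrightarrow> S' = ins e S \<Longrightarrow> S' = ins e S1 \<Longrightarrow> S = S1"
      using ri by (metis G0)
  qed simp
  moreover have "G = un G0 G1" by (rule set_eqI) (auto simp: G0 G1)
  then have "card8 G = (card8 G0 + card8 G1) mod 8"
    using card8_un[OF fin] by (metis G0 G1)
  ultimately show ?thesis unfolding G0_def by (simp add: mult_2)
qed

text \<open>Each of the three elements contributes a factor 2: the subfamily that omits
  \<open>a\<close>, and then the one that also omits \<open>b\<close>, is still closed under
  toggling the remaining elements.\<close>

lemma card8_three_toggles:
  assumes G: "fin G" and abc: "a \<noteq> b" "a \<noteq> c" "b \<noteq> c"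
    and cl: "\<And>e S. S \<^bold>\<in> G \<Longrightarrow> e = a \<or> e = b \<or> e = c \<Longrightarrow> ins e S \<^bold>\<in> G \<and> rem e S \<^bold>\<in> G"
  shows "card8 G = 0"
proof -
  define Ga where "Ga = SEP G (\<lambda>S. \<not> a \<^bold>\<in> S)"
  define Gab where "Gab = SEP Ga (\<lambda>S. \<not> b \<^bold>\<in> S)"
  have Ga: "S \<^bold>\<in> Ga \<longleftrightarrow> S \<^bold>\<in> G \<and> \<not> a \<^bold>\<in> S" for S unfolding Ga_def by (rule mem_SEP) (intro dfs)
  have Gab: "S \<^bold>\<in> Gab \<longleftrightarrow> S \<^bold>\<in> G \<and> \<not> a \<^bold>\<in> S \<and> \<not> b \<^bold>\<in> S" for S
    unfolding Gab_def by (subst mem_SEP) (intro dfs, simp add: Ga)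
  have "fin Ga" "fin Gab" by (rule fin_subset[OF G]; simp add: subset_def Ga Gab)+
  then have "\<exists>i. card8 Gab = (2 * i) mod 8"
    using card8_toggle[of Gab c] abc cl by (auto simp: Gab)
  moreover have "card8 Ga = (2 * card8 Gab) mod 8"
    unfolding Gab_def by (rule card8_toggle) (use \<open>fin Ga\<close> abc cl in \<open>auto simp: Ga\<close>)
  moreover have "card8 G = (2 * card8 Ga) mod 8"
    unfolding Ga_def by (rule card8_toggle) (use G cl in auto)
  ultimately obtain i where "card8 G = (2 * ((2 * ((2 * i) mod 8)) mod 8)) mod 8" by auto
  then show ?thesis by (simp add: mod_mult_right_eq flip: mult.assoc)
qed

end

context coded_partitions
begin

section \<open>The finite stage: a support leaving a given finite set\<close>

text \<open>The singletons separate each element of \<open>F\<close> from the rest of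
  \<open>A\<close>, so that it can be added to or removed from a saturated set.\<close>

definition gens :: "'a \<Rightarrow> 'a" where
  "gens F = SEP (power_set A) (\<lambda>T. (\<forall>y. supp T y \<longrightarrow> y \<^bold>\<in> F) \<or> (\<exists>e. e \<^bold>\<in> F \<and> T = ins e emp))"

lemma mem_gens:
  "T \<^bold>\<in> gens F \<longleftrightarrow> subset T A \<and> ((\<forall>y. supp T y \<longrightarrow> y \<^bold>\<in> F) \<or> (\<exists>e. e \<^bold>\<in> F \<and> T = ins e emp))"
  unfolding gens_def by (subst mem_SEP) (intro dfs, simp add: mem_power_set)

lemma dt_gens [dfs]: "dt t \<Longrightarrow> dt (\<lambda>s. gens (t s))"
proof (rule dt_op1[where g = gens])
  show "df (\<lambda>s. s 0 = gens (s 1))" unfolding gens_def by (intro dfs)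
qed

text \<open>For finite \<open>F\<close>, the Boolean algebra generated by \<open>gens F\<close>,
  given as the unions of its cells: points that no generator separates are not separated by
  \<open>S\<close>.\<close>

definition saturated :: "'a \<Rightarrow> 'a \<Rightarrow> bool" where
  "saturated F S \<longleftrightarrow> subset S A \<and>
    (\<forall>x y. x \<^bold>\<in> A \<and> y \<^bold>\<in> A \<and> (\<forall>T. T \<^bold>\<in> gens F \<longrightarrow> (x \<^bold>\<in> T \<longleftrightarrow> y \<^bold>\<in> T)) \<longrightarrow> (x \<^bold>\<in> S \<longleftrightarrow> y \<^bold>\<in> S))"

lemma df_saturated [dfs]: "dt t \<Longrightarrow> dt u \<Longrightarrow> df (\<lambda>s. saturated (t s) (u s))"
proof (rule df_term2[where P = saturated])
  show "df (\<lambda>s. saturated (s 0) (s 1))" unfolding saturated_def by (intro dfs)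
qed

lemma fin_gens:
  assumes "fin F"
  shows "fin (gens F)"
proof -
  have "bnd (\<lambda>T. (subset T A \<and> (\<forall>y. supp T y \<longrightarrow> y \<^bold>\<in> F)) \<or> (\<forall>z. z \<^bold>\<in> T \<longrightarrow> z \<^bold>\<in> F))"
    by (intro bnd_disj bnd_supported bnd_Pow bnd_fin assms)
  then have "bnd (\<lambda>T. T \<^bold>\<in> gens F)" by (rule bnd_mono) (auto simp: mem_gens)
  then show ?thesis by (rule bnd_finD)
qed

text \<open>A saturated set is determined by the types of its elements, the type of \<open>x\<close>
  being the set of generators that contain \<open>x\<close>; there are finitely many types.\<close>

lemma bnd_saturated:
  assumes "fin F"
  shows "bnd (saturated F)"
proof -
  define ty where "ty x = SEP (gens F) (\<lambda>T. x \<^bold>\<in> T)" for x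
  have ty: "T \<^bold>\<in> ty x \<longleftrightarrow> T \<^bold>\<in> gens F \<and> x \<^bold>\<in> T" for T x unfolding ty_def by (rule mem_SEP) (intro dfs)
  have ty_eq: "ty x = ty y \<longleftrightarrow> (\<forall>T. T \<^bold>\<in> gens F \<longrightarrow> (x \<^bold>\<in> T \<longleftrightarrow> y \<^bold>\<in> T))" for x y
    using set_eqI[of "ty x" "ty y"] ty by metis
  define \<rho> where "\<rho> c S \<longleftrightarrow> saturated F S \<and> (\<forall>q. q \<^bold>\<in> c \<longleftrightarrow> (\<exists>x. x \<^bold>\<in> S \<and> q = ty x))" for c S
  have "bnd (\<lambda>S. \<exists>c. c \<^bold>\<in> power_set (power_set (gens F)) \<and> \<rho> c S)"
  proof (rule bnd_image)
    show "df (\<lambda>s. \<rho> (s 0) (s 1))" unfolding \<rho>_def ty_def by (intro dfs)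
    show "bnd (\<lambda>c. c \<^bold>\<in> power_set (power_set (gens F)))"
      by (intro bnd_fin fin_power_set fin_gens assms)
    show "df (\<lambda>s. s 0 \<^bold>\<in> power_set (power_set (gens F)))" by (intro dfs)
    fix c S S' assume S: "\<rho> c S" "\<rho> c S'"
    have "x \<^bold>\<in> S \<longleftrightarrow> x \<^bold>\<in> A \<and> ty x \<^bold>\<in> c" if "\<rho> c S" for x S
      using that unfolding \<rho>_def saturated_def subset_def ty_eq[symmetric] by metis
    from this[OF S(1)] this[OF S(2)] show "S = S'" by (intro set_eqI) simp
  qed
  then show ?thesis
  proof (rule bnd_mono)
    fix S assume S: "saturated F S"
    define c where "c = SEP (power_set (gens F)) (\<lambda>q. \<exists>x. x \<^bold>\<in> S \<and> q = ty x)"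
    have c: "q \<^bold>\<in> c \<longleftrightarrow> q \<^bold>\<in> power_set (gens F) \<and> (\<exists>x. x \<^bold>\<in> S \<and> q = ty x)" for q
      unfolding c_def ty_def by (rule mem_SEP) (intro dfs)
    have "ty x \<^bold>\<in> power_set (gens F)" for x by (simp add: mem_power_set subset_def ty)
    then have "\<rho> c S" unfolding \<rho>_def c using S by blast
    moreover have "c \<^bold>\<in> power_set (power_set (gens F))" by (simp add: mem_power_set[of c] subset_def c)
    ultimately show "\<exists>c. c \<^bold>\<in> power_set (power_set (gens F)) \<and> \<rho> c S" by blast
  qed
qed

lemma bnd_supp_saturated:
  assumes "fin F"
  shows "bnd (\<lambda>x. \<exists>S. saturated F S \<and> supp S x)"
proof -
  define H where "H = SEP (power_set A) (saturated F)"
  have H: "S \<^bold>\<in> H \<longleftrightarrow> saturated F S" for S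
    unfolding H_def by (subst mem_SEP) (intro dfs, auto simp: mem_power_set saturated_def)
  have "fin H" by (rule bnd_finD) (simp add: H bnd_saturated[OF assms])
  have "bnd (\<lambda>x. \<exists>S. S \<^bold>\<in> H \<and> supp S x)"
  proof (rule bnd_UN[OF _ \<open>fin H\<close>])
    show "df (\<lambda>s. supp (s 0) (s 1))" by (intro dfs)
    show "\<And>S. S \<^bold>\<in> H \<Longrightarrow> bnd (supp S)" unfolding H saturated_def by (intro bnd_supp) blast
  qed
  then show ?thesis by (simp add: H)
qed

text \<open>Otherwise the saturated sets are exactly the codes of the partitions supported in \<open>F\<close>;
  the number of the former is divisible by 8, the number of the latter is a Bell number.\<close>

lemma ex_supp_saturated:
  assumes F: "fin F" "subset F A" and abc: "a \<^bold>\<in> F" "b \<^bold>\<in> F" "c \<^bold>\<in> F" "a \<noteq> b" "a \<noteq> c" "b \<noteq> c"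
  shows "\<exists>S x. saturated F S \<and> supp S x \<and> \<not> x \<^bold>\<in> F"
proof (rule ccontr)
  assume "\<not> ?thesis"
  then have *: "supp S x \<Longrightarrow> x \<^bold>\<in> F" if "saturated F S" for S x using that by blast
  let ?G = "sep_ptns F emp"
  \<comment> \<open>A code with support in \<open>F\<close> is itself a generator and hence
    saturated. The converse is the assumption to be refuted.\<close>
  have G: "S \<^bold>\<in> ?G \<longleftrightarrow> saturated F S" for S
  proof
    assume "S \<^bold>\<in> ?G"
    then have "subset S A" "S \<^bold>\<in> gens F" by (auto simp: mem_sep_ptns mem_gens)
    then show "saturated F S" by (auto simp: saturated_def)
  next
    assume "saturated F S"
    then show "S \<^bold>\<in> ?G" using * by (auto simp: mem_sep_ptns saturated_def)
  qed
  have "card8 ?G = 0"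
  proof (rule card8_three_toggles[OF fin_sep_ptns[OF F(1) fin_emp] abc(4-6)])
    fix e S assume S: "S \<^bold>\<in> ?G" and e: "e = a \<or> e = b \<or> e = c"
    have e': "e \<^bold>\<in> F" "e \<^bold>\<in> A" using e abc F(2) by (auto simp: subset_def)
    \<comment> \<open>The generator \<open>ins e emp\<close> tells \<open>e\<close> apart from every
      other point, so changing \<open>S\<close> at \<open>e\<close> preserves saturation.\<close>
    have sep: "x = e \<longleftrightarrow> y = e" if "\<forall>T. T \<^bold>\<in> gens F \<longrightarrow> (x \<^bold>\<in> T \<longleftrightarrow> y \<^bold>\<in> T)" for x y
    proof -
      have "ins e emp \<^bold>\<in> gens F" using e' by (auto simp: mem_gens subset_def)
      then show ?thesis using that by fastforce
    qed
    from S have "saturated F S" using G by simp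
    then have st: "x \<^bold>\<in> S \<longleftrightarrow> y \<^bold>\<in> S"
      if "x \<^bold>\<in> A" "y \<^bold>\<in> A" "\<forall>T. T \<^bold>\<in> gens F \<longrightarrow> (x \<^bold>\<in> T \<longleftrightarrow> y \<^bold>\<in> T)" for x y
      using that unfolding saturated_def by blast
    have SA: "subset S A" using \<open>saturated F S\<close> by (simp add: saturated_def)
    have "saturated F (ins e S) \<and> saturated F (rem e S)" unfolding saturated_def
    proof (intro conjI allI impI)
      fix x y assume xy: "x \<^bold>\<in> A \<and> y \<^bold>\<in> A \<and> (\<forall>T. T \<^bold>\<in> gens F \<longrightarrow> (x \<^bold>\<in> T \<longleftrightarrow> y \<^bold>\<in> T))"
      then show "x \<^bold>\<in> ins e S \<longleftrightarrow> y \<^bold>\<in> ins e S" "x \<^bold>\<in> rem e S \<longleftrightarrow> y \<^bold>\<in> rem e S"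
        using st[of x y] sep[of x y] by simp_all
    qed (use SA e' in \<open>auto simp: subset_def\<close>)
    then show "ins e S \<^bold>\<in> ?G \<and> rem e S \<^bold>\<in> ?G" by (simp add: G)
  qed
  then show False using card8_supported_nonzero[OF F] by simp
qed

end

context ZF
begin

section \<open>Ordinals\<close>

text \<open>Transitive sets of transitive sets; in the presence of Foundation these are the von
  Neumann ordinals.\<close>

definition ord :: "'a \<Rightarrow> bool" where
  "ord x \<longleftrightarrow> (\<forall>y z. z \<^bold>\<in> y \<and> y \<^bold>\<in> x \<longrightarrow> z \<^bold>\<in> x) \<and> (\<forall>y z w. y \<^bold>\<in> x \<and> z \<^bold>\<in> y \<and> w \<^bold>\<in> z \<longrightarrow> w \<^bold>\<in> y)"

lemma df_ord [dfs]: "dt t \<Longrightarrow> df (\<lambda>s. ord (t s))"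
proof (rule df_term[where P = ord])
  show "df (\<lambda>s. ord (s 0))" unfolding ord_def by (intro dfs)
qed

lemma ord_trans: "ord x \<Longrightarrow> y \<^bold>\<in> x \<Longrightarrow> z \<^bold>\<in> y \<Longrightarrow> z \<^bold>\<in> x"
  unfolding ord_def by blast

lemma ord_mem: "ord x \<Longrightarrow> y \<^bold>\<in> x \<Longrightarrow> ord y"
  unfolding ord_def by blast

lemma ord_succ: "ord x \<Longrightarrow> ord (ins x x)"
  unfolding ord_def mem_ins by blast

lemma ord_induct:
  assumes Q: "df (\<lambda>s. Q (s 0))" and x: "ord x"
    and step: "\<And>x. ord x \<Longrightarrow> (\<And>y. y \<^bold>\<in> x \<Longrightarrow> Q y) \<Longrightarrow> Q x"
  shows "Q x"
proof (rule ccontr)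
  assume "\<not> Q x"
  then obtain y where y: "y \<^bold>\<in> ins x x" "\<not> Q y" "\<forall>z. z \<^bold>\<in> y \<and> z \<^bold>\<in> ins x x \<longrightarrow> \<not> \<not> Q z"
    using ex_minimal[OF df_not[OF Q], of x "ins x x"] by auto
  have "ord y" using y(1) x ord_mem by auto
  moreover have "Q z" if "z \<^bold>\<in> y" for z using that y(1,3) ord_trans[OF x] by auto
  ultimately show False using step y(2) by blast
qed

text \<open>If \<open>x\<close> and \<open>y\<close> were incomparable, the two nested induction
  hypotheses, for the elements of \<open>x\<close> and for those of \<open>y\<close>, would show
  that both have the same elements.\<close>

lemma ord_linear:
  assumes "ord x" "ord y"
  shows "x \<^bold>\<in> y \<or> x = y \<or> y \<^bold>\<in> x"
proof -
  have "\<forall>y. ord y \<longrightarrow> x \<^bold>\<in> y \<or> x = y \<or> y \<^bold>\<in> x"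
  proof (rule ord_induct[OF _ assms(1)])
    show "df (\<lambda>s. \<forall>y. ord y \<longrightarrow> s 0 \<^bold>\<in> y \<or> s 0 = y \<or> y \<^bold>\<in> s 0)" by (intro dfs)
    fix x assume x: "ord x" and IH: "\<And>z. z \<^bold>\<in> x \<Longrightarrow> \<forall>y. ord y \<longrightarrow> z \<^bold>\<in> y \<or> z = y \<or> y \<^bold>\<in> z"
    show "\<forall>y. ord y \<longrightarrow> x \<^bold>\<in> y \<or> x = y \<or> y \<^bold>\<in> x"
    proof (intro allI impI)
      fix y assume y: "ord y"
      show "x \<^bold>\<in> y \<or> x = y \<or> y \<^bold>\<in> x"
      proof (rule ord_induct[OF _ y])
        show "df (\<lambda>s. x \<^bold>\<in> s 0 \<or> x = s 0 \<or> s 0 \<^bold>\<in> x)" by (intro dfs)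
        fix y assume y: "ord y" and IH': "\<And>w. w \<^bold>\<in> y \<Longrightarrow> x \<^bold>\<in> w \<or> x = w \<or> w \<^bold>\<in> x"
        show "x \<^bold>\<in> y \<or> x = y \<or> y \<^bold>\<in> x"
        proof (rule ccontr)
          assume n: "\<not> ?thesis"
          have "z \<^bold>\<in> x \<longleftrightarrow> z \<^bold>\<in> y" for z using n IH[of z] IH'[of z] x y ord_trans by metis
          then have "x = y" by (rule set_eqI)
          with n show False by simp
        qed
      qed
    qed
  qed
  with assms(2) show ?thesis by blast
qed

lemma natural_mem: "natural n \<Longrightarrow> m \<^bold>\<in> n \<Longrightarrow> natural m"
proof -
  assume "natural n"
  then have "\<forall>m. m \<^bold>\<in> n \<longrightarrow> natural m"
  proof (rule nat_induct[rotated])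
    show "df (\<lambda>s. \<forall>m. m \<^bold>\<in> s 0 \<longrightarrow> natural m)" by (intro dfs)
  qed auto
  then show "m \<^bold>\<in> n \<Longrightarrow> natural m" by blast
qed

lemma natural_ord: "natural n \<Longrightarrow> ord n"
proof (rule nat_induct[of ord])
  show "df (\<lambda>s. ord (s 0))" by (intro dfs)
qed (simp_all add: ord_succ, simp add: ord_def)

lemma natural_fin: "natural n \<Longrightarrow> fin n"
proof (rule nat_induct[of fin])
  show "df (\<lambda>s. fin (s 0))" by (intro dfs)
qed (simp_all add: fin_ins)

lemma ord_om: "ord om"
proof -
  have "w \<^bold>\<in> y" if "natural y" "z \<^bold>\<in> y" "w \<^bold>\<in> z" for y z w
    using ord_trans[OF natural_ord[OF that(1)]] that by blast
  moreover have "natural z" if "natural y" "z \<^bold>\<in> y" for y z using natural_mem that .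
  ultimately show ?thesis unfolding ord_def mem_om by blast
qed

lemma om_cases:
  assumes "ord i"
  shows "i \<^bold>\<in> om \<or> subset om i"
  using ord_linear[OF assms ord_om] ord_trans[OF assms, of om] unfolding subset_def by blast

section \<open>Finite sets of ordinals\<close>

definition ord_set :: "'a \<Rightarrow> bool" where
  "ord_set k \<longleftrightarrow> fin k \<and> (\<forall>x. x \<^bold>\<in> k \<longrightarrow> ord x)"

lemma df_ord_set [dfs]: "dt t \<Longrightarrow> df (\<lambda>s. ord_set (t s))"
proof (rule df_term[where P = ord_set])
  show "df (\<lambda>s. ord_set (s 0))" unfolding ord_set_def by (intro dfs)
qed

definition ismax :: "'a \<Rightarrow> 'a \<Rightarrow> bool" where
  "ismax m k \<longleftrightarrow> m \<^bold>\<in> k \<and> (\<forall>x. x \<^bold>\<in> k \<longrightarrow> x = m \<or> x \<^bold>\<in> m)"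

lemma df_ismax [dfs]: "dt t \<Longrightarrow> dt u \<Longrightarrow> df (\<lambda>s. ismax (t s) (u s))"
proof (rule df_term2[where P = ismax])
  show "df (\<lambda>s. ismax (s 0) (s 1))" unfolding ismax_def by (intro dfs)
qed

lemma ex_ismax:
  assumes "ord_set k" "k \<noteq> emp"
  shows "\<exists>m. ismax m k"
proof -
  have "(\<forall>x. x \<^bold>\<in> k \<longrightarrow> ord x) \<longrightarrow> k = emp \<or> (\<exists>m. ismax m k)"
  proof (rule fin_induct[of "\<lambda>k. (\<forall>x. x \<^bold>\<in> k \<longrightarrow> ord x) \<longrightarrow> k = emp \<or> (\<exists>m. ismax m k)"])
    show "df (\<lambda>s. (\<forall>x. x \<^bold>\<in> s 0 \<longrightarrow> ord x) \<longrightarrow> s 0 = emp \<or> (\<exists>m. ismax m (s 0)))" by (intro dfs)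
    fix k y assume IH: "(\<forall>x. x \<^bold>\<in> k \<longrightarrow> ord x) \<longrightarrow> k = emp \<or> (\<exists>m. ismax m k)"
    show "(\<forall>x. x \<^bold>\<in> ins y k \<longrightarrow> ord x) \<longrightarrow> ins y k = emp \<or> (\<exists>m. ismax m (ins y k))"
    proof
      assume o: "\<forall>x. x \<^bold>\<in> ins y k \<longrightarrow> ord x"
      then consider "k = emp" | m where "ismax m k" using IH by auto
      then show "ins y k = emp \<or> (\<exists>m. ismax m (ins y k))"
      proof cases
        case 1
        then have "ismax y (ins y k)" by (simp add: ismax_def)
        then show ?thesis by blast
      next
        case (2 m)
        then have "ord y" "ord m" using o by (auto simp: ismax_def)
        then consider "y \<^bold>\<in> m \<or> y = m" | "m \<^bold>\<in> y" using ord_linear by blast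
        then have "ismax m (ins y k) \<or> ismax y (ins y k)"
        proof cases
          case 1
          then show ?thesis using 2 unfolding ismax_def mem_ins by blast
        next
          case m: 2
          then have "z \<^bold>\<in> y" if "z \<^bold>\<in> m" for z using ord_trans[OF \<open>ord y\<close> _ that] by blast
          then show ?thesis using 2 m unfolding ismax_def mem_ins by blast
        qed
        then show ?thesis by blast
      qed
    qed
  qed (use assms in \<open>simp_all add: ord_set_def\<close>)
  with assms show ?thesis unfolding ord_set_def by blast
qed

lemma not_fin_om: "\<not> fin om"
proof
  assume "fin om"
  then have "ord_set om" by (simp add: ord_set_def mem_om natural_ord)
  moreover have "om \<noteq> emp" using natural_emp mem_om mem_emp by metis
  ultimately obtain m where m: "ismax m om" using ex_ismax by blast
  then have "ins m m \<^bold>\<in> om" by (simp add: ismax_def mem_om natural_succ)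
  with m show False unfolding ismax_def by (metis mem_asym mem_ins mem_irrefl)
qed

text \<open>Comparison at the largest element of the symmetric difference.\<close>

definition lt :: "'a \<Rightarrow> 'a \<Rightarrow> bool" where
  "lt k k' \<longleftrightarrow> (\<exists>m. m \<^bold>\<in> k' \<and> \<not> m \<^bold>\<in> k \<and> (\<forall>x. m \<^bold>\<in> x \<and> (x \<^bold>\<in> k \<or> x \<^bold>\<in> k') \<longrightarrow> x \<^bold>\<in> k \<and> x \<^bold>\<in> k'))"

lemma df_lt [dfs]: "dt t \<Longrightarrow> dt u \<Longrightarrow> df (\<lambda>s. lt (t s) (u s))"
proof (rule df_term2[where P = lt])
  show "df (\<lambda>s. lt (s 0) (s 1))" unfolding lt_def by (intro dfs)
qed

lemma lt_total:
  assumes "ord_set k" "ord_set k'" "k \<noteq> k'"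
  shows "lt k k' \<or> lt k' k"
proof -
  define d where "d = SEP (un k k') (\<lambda>x. \<not> (x \<^bold>\<in> k \<longleftrightarrow> x \<^bold>\<in> k'))"
  have d: "x \<^bold>\<in> d \<longleftrightarrow> \<not> (x \<^bold>\<in> k \<longleftrightarrow> x \<^bold>\<in> k')" for x
    unfolding d_def by (subst mem_SEP) (intro dfs, auto)
  have "fin d" by (rule fin_subset[OF fin_un[of k k']]) (use assms in \<open>auto simp: ord_set_def subset_def d\<close>)
  then have "ord_set d" using assms by (auto simp: ord_set_def d)
  moreover have "d \<noteq> emp" using assms(3) set_eqI[of k k'] d by auto
  ultimately obtain m where m: "ismax m d" using ex_ismax by blast
  then have "\<forall>x. m \<^bold>\<in> x \<longrightarrow> \<not> x \<^bold>\<in> d" unfolding ismax_def using mem_asym by auto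
  with m show ?thesis unfolding lt_def ismax_def d by blast
qed

text \<open>The larger of the two deciding elements \<open>m\<close> and \<open>n\<close> decides
  between \<open>a\<close> and \<open>c\<close>.\<close>

lemma lt_trans:
  assumes "ord_set a" "ord_set b" "ord_set c" "lt a b" "lt b c"
  shows "lt a c"
proof -
  obtain m where m: "m \<^bold>\<in> b" "\<not> m \<^bold>\<in> a" "\<And>x. m \<^bold>\<in> x \<Longrightarrow> x \<^bold>\<in> a \<longleftrightarrow> x \<^bold>\<in> b"
    using assms(4) unfolding lt_def by blast
  obtain n where n: "n \<^bold>\<in> c" "\<not> n \<^bold>\<in> b" "\<And>x. n \<^bold>\<in> x \<Longrightarrow> x \<^bold>\<in> b \<longleftrightarrow> x \<^bold>\<in> c"
    using assms(5) unfolding lt_def by blast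
  have o: "ord m" "ord n" using m n assms unfolding ord_set_def by blast+
  have t: "x \<^bold>\<in> a \<or> x \<^bold>\<in> b \<or> x \<^bold>\<in> c \<Longrightarrow> ord x" for x using assms unfolding ord_set_def by blast
  consider "m \<^bold>\<in> n" | "n \<^bold>\<in> m" using ord_linear[OF o] m n by blast
  then show ?thesis
  proof cases
    case 1
    then have "m \<^bold>\<in> x" if "n \<^bold>\<in> x" "x \<^bold>\<in> a \<or> x \<^bold>\<in> b \<or> x \<^bold>\<in> c" for x using that t ord_trans by blast
    then show ?thesis unfolding lt_def using 1 m n by (intro exI[of _ n]) blast
  next
    case 2
    then have "n \<^bold>\<in> x" if "m \<^bold>\<in> x" "x \<^bold>\<in> a \<or> x \<^bold>\<in> b \<or> x \<^bold>\<in> c" for x using that t ord_trans by blast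
    then show ?thesis unfolding lt_def using 2 m n by (intro exI[of _ m]) blast
  qed
qed

lemma lt_irrefl: "\<not> lt k k"
  unfolding lt_def by blast

text \<open>An element of \<open>k'\<close> missing in \<open>k\<close> lies below the deciding
  element of \<open>k\<close>, hence in \<open>i\<close>. As a consequence, the predecessors of
  \<open>k\<close> form a set.\<close>

lemma lt_subset:
  assumes "ord_set k" "ord_set k'" "lt k' k" "ord i" "subset k i"
  shows "subset k' i"
proof -
  obtain m where m: "m \<^bold>\<in> k" "\<And>x. m \<^bold>\<in> x \<Longrightarrow> x \<^bold>\<in> k' \<Longrightarrow> x \<^bold>\<in> k" using assms(3) unfolding lt_def by blast
  have "x \<^bold>\<in> i" if "x \<^bold>\<in> k'" for x
  proof -
    have "m \<^bold>\<in> i" "ord m" "ord x" using assms m that by (auto simp: subset_def ord_set_def)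
    then show ?thesis
      using ord_linear[of x m] m(2)[OF _ that] assms(5) ord_trans[OF assms(4), of m x]
      by (auto simp: subset_def)
  qed
  then show ?thesis by (simp add: subset_def)
qed

lemma lt_max: "ismax i k \<Longrightarrow> subset k' i \<Longrightarrow> lt k' k"
  unfolding lt_def ismax_def subset_def using mem_irrefl mem_asym by (intro exI[of _ i]) metis

text \<open>Well-foundedness of \<open>lt\<close>, by induction on the bound \<open>i\<close>. The
  least maximum \<open>j\<close> of a member is fixed first; removing \<open>j\<close> from the
  members with this maximum leaves subsets of \<open>j\<close>, to which the induction hypothesis
  applies.\<close>

lemma ex_lt_minimal:
  assumes "ord i" "k \<^bold>\<in> X" "\<forall>k. k \<^bold>\<in> X \<longrightarrow> ord_set k \<and> subset k i"
  shows "\<exists>k. k \<^bold>\<in> X \<and> (\<forall>k'. k' \<^bold>\<in> X \<longrightarrow> \<not> lt k' k)"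
proof -
  define W where "W i \<longleftrightarrow> (\<forall>X. (\<exists>k. k \<^bold>\<in> X) \<and> (\<forall>k. k \<^bold>\<in> X \<longrightarrow> ord_set k \<and> subset k i) \<longrightarrow>
    (\<exists>k. k \<^bold>\<in> X \<and> (\<forall>k'. k' \<^bold>\<in> X \<longrightarrow> \<not> lt k' k)))" for i
  have "W i"
  proof (rule ord_induct[OF _ assms(1)])
    show "df (\<lambda>s. W (s 0))" unfolding W_def by (intro dfs)
    fix i assume i: "ord i" and IH: "\<And>j. j \<^bold>\<in> i \<Longrightarrow> W j"
    show "W i" unfolding W_def
    proof (intro allI impI)
      fix X assume "(\<exists>k. k \<^bold>\<in> X) \<and> (\<forall>k. k \<^bold>\<in> X \<longrightarrow> ord_set k \<and> subset k i)"
      then obtain k0 where k0: "k0 \<^bold>\<in> X" and X: "\<And>k. k \<^bold>\<in> X \<Longrightarrow> ord_set k" "\<And>k. k \<^bold>\<in> X \<Longrightarrow> subset k i" by blast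
      show "\<exists>k. k \<^bold>\<in> X \<and> (\<forall>k'. k' \<^bold>\<in> X \<longrightarrow> \<not> lt k' k)"
      proof (cases "emp \<^bold>\<in> X")
        case True
        then show ?thesis unfolding lt_def by (intro exI[of _ emp]) simp
      next
        case False
        have mx: "\<exists>j. j \<^bold>\<in> i \<and> ismax j k" if "k \<^bold>\<in> X" for k
          using ex_ismax[OF X(1)[OF that]] X(2)[OF that] that False
          by (auto simp: ismax_def subset_def)
        define Q where "Q j \<longleftrightarrow> (\<exists>k. k \<^bold>\<in> X \<and> ismax j k)" for j
        have "df (\<lambda>s. Q (s 0))" unfolding Q_def by (intro dfs)
        moreover obtain j0 where "j0 \<^bold>\<in> i" "Q j0" using mx[OF k0] k0 unfolding Q_def by blast
        ultimately obtain j where j: "j \<^bold>\<in> i" "Q j" "\<forall>z. z \<^bold>\<in> j \<and> z \<^bold>\<in> i \<longrightarrow> \<not> Q z"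
          using ex_minimal by blast
        have "ord j" using i j ord_mem by blast
        define Y where "Y = SEP (power_set j) (\<lambda>h. \<exists>k. k \<^bold>\<in> X \<and> ismax j k \<and> h = rem j k)"
        have Y: "h \<^bold>\<in> Y \<longleftrightarrow> subset h j \<and> (\<exists>k. k \<^bold>\<in> X \<and> ismax j k \<and> h = rem j k)" for h
          unfolding Y_def by (subst mem_SEP) (intro dfs, simp add: mem_power_set)
        have remY: "rem j k \<^bold>\<in> Y" if "k \<^bold>\<in> X" "ismax j k" for k
          using that unfolding Y by (auto simp: subset_def ismax_def)
        have "ord_set h" if "h \<^bold>\<in> Y" for h
        proof -
          obtain k where k: "k \<^bold>\<in> X" "h = rem j k" using \<open>h \<^bold>\<in> Y\<close> Y by blast
          have "fin h" by (rule fin_subset[of k]) (use k X in \<open>auto simp: ord_set_def subset_def\<close>)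
          then show ?thesis using X(1)[OF k(1)] k(2) by (simp add: ord_set_def)
        qed
        moreover have "\<exists>h. h \<^bold>\<in> Y" using remY j(2) unfolding Q_def by blast
        ultimately obtain h where h: "h \<^bold>\<in> Y" "\<forall>h'. h' \<^bold>\<in> Y \<longrightarrow> \<not> lt h' h"
          using IH[OF j(1)] Y unfolding W_def by blast
        then obtain k where k: "k \<^bold>\<in> X" "ismax j k" "h = rem j k" unfolding Y by blast
        have "\<not> lt k' k" if k': "k' \<^bold>\<in> X" for k'
        proof
          assume "lt k' k"
          then obtain m where m: "m \<^bold>\<in> k" "\<not> m \<^bold>\<in> k'" "\<And>x. m \<^bold>\<in> x \<Longrightarrow> x \<^bold>\<in> k' \<longleftrightarrow> x \<^bold>\<in> k"
            unfolding lt_def by blast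
          obtain j' where j': "j' \<^bold>\<in> i" "ismax j' k'" using mx[OF k'] by blast
          then have "ord j'" "\<not> j' \<^bold>\<in> j" using i ord_mem j(3) k' unfolding Q_def by blast+
          then consider "j' = j" | "j \<^bold>\<in> j'" using ord_linear[OF _ \<open>ord j\<close>] by blast
          then show False
          proof cases
            case 1
            then have "rem j k' \<^bold>\<in> Y" using remY k' j' by blast
            moreover have "m \<noteq> j" using 1 j' m(2) unfolding ismax_def by blast
            then have "lt (rem j k') h" unfolding lt_def k(3)
              using m by (intro exI[of _ m]) auto
            ultimately show False using h(2) by blast
          next
            case 2
            have "m = j \<or> m \<^bold>\<in> j" using k(2) m(1) unfolding ismax_def by blast
            then have "m \<^bold>\<in> j'" using 2 ord_trans[OF \<open>ord j'\<close>] by blast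
            then have "j' \<^bold>\<in> k" using m(3) j'(2) unfolding ismax_def by blast
            then have "j' = j \<or> j' \<^bold>\<in> j" using k(2) unfolding ismax_def by blast
            then show False using 2 \<open>\<not> j' \<^bold>\<in> j\<close> by auto
          qed
        qed
        then show ?thesis using k(1) by blast
      qed
    qed
  qed
  with assms(2,3) show ?thesis unfolding W_def by blast
qed

text \<open>For a set of ordinals, the least ordinal that includes \<open>k\<close>; it then
  includes all predecessors of \<open>k\<close> as well.\<close>

definition hull :: "'a \<Rightarrow> 'a" where
  "hull k = un (Uni k) k"

lemma ord_hull:
  assumes "ord_set k"
  shows "ord (hull k)"
proof -
  have o: "\<And>x. x \<^bold>\<in> k \<Longrightarrow> ord x" using assms by (simp add: ord_set_def)
  have *: "ord x" if "x \<^bold>\<in> hull k" for x using that o ord_mem unfolding hull_def by auto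
  show ?thesis unfolding ord_def
  proof (intro conjI allI impI)
    fix y z assume "z \<^bold>\<in> y \<and> y \<^bold>\<in> hull k"
    then show "z \<^bold>\<in> hull k" using o ord_trans unfolding hull_def by auto
  qed (use * in \<open>auto simp: ord_def\<close>)
qed

lemma subset_hull: "subset k (hull k)"
  by (simp add: hull_def subset_def)

text \<open>\<open>ex_lt_minimal\<close> is applied to the counterexamples inside
  \<open>hull k\<close>; by \<open>lt_subset\<close>, their predecessors stay inside
  \<open>hull k\<close>.\<close>

lemma lt_induct:
  assumes P: "df (\<lambda>s. P (s 0))" and k: "ord_set k"
    and step: "\<And>k. ord_set k \<Longrightarrow> (\<And>k'. ord_set k' \<Longrightarrow> lt k' k \<Longrightarrow> P k') \<Longrightarrow> P k"
  shows "P k"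
proof (rule ccontr)
  assume "\<not> P k"
  define X where "X = SEP (power_set (hull k)) (\<lambda>k'. ord_set k' \<and> \<not> P k')"
  have X: "k' \<^bold>\<in> X \<longleftrightarrow> subset k' (hull k) \<and> ord_set k' \<and> \<not> P k'" for k'
    unfolding X_def by (subst mem_SEP) (intro dfs P, simp add: mem_power_set)
  have "k \<^bold>\<in> X" using k \<open>\<not> P k\<close> subset_hull by (simp add: X)
  then obtain k0 where k0: "k0 \<^bold>\<in> X" "\<forall>k'. k' \<^bold>\<in> X \<longrightarrow> \<not> lt k' k0"
    using ex_lt_minimal[OF ord_hull[OF k], of k X] X by blast
  have "P k0"
  proof (rule step)
    show "ord_set k0" using k0 X by blast
    fix k' assume "ord_set k'" "lt k' k0"
    moreover from this have "subset k' (hull k)"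
      using lt_subset[OF _ _ _ ord_hull[OF k], of k0 k'] k0(1) X by blast
    ultimately show "P k'" using k0(2) X by blast
  qed
  then show False using k0 X by blast
qed

definition preds :: "'a \<Rightarrow> 'a" where
  "preds k = SEP (power_set (hull k)) (\<lambda>k'. ord_set k' \<and> lt k' k)"

lemma mem_preds: "ord_set k \<Longrightarrow> k' \<^bold>\<in> preds k \<longleftrightarrow> ord_set k' \<and> lt k' k"
  unfolding preds_def
  by (subst mem_SEP) (intro dfs, use lt_subset[OF _ _ _ ord_hull subset_hull, of k k'] in \<open>auto simp: mem_power_set\<close>)

end

context ZF
begin

section \<open>Recursion along finite sets of ordinals\<close>

text \<open>\<open>G\<close> receives the earlier values as a relation of the metalogic;
  \<open>df_G\<close> demands definability when this relation is coded by a set \<open>s 0\<close>.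
  Since \<open>G_in\<close> confines all values to \<open>A\<close>, the approximations are
  sets.\<close>

lemma lt_recursion:
  assumes df_G: "df (\<lambda>s. G (\<lambda>k y. ord_set k \<and> lt k (s 1) \<and> pr k y \<^bold>\<in> s 0) (s 1) (s 2))"
    and G_in: "\<And>L k x. G L k x \<Longrightarrow> x \<^bold>\<in> A"
  obtains D where "df (\<lambda>s. D (s 0) (s 1))"
    and "\<And>k x. ord_set k \<Longrightarrow> D k x \<longleftrightarrow> G (\<lambda>k' y. ord_set k' \<and> lt k' k \<and> D k' y) k x"
proof -
  define H where "H R k = (\<lambda>k' y. ord_set k' \<and> lt k' k \<and> pr k' y \<^bold>\<in> R)" for R k
  have df_G': "df (\<lambda>s. G (H (t s) (u s)) (u s) (v s))" if "dt t" "dt u" "dt v" for t u v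
    using df_term3[where P = "\<lambda>R k x. G (H R k) k x", OF _ that] df_G unfolding H_def by simp
  \<comment> \<open>An approximation obeys the recursion at all indices up to and including
    \<open>k\<close>; \<open>D\<close> reads its values off from any of them.\<close>
  define appr where "appr R k \<longleftrightarrow>
    (\<forall>k' y. ord_set k' \<and> (lt k' k \<or> k' = k) \<longrightarrow> (pr k' y \<^bold>\<in> R \<longleftrightarrow> G (H R k') k' y))" for R k
  have df_appr: "df (\<lambda>s. appr (t s) (u s))" if "dt t" "dt u" for t u
  proof (rule df_term2[where P = appr, OF _ that])
    show "df (\<lambda>s. appr (s 0) (s 1))" unfolding appr_def by (intro dfs df_G')
  qed
  define D where "D k x \<longleftrightarrow> (\<exists>R. appr R k \<and> pr k x \<^bold>\<in> R)" for k x
  have df_D: "df (\<lambda>s. D (t s) (u s))" if "dt t" "dt u" for t u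
  proof (rule df_term2[where P = D, OF _ that])
    show "df (\<lambda>s. D (s 0) (s 1))" unfolding D_def by (intro dfs df_appr)
  qed
  have unique: "pr k' y \<^bold>\<in> R \<longleftrightarrow> pr k' y \<^bold>\<in> R'"
    if "ord_set k" "appr R k" "appr R' k" "ord_set k'" "lt k' k \<or> k' = k" for k k' R R' y
  proof -
    have "lt k' k \<or> k' = k \<longrightarrow> (\<forall>y. pr k' y \<^bold>\<in> R \<longleftrightarrow> pr k' y \<^bold>\<in> R')"
    proof (rule lt_induct[OF _ that(4)])
      show "df (\<lambda>s. lt (s 0) k \<or> s 0 = k \<longrightarrow> (\<forall>y. pr (s 0) y \<^bold>\<in> R \<longleftrightarrow> pr (s 0) y \<^bold>\<in> R'))"
        by (intro dfs)
      fix k' assume k': "ord_set k'" and IH: "\<And>k''. ord_set k'' \<Longrightarrow> lt k'' k' \<Longrightarrow>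
          lt k'' k \<or> k'' = k \<longrightarrow> (\<forall>y. pr k'' y \<^bold>\<in> R \<longleftrightarrow> pr k'' y \<^bold>\<in> R')"
      show "lt k' k \<or> k' = k \<longrightarrow> (\<forall>y. pr k' y \<^bold>\<in> R \<longleftrightarrow> pr k' y \<^bold>\<in> R')"
      proof
        assume le: "lt k' k \<or> k' = k"
        have "H R k' k'' y \<longleftrightarrow> H R' k' k'' y" for k'' y
        proof (cases "ord_set k'' \<and> lt k'' k'")
          case True
          then have "lt k'' k" using le lt_trans[of k'' k' k] k' that(1) by blast
          then show ?thesis using IH True unfolding H_def by blast
        qed (auto simp: H_def)
        then have "H R k' = H R' k'" by (intro ext)
        then show "\<forall>y. pr k' y \<^bold>\<in> R \<longleftrightarrow> pr k' y \<^bold>\<in> R'"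
          using that(2,3) le k' unfolding appr_def by simp
      qed
    qed
    with that show ?thesis by blast
  qed
  have appr_below: "appr R k'" if "appr R k" "ord_set k" "ord_set k'" "lt k' k" for R k k'
    using that lt_trans[of _ k' k] unfolding appr_def by blast
  have D_iff: "D k' y \<longleftrightarrow> pr k' y \<^bold>\<in> R" if "ord_set k" "ord_set k'" "appr R k" "lt k' k \<or> k' = k" for k k' R y
  proof -
    have "appr R k'" using that appr_below by blast
    then show ?thesis unfolding D_def using unique[OF that(2) _ _ that(2)] by blast
  qed
  have ex: "\<exists>R. appr R k" if "ord_set k" for k
  proof (rule lt_induct[OF _ that])
    show "df (\<lambda>s. \<exists>R. appr R (s 0))" by (intro dfs df_appr)
    fix k assume k: "ord_set k" and IH: "\<And>k'. ord_set k' \<Longrightarrow> lt k' k \<Longrightarrow> \<exists>R. appr R k'"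
    have D_in: "D k' y \<Longrightarrow> y \<^bold>\<in> A" if "ord_set k'" for k' y
      using that G_in unfolding D_def appr_def by blast
    \<comment> \<open>No approximations have to be chosen: they agree by \<open>unique\<close>, so
      the definable \<open>D\<close> collects the values below \<open>k\<close>, and
      \<open>R\<close> adds only those at \<open>k\<close>.\<close>
    define R0 where "R0 = SEP (times (preds k) A) (\<lambda>p. \<exists>k' x. p = pr k' x \<and> D k' x)"
    define R where "R = un R0 (SEP (times (ins k emp) A) (\<lambda>p. \<exists>x. p = pr k x \<and> G (H R0 k) k x))"
    have R0: "pr k' y \<^bold>\<in> R0 \<longleftrightarrow> ord_set k' \<and> lt k' k \<and> D k' y" for k' y
      unfolding R0_def using D_in by (subst mem_SEP) (intro dfs df_D, auto simp: mem_preds[OF k])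
    have R: "pr k' y \<^bold>\<in> R \<longleftrightarrow> pr k' y \<^bold>\<in> R0 \<or> k' = k \<and> G (H R0 k) k y" for k' y
      unfolding R_def mem_un using G_in by (subst mem_SEP) (intro dfs df_G', auto)
    have "H R0 k = H R k" unfolding H_def R using lt_irrefl by (intro ext) auto
    have "pr k' y \<^bold>\<in> R \<longleftrightarrow> G (H R k') k' y" if k': "ord_set k'" "lt k' k \<or> k' = k" for k' y
    proof (cases "k' = k")
      case True
      then show ?thesis using R R0 lt_irrefl \<open>H R0 k = H R k\<close> by auto
    next
      case False
      then have less: "lt k' k" using k' by blast
      then obtain S where S: "appr S k'" using IH k' by blast
      have "H R k' k'' z \<longleftrightarrow> H S k' k'' z" for k'' z
      proof (cases "ord_set k'' \<and> lt k'' k'")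
        case True
        then have "lt k'' k" "k'' \<noteq> k" using less lt_trans[of k'' k' k] k' k lt_irrefl by blast+
        then show ?thesis unfolding H_def R R0
          using True D_iff[OF k'(1) _ S, of k''] by auto
      qed (auto simp: H_def)
      then have "H R k' = H S k'" by (intro ext)
      moreover have "pr k' y \<^bold>\<in> R \<longleftrightarrow> pr k' y \<^bold>\<in> S"
        using False less k' D_iff[OF k'(1) k'(1) S] by (simp add: R R0)
      ultimately show ?thesis using S k' unfolding appr_def by simp
    qed
    then have "appr R k" unfolding appr_def by blast
    then show "\<exists>R. appr R k" by blast
  qed
  have "D k x \<longleftrightarrow> G (\<lambda>k' y. ord_set k' \<and> lt k' k \<and> D k' y) k x" if k: "ord_set k" for k x
  proof -
    obtain R where R: "appr R k" using ex[OF k] by blast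
    have "H R k = (\<lambda>k' y. ord_set k' \<and> lt k' k \<and> D k' y)"
      unfolding H_def using D_iff[OF k _ R] by (intro ext) auto
    then show ?thesis using D_iff[OF k k R] R k unfolding appr_def by simp
  qed
  moreover have "df (\<lambda>s. D (s 0) (s 1))" by (intro df_D dfs)
  ultimately show ?thesis using that by blast
qed

end

section \<open>The layers\<close>

locale layer_base = coded_partitions +
  fixes a b c :: 'a
  assumes abc: "a \<^bold>\<in> A" "b \<^bold>\<in> A" "c \<^bold>\<in> A" "a \<noteq> b" "a \<noteq> c" "b \<noteq> c"
begin

definition base :: 'a where
  "base = ins a (ins b (ins c emp))"

text \<open>In the following, \<open>L k y\<close> says that \<open>y\<close> lies in the layer with index \<open>k\<close>, among the layers
  constructed so far. The sets \<open>T\<close> with \<open>req L i e n T\<close> are those attached to the pair \<open>(e, n)\<close>, and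
  \<open>pos e n m\<close> for \<open>m > n\<close> are the indices reserved for it.\<close>

definition covered :: "('a \<Rightarrow> 'a \<Rightarrow> bool) \<Rightarrow> 'a \<Rightarrow> bool" where
  "covered L y \<longleftrightarrow> y \<^bold>\<in> base \<or> (\<exists>k. L k y)"

definition pos :: "'a \<Rightarrow> 'a \<Rightarrow> 'a \<Rightarrow> 'a" where
  "pos e n m = un e (upr n m)"

definition req :: "('a \<Rightarrow> 'a \<Rightarrow> bool) \<Rightarrow> 'a \<Rightarrow> 'a \<Rightarrow> 'a \<Rightarrow> 'a \<Rightarrow> bool" where
  "req L i e n T \<longleftrightarrow> subset T A \<and> (\<forall>y. supp T y \<longrightarrow> y \<^bold>\<in> base \<or>
     (\<exists>k. L k y \<and> (\<forall>j. j \<^bold>\<in> k \<longrightarrow> j \<^bold>\<in> e \<or> j \<^bold>\<in> n \<or> j = i)))"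

text \<open>A set \<open>T\<close> has at most one trace \<open>m\<close>, the only one whose
  reserved layer is included in \<open>T\<close>; therefore finitely many \<open>T\<close> leave
  some \<open>m\<close> free.\<close>

definition trace :: "('a \<Rightarrow> 'a \<Rightarrow> bool) \<Rightarrow> 'a \<Rightarrow> 'a \<Rightarrow> 'a \<Rightarrow> 'a \<Rightarrow> bool" where
  "trace L e n m T \<longleftrightarrow>
     (\<forall>m'. m' \<^bold>\<in> om \<and> n \<^bold>\<in> m' \<longrightarrow> ((\<forall>y. L (pos e n m') y \<longrightarrow> y \<^bold>\<in> T) \<longleftrightarrow> m' = m))"

definition free :: "('a \<Rightarrow> 'a \<Rightarrow> bool) \<Rightarrow> 'a \<Rightarrow> 'a \<Rightarrow> 'a \<Rightarrow> 'a \<Rightarrow> bool" where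
  "free L i e n m \<longleftrightarrow> m \<^bold>\<in> om \<and> n \<^bold>\<in> m \<and> \<not> (\<exists>T. req L i e n T \<and> trace L e n m T)"

text \<open>Taking the least free number makes the selection definable.\<close>

definition chosen :: "('a \<Rightarrow> 'a \<Rightarrow> bool) \<Rightarrow> 'a \<Rightarrow> 'a \<Rightarrow> 'a \<Rightarrow> 'a \<Rightarrow> bool" where
  "chosen L i e n m \<longleftrightarrow> free L i e n m \<and> (\<forall>m'. m' \<^bold>\<in> m \<longrightarrow> \<not> free L i e n m')"

text \<open>Since \<open>e\<close> avoids \<open>om\<close>, different pairs have different reserved
  indices, see \<open>pos_inj\<close>; so the selections for all pairs can be made at once.\<close>

definition diag :: "('a \<Rightarrow> 'a \<Rightarrow> bool) \<Rightarrow> 'a \<Rightarrow> 'a" where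
  "diag L i = SEP A (\<lambda>y. \<exists>e n m. ord_set e \<and> subset e i \<and> (\<forall>j. j \<^bold>\<in> e \<longrightarrow> \<not> j \<^bold>\<in> om) \<and> n \<^bold>\<in> om \<and>
     chosen L i e n m \<and> L (pos e n m) y)"

text \<open>In the first case the supports of all saturated sets are used, as no particular one can
  be selected; in the second, \<open>diag\<close> defines a single set.\<close>

definition next_layer :: "('a \<Rightarrow> 'a \<Rightarrow> bool) \<Rightarrow> 'a \<Rightarrow> 'a \<Rightarrow> bool" where
  "next_layer L k x \<longleftrightarrow> x \<^bold>\<in> A \<and> \<not> covered L x \<and>
     (subset k om \<and> (\<exists>S. saturated (SEP A (covered L)) S \<and> supp S x) \<or>
      \<not> subset k om \<and> (\<exists>i. ismax i k \<and> supp (diag L i) x))"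

lemma dt_pos [dfs]: "dt t \<Longrightarrow> dt u \<Longrightarrow> dt v \<Longrightarrow> dt (\<lambda>s. pos (t s) (u s) (v s))"
  unfolding pos_def by (intro dfs)

lemmas layer_defs = next_layer_def diag_def chosen_def free_def trace_def req_def covered_def

end

section \<open>Properties of the layers obtained by recursion\<close>

locale layers = layer_base +
  fixes D :: "'a \<Rightarrow> 'a \<Rightarrow> bool"
  assumes df_D0: "df (\<lambda>s. D (s 0) (s 1))"
    and D_eq: "ord_set k \<Longrightarrow> D k x \<longleftrightarrow> next_layer (\<lambda>k' y. ord_set k' \<and> lt k' k \<and> D k' y) k x"
begin

lemma df_D [dfs]: "dt t \<Longrightarrow> dt u \<Longrightarrow> df (\<lambda>s. D (t s) (u s))"
  by (rule df_term2[where P = D, OF df_D0])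

definition L :: "'a \<Rightarrow> 'a \<Rightarrow> 'a \<Rightarrow> bool" where
  "L k k' y \<longleftrightarrow> ord_set k' \<and> lt k' k \<and> D k' y"

lemma df_L [dfs]: "dt t \<Longrightarrow> dt u \<Longrightarrow> dt v \<Longrightarrow> df (\<lambda>s. L (t s) (u s) (v s))"
  unfolding L_def by (intro dfs)

lemma D_iff: "ord_set k \<Longrightarrow> D k x \<longleftrightarrow> next_layer (L k) k x"
  using D_eq unfolding L_def[abs_def] by blast

lemma D_in: "ord_set k \<Longrightarrow> D k x \<Longrightarrow> x \<^bold>\<in> A"
  by (simp add: D_iff next_layer_def)

lemma D_disjoint:
  assumes "ord_set k" "ord_set k'" "D k x" "D k' x"
  shows "k = k'"
proof (rule ccontr)
  have new: "\<not> covered (L k) x" if "ord_set k" "D k x" for k using that by (simp add: D_iff next_layer_def)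
  assume "k \<noteq> k'"
  then have "lt k k' \<or> lt k' k" using lt_total assms by blast
  then have "L k' k x \<or> L k k' x" using assms by (auto simp: L_def)
  then show False using new assms unfolding covered_def by blast
qed

text \<open>Finitely many \<open>T\<close> have finitely many traces, and finitely many numbers are
  at most \<open>n\<close>. If no \<open>m\<close> above \<open>n\<close> were free,
  \<open>om\<close> would be finite.\<close>

lemma ex_trace_free:
  assumes n: "n \<^bold>\<in> om" and bnd: "bnd (req K i e n)" and df_K: "df (\<lambda>s. K (s 0) (s 1))"
  shows "\<exists>m. chosen K i e n m"
proof -
  have df_K': "df (\<lambda>s. K (t s) (u s))" if "dt t" "dt u" for t u
    by (rule df_term2[where P = K, OF df_K that])
  have "\<exists>m. m \<^bold>\<in> om \<and> free K i e n m"
  proof (rule ccontr)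
    assume no: "\<not> ?thesis"
    have "bnd (\<lambda>m. \<exists>T. req K i e n T \<and> m \<^bold>\<in> om \<and> n \<^bold>\<in> m \<and> trace K e n m T)"
    proof (rule bnd_image[OF _ bnd])
      show "df (\<lambda>s. s 1 \<^bold>\<in> om \<and> n \<^bold>\<in> s 1 \<and> trace K e n (s 1) (s 0))"
        unfolding trace_def by (intro dfs df_K')
      show "df (\<lambda>s. req K i e n (s 0))" unfolding req_def by (intro dfs df_K')
      fix T m m'
      assume m: "m \<^bold>\<in> om \<and> n \<^bold>\<in> m \<and> trace K e n m T" and m': "m' \<^bold>\<in> om \<and> n \<^bold>\<in> m' \<and> trace K e n m' T"
      then have "\<forall>y. K (pos e n m) y \<longrightarrow> y \<^bold>\<in> T" unfolding trace_def by blast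
      then show "m = m'" using m m' unfolding trace_def by blast
    qed
    then have "bnd (\<lambda>m. m \<^bold>\<in> om \<and> n \<^bold>\<in> m)" by (rule bnd_mono) (use no in \<open>auto simp: free_def\<close>)
    moreover have "bnd (\<lambda>m. m \<^bold>\<in> ins n n)"
      using n natural_fin by (intro bnd_fin fin_ins) (simp add: mem_om)
    ultimately have "bnd (\<lambda>m. m \<^bold>\<in> om \<and> n \<^bold>\<in> m \<or> m \<^bold>\<in> ins n n)" by (rule bnd_disj)
    moreover have "m \<^bold>\<in> om \<and> n \<^bold>\<in> m \<or> m \<^bold>\<in> ins n n" if "m \<^bold>\<in> om" for m
      using that n ord_linear[of m n] natural_ord by (auto simp: mem_om)
    ultimately have "fin om" by (intro bnd_finD) (rule bnd_mono)
    then show False using not_fin_om by simp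
  qed
  then obtain m0 where "m0 \<^bold>\<in> om" "free K i e n m0" by blast
  moreover have "df (\<lambda>s. free K i e n (s 0))"
    unfolding free_def trace_def req_def by (intro dfs df_K')
  ultimately obtain m where "m \<^bold>\<in> om" "free K i e n m" "\<forall>m'. m' \<^bold>\<in> m \<and> m' \<^bold>\<in> om \<longrightarrow> \<not> free K i e n m'"
    using ex_minimal[of "free K i e n"] by blast
  then show ?thesis unfolding chosen_def using ord_trans[OF ord_om] by blast
qed

lemma chosen_unique:
  assumes "chosen K i e n m" "chosen K i e n m'"
  shows "m = m'"
proof -
  have "ord m" "ord m'" using assms natural_ord by (auto simp: chosen_def free_def mem_om)
  then show ?thesis using ord_linear[of m m'] assms unfolding chosen_def by blast
qed

text \<open>\<open>e\<close> is recovered as the part outside \<open>om\<close>; the other two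
  elements are told apart by which is a member of the other.\<close>

lemma pos_inj:
  assumes "pos e n m = pos e' n' m'" "\<forall>j. j \<^bold>\<in> e \<longrightarrow> \<not> j \<^bold>\<in> om" "\<forall>j. j \<^bold>\<in> e' \<longrightarrow> \<not> j \<^bold>\<in> om"
    "m \<^bold>\<in> om" "n \<^bold>\<in> m" "m' \<^bold>\<in> om" "n' \<^bold>\<in> m'"
  shows "e = e' \<and> n = n' \<and> m = m'"
proof -
  have n: "n \<^bold>\<in> om" "n' \<^bold>\<in> om" using assms ord_trans[OF ord_om] by blast+
  have p: "j \<^bold>\<in> e \<or> j = n \<or> j = m \<longleftrightarrow> j \<^bold>\<in> e' \<or> j = n' \<or> j = m'" for j
    using assms(1) mem_un[of j e "upr n m"] mem_un[of j e' "upr n' m'"] by (simp add: pos_def)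
  have "j \<^bold>\<in> e \<longleftrightarrow> j \<^bold>\<in> e'" for j using p[of j] assms n by metis
  then have e: "e = e'" by (rule set_eqI)
  have "j = n \<or> j = m \<longleftrightarrow> j = n' \<or> j = m'" for j using p[of j] assms n e by metis
  then have "upr n m = upr n' m'" by (intro set_eqI) simp
  then have "n = n' \<and> m = m' \<or> n = m' \<and> m = n'" by (simp add: upr_eq_iff)
  then show ?thesis using e assms mem_asym by blast
qed

text \<open>All predecessors of \<open>k\<close> are subsets of a single natural number
  \<open>i\<close>, so there are finitely many, and the set \<open>F\<close> of covered elements is
  finite; \<open>ex_supp_saturated\<close> then applies.\<close>

lemma D_finite_stage:
  assumes k: "ord_set k" "subset k om" and IH: "\<And>k'. ord_set k' \<Longrightarrow> lt k' k \<Longrightarrow> bnd (D k')"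
  shows "(\<exists>x. D k x) \<and> bnd (D k)"
proof -
  define F where "F = SEP A (covered (L k))"
  have F: "x \<^bold>\<in> F \<longleftrightarrow> x \<^bold>\<in> A \<and> covered (L k) x" for x
    unfolding F_def by (rule mem_SEP) (unfold covered_def, intro dfs)
  obtain i where i: "natural i" "subset k i"
  proof (cases "k = emp")
    case True
    then show ?thesis using that[OF natural_emp] by simp
  next
    case False
    then obtain m where "ismax m k" using ex_ismax k by blast
    then show ?thesis using that[of "ins m m"] k natural_succ
      by (auto simp: ismax_def subset_def mem_om)
  qed
  have "fin (preds k)"
  proof (rule fin_subset[OF fin_power_set[OF natural_fin[OF i(1)]]])
    show "subset (preds k) (power_set i)"
      using lt_subset[OF k(1) _ _ natural_ord i(2)] i(1) mem_preds[OF k(1)]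
      by (auto simp: subset_def[of "preds k"] mem_power_set)
  qed
  then have "bnd (\<lambda>x. \<exists>k'. k' \<^bold>\<in> preds k \<and> D k' x)"
    using IH mem_preds[OF k(1)] by (intro bnd_UN df_D0) auto
  then have "bnd (\<lambda>x. x \<^bold>\<in> base \<or> (\<exists>k'. k' \<^bold>\<in> preds k \<and> D k' x))"
    by (intro bnd_disj bnd_fin) (simp add: base_def fin_ins)
  then have "bnd (\<lambda>x. x \<^bold>\<in> F)"
    by (rule bnd_mono) (auto simp: F covered_def L_def mem_preds[OF k(1)])
  then have "fin F" by (rule bnd_finD)
  have D: "D k x \<longleftrightarrow> x \<^bold>\<in> A \<and> \<not> x \<^bold>\<in> F \<and> (\<exists>S. saturated F S \<and> supp S x)" for x
    using k by (auto simp: D_iff next_layer_def F F_def[symmetric])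
  have "subset F A" "a \<^bold>\<in> F" "b \<^bold>\<in> F" "c \<^bold>\<in> F"
    using abc by (auto simp: subset_def F covered_def base_def)
  from ex_supp_saturated[OF \<open>fin F\<close> this abc(4-6)] have "\<exists>x. D k x" unfolding D using supp_in by blast
  moreover have "bnd (D k)" by (rule bnd_mono[OF bnd_supp_saturated[OF \<open>fin F\<close>]]) (simp add: D)
  ultimately show ?thesis by blast
qed

text \<open>If nothing new arose, the support of the diagonal set \<open>S\<close> would be covered
  by finitely many layers, whose indices yield a pair \<open>(e, n)\<close> to which
  \<open>S\<close> is attached. But \<open>S\<close> traces the chosen \<open>m\<close> of this
  pair, although \<open>m\<close> is free.\<close>

lemma D_infinite_stage:
  assumes k: "ord_set k" "\<not> subset k om"
    and IH: "\<And>k'. ord_set k' \<Longrightarrow> lt k' k \<Longrightarrow> (\<exists>x. D k' x) \<and> bnd (D k')"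
  shows "(\<exists>x. D k x) \<and> bnd (D k)"
proof -
  have "k \<noteq> emp" using k(2) by (auto simp: subset_def)
  then obtain i where i: "ismax i k" using ex_ismax k by blast
  then have "i \<^bold>\<in> k" unfolding ismax_def by blast
  then have "ord i" using k unfolding ord_set_def by blast
  have "\<not> i \<^bold>\<in> om"
  proof
    assume "i \<^bold>\<in> om"
    then have "subset k om" using i ord_trans[OF ord_om] unfolding ismax_def subset_def by blast
    with k show False by simp
  qed
  then have om_i: "subset om i" using om_cases[OF \<open>ord i\<close>] by blast
  have i_unique: "i' = i" if "ismax i' k" for i'
    using that i mem_asym unfolding ismax_def by blast
  define S where "S = diag (L k) i"
  have S: "y \<^bold>\<in> S \<longleftrightarrow> y \<^bold>\<in> A \<and> (\<exists>e n m. ord_set e \<and> subset e i \<and> (\<forall>j. j \<^bold>\<in> e \<longrightarrow> \<not> j \<^bold>\<in> om) \<and> n \<^bold>\<in> om \<and>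
     chosen (L k) i e n m \<and> L k (pos e n m) y)" for y
    unfolding S_def diag_def by (rule mem_SEP) (unfold layer_defs, intro dfs)
  have SA: "subset S A" by (simp add: subset_def S)
  have D: "D k x \<longleftrightarrow> x \<^bold>\<in> A \<and> \<not> covered (L k) x \<and> supp S x" for x
    using D_iff[OF k(1)] k(2) i i_unique unfolding next_layer_def S_def by blast
  have "bnd (D k)" by (rule bnd_mono[OF bnd_supp[OF SA]]) (simp add: D)
  moreover have "\<exists>x. D k x"
  proof (rule ccontr)
    assume "\<not> ?thesis"
    then have cov: "covered (L k) x" if "supp S x" for x using that supp_in unfolding D by blast
    \<comment> \<open>The indices of the layers that meet the support. They are finitely many,
      because each element of the finite support lies in at most one layer.\<close>
    define K where "K k' \<longleftrightarrow> (\<exists>y. supp S y \<and> L k k' y)" for k'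
    have df_K: "df (\<lambda>s. K (t s))" if "dt t" for t
    proof (rule df_term[where P = K, OF _ that])
      show "df (\<lambda>s. K (s 0))" unfolding K_def by (intro dfs)
    qed
    have "bnd K" unfolding K_def
    proof (rule bnd_image[OF _ bnd_supp[OF SA]])
      show "df (\<lambda>s. L k (s 1) (s 0))" "df (\<lambda>s. supp S (s 0))" by (intro dfs)+
    qed (use D_disjoint in \<open>auto simp: L_def\<close>)
    then obtain K' where K': "fin K'" "\<And>k'. K k' \<Longrightarrow> k' \<^bold>\<in> K'" unfolding bnd_def by blast
    define J where "J j \<longleftrightarrow> (\<exists>k'. k' \<^bold>\<in> K' \<and> K k' \<and> j \<^bold>\<in> k')" for j
    have df_J: "df (\<lambda>s. J (t s))" if "dt t" for t
    proof (rule df_term[where P = J, OF _ that])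
      show "df (\<lambda>s. J (s 0))" unfolding J_def by (intro dfs df_K)
    qed
    have "bnd J" unfolding J_def
    proof (rule bnd_UN[OF _ K'(1)])
      show "df (\<lambda>s. K (s 0) \<and> s 1 \<^bold>\<in> s 0)" by (intro dfs df_K)
      fix k' show "bnd (\<lambda>j. K k' \<and> j \<^bold>\<in> k')"
      proof (cases "K k'")
        case True
        then have "fin k'" unfolding K_def L_def ord_set_def by blast
        then show ?thesis by (intro bnd_mono[OF bnd_fin]) auto
      qed (auto intro: bnd_mono[OF bnd_fin[OF fin_emp]])
    qed
    \<comment> \<open>A predecessor of \<open>k\<close> may still contain the maximum
      \<open>i\<close>; for this reason \<open>req\<close> admits \<open>j = i\<close>.\<close>
    have J_i: "j \<^bold>\<in> i \<or> j = i" if J: "J j" for j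
    proof -
      obtain k' where k': "ord_set k'" "lt k' k" "j \<^bold>\<in> k'" using J unfolding J_def K_def L_def by blast
      have "subset k (ins i i)" using i by (auto simp: ismax_def subset_def)
      then have "subset k' (ins i i)"
        using lt_subset[OF k(1) k'(1,2) ord_succ] \<open>ord i\<close> by blast
      then show ?thesis using k'(3) by (auto simp: subset_def)
    qed
    \<comment> \<open>The elements of the indices in \<open>K\<close> are of three kinds: those
      below \<open>i\<close> and outside \<open>om\<close> form \<open>e\<close>, those in
      \<open>om\<close> form \<open>N\<close>, and \<open>i\<close> itself may occur.\<close>
    define e where "e = SEP i (\<lambda>j. J j \<and> \<not> j \<^bold>\<in> om)"
    have e: "j \<^bold>\<in> e \<longleftrightarrow> j \<^bold>\<in> i \<and> J j \<and> \<not> j \<^bold>\<in> om" for j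
      unfolding e_def by (rule mem_SEP) (intro dfs df_J)
    have "fin e" by (rule bnd_finD, rule bnd_mono[OF \<open>bnd J\<close>]) (simp add: e)
    then have e_props: "ord_set e" "subset e i" "\<forall>j. j \<^bold>\<in> e \<longrightarrow> \<not> j \<^bold>\<in> om"
      using ord_mem[OF \<open>ord i\<close>] by (auto simp: ord_set_def subset_def e)
    define N where "N = SEP om J"
    have N: "j \<^bold>\<in> N \<longleftrightarrow> j \<^bold>\<in> om \<and> J j" for j unfolding N_def by (rule mem_SEP) (intro dfs df_J)
    have "fin N" by (rule bnd_finD, rule bnd_mono[OF \<open>bnd J\<close>]) (simp add: N)
    then have "ord_set N" by (simp add: ord_set_def N mem_om natural_ord)
    \<comment> \<open>\<open>req\<close> asks for elements of \<open>n\<close>, so a strict bound of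
      \<open>N\<close> is taken: the successor of its maximum.\<close>
    obtain n where n: "n \<^bold>\<in> om" "\<And>j. j \<^bold>\<in> N \<Longrightarrow> j \<^bold>\<in> n"
    proof (cases "N = emp")
      case True
      then show ?thesis using that[of emp] natural_emp by (simp add: mem_om)
    next
      case False
      then obtain m where m: "ismax m N" using ex_ismax[OF \<open>ord_set N\<close>] by blast
      then have "natural m" unfolding ismax_def N mem_om by blast
      then show ?thesis using that[of "ins m m"] m natural_succ by (auto simp: ismax_def mem_om)
    qed
    have req_S: "req (L k) i e n S" unfolding req_def
    proof (intro conjI allI impI SA)
      fix y assume y: "supp S y"
      then consider "y \<^bold>\<in> base" | k' where "L k k' y" using cov unfolding covered_def by blast
      then show "y \<^bold>\<in> base \<or> (\<exists>k'. L k k' y \<and> (\<forall>j. j \<^bold>\<in> k' \<longrightarrow> j \<^bold>\<in> e \<or> j \<^bold>\<in> n \<or> j = i))"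
      proof cases
        case (2 k')
        then have "K k'" using y unfolding K_def by blast
        have "j \<^bold>\<in> e \<or> j \<^bold>\<in> n \<or> j = i" if "j \<^bold>\<in> k'" for j
        proof -
          have "J j" unfolding J_def using that \<open>K k'\<close> K'(2) by blast
          then show ?thesis using J_i[of j] e[of j] N[of j] n(2)[of j] by blast
        qed
        then show ?thesis using 2 by blast
      qed blast
    qed
    \<comment> \<open>Finitely many indices consist of elements of \<open>e\<close>,
      \<open>n\<close> and \<open>{i}\<close> only, and their layers are finite by
      \<open>IH\<close>. So the supports of all attached sets lie in one finite set.\<close>
    have "bnd (req (L k) i e n)"
    proof -
      define d where "d = un e (ins i n)"
      have "fin d" unfolding d_def
        using \<open>fin e\<close> n natural_fin by (intro fin_un fin_ins) (auto simp: mem_om)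
      define a where "a = SEP (power_set d) (\<lambda>k'. ord_set k' \<and> lt k' k)"
      have a: "k' \<^bold>\<in> a \<longleftrightarrow> subset k' d \<and> ord_set k' \<and> lt k' k" for k'
        unfolding a_def by (subst mem_SEP) (intro dfs, simp add: mem_power_set)
      have "fin a"
        by (rule fin_subset[OF fin_power_set[OF \<open>fin d\<close>]])
           (simp add: subset_def[of a] a mem_power_set)
      have "bnd (\<lambda>x. \<exists>k'. k' \<^bold>\<in> a \<and> D k' x)" using IH a by (intro bnd_UN df_D0 \<open>fin a\<close>) blast
      then have "bnd (\<lambda>y. y \<^bold>\<in> base \<or> (\<exists>k'. k' \<^bold>\<in> a \<and> D k' y))"
        by (intro bnd_disj bnd_fin) (simp add: base_def fin_ins)
      from bnd_supported[OF this] show ?thesis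
      proof (rule bnd_mono)
        fix T assume "req (L k) i e n T"
        then show "subset T A \<and> (\<forall>x. supp T x \<longrightarrow> x \<^bold>\<in> base \<or> (\<exists>k'. k' \<^bold>\<in> a \<and> D k' x))"
          unfolding req_def L_def a d_def subset_def[of _ "un e (ins i n)"] mem_un mem_ins by blast
      qed
    qed
    moreover have "df (\<lambda>s. L k (s 0) (s 1))" by (intro dfs)
    ultimately obtain m where m: "chosen (L k) i e n m" using ex_trace_free[OF n(1)] by blast
    \<comment> \<open>Reserved indices are subsets of \<open>i\<close>, because \<open>om\<close>
      is; hence they precede \<open>k\<close>, whose maximum is \<open>i\<close>, and their layers
      are already available.\<close>
    have pos: "ord_set (pos e' n' m') \<and> lt (pos e' n' m') k"
      if "ord_set e'" "subset e' i" "m' \<^bold>\<in> om" "n' \<^bold>\<in> m'" for e' n' m'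
    proof -
      have n': "n' \<^bold>\<in> om" using that ord_trans[OF ord_om] by blast
      have "subset (pos e' n' m') i" using that n' om_i by (auto simp: pos_def subset_def)
      moreover have "ord_set (pos e' n' m')"
        using that n' natural_ord by (auto simp: ord_set_def pos_def mem_om fin_un fin_upr)
      ultimately show ?thesis using lt_max[OF i] by blast
    qed
    have "trace (L k) e n m S" unfolding trace_def
    proof (intro allI impI)
      fix m' assume m': "m' \<^bold>\<in> om \<and> n \<^bold>\<in> m'"
      show "(\<forall>y. L k (pos e n m') y \<longrightarrow> y \<^bold>\<in> S) \<longleftrightarrow> m' = m"
      proof
        assume "m' = m"
        then show "\<forall>y. L k (pos e n m') y \<longrightarrow> y \<^bold>\<in> S"
          unfolding S using m n(1) e_props D_in unfolding L_def by blast
      next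
        \<comment> \<open>By \<open>IH\<close> the layer at \<open>m'\<close> has a point. This
          point entered \<open>S\<close> through some chosen index, and disjointness of the layers
          identifies the two indices.\<close>
        assume sub: "\<forall>y. L k (pos e n m') y \<longrightarrow> y \<^bold>\<in> S"
        have p: "ord_set (pos e n m') \<and> lt (pos e n m') k" using pos e_props m' by blast
        then obtain y where y: "D (pos e n m') y" using IH by blast
        then have "y \<^bold>\<in> S" using sub p unfolding L_def by blast
        then obtain e1 n1 m1 where 1: "\<forall>j. j \<^bold>\<in> e1 \<longrightarrow> \<not> j \<^bold>\<in> om" "chosen (L k) i e1 n1 m1"
            "L k (pos e1 n1 m1) y"
          unfolding S by blast
        then have "pos e n m' = pos e1 n1 m1" using D_disjoint p y unfolding L_def by blast
        then have "e = e1 \<and> n = n1 \<and> m' = m1"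
          using pos_inj[OF _ e_props(3) 1(1)] 1(2) m' unfolding chosen_def free_def by blast
        then show "m' = m" using 1(2) m chosen_unique by blast
      qed
    qed
    then show False using m req_S unfolding chosen_def free_def by blast
  qed
  ultimately show ?thesis by blast
qed

text \<open>Finiteness of the layers is carried along in the induction, as both stages rely on it
  for the earlier layers.\<close>

lemma D_nonempty:
  assumes "ord_set k"
  shows "\<exists>x. D k x"
proof -
  have "(\<exists>x. D k x) \<and> bnd (D k)"
  proof (rule lt_induct[OF _ assms])
    show "df (\<lambda>s. (\<exists>x. D (s 0) x) \<and> bnd (\<lambda>x. D (s 0) x))" by (intro dfs df_bnd)
    fix k assume k: "ord_set k" and IH: "\<And>k'. ord_set k' \<Longrightarrow> lt k' k \<Longrightarrow> (\<exists>x. D k' x) \<and> bnd (\<lambda>x. D k' x)"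
    then show "(\<exists>x. D k x) \<and> bnd (\<lambda>x. D k x)"
      using D_finite_stage[OF k] D_infinite_stage[OF k] by blast
  qed
  then show ?thesis by blast
qed

text \<open>The layers at singletons of ordinals are non-empty and pairwise disjoint, so as subsets
  of \<open>A\<close> they determine their ordinals. Replacement on \<open>power_set A\<close>
  yields the set of all ordinals, which would be an ordinal and thus its own element.\<close>

lemma contradiction: False
proof -
  define Q where "Q X i \<longleftrightarrow> ord i \<and> (\<forall>x. x \<^bold>\<in> X \<longleftrightarrow> x \<^bold>\<in> A \<and> D (ins i emp) x)" for X i
  have single: "ord_set (ins i emp)" if "ord i" for i using that by (simp add: ord_set_def fin_ins)
  have "\<exists>w. \<forall>i. i \<^bold>\<in> w \<longleftrightarrow> (\<exists>X. X \<^bold>\<in> power_set A \<and> Q X i)"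
  proof (rule replacement)
    show "df (\<lambda>s. Q (s 0) (s 1))" unfolding Q_def by (intro dfs)
    fix X i j assume Q: "Q X i" "Q X j"
    then obtain x where "D (ins i emp) x" "x \<^bold>\<in> X" using D_nonempty single D_in unfolding Q_def by metis
    then have "ins i emp = ins j emp" using Q D_disjoint single unfolding Q_def by metis
    then have "i \<^bold>\<in> ins j emp" by (metis mem_ins)
    then show "i = j" by simp
  qed
  then obtain w where w: "i \<^bold>\<in> w \<longleftrightarrow> (\<exists>X. X \<^bold>\<in> power_set A \<and> Q X i)" for i by blast
  have "i \<^bold>\<in> w \<longleftrightarrow> ord i" for i
  proof -
    define X where "X = SEP A (\<lambda>x. D (ins i emp) x)"
    have X: "x \<^bold>\<in> X \<longleftrightarrow> x \<^bold>\<in> A \<and> D (ins i emp) x" for x unfolding X_def by (rule mem_SEP) (intro dfs)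
    then have "X \<^bold>\<in> power_set A" by (simp add: mem_power_set subset_def)
    then show ?thesis unfolding w using X unfolding Q_def by blast
  qed
  note w = this
  have "ord w" unfolding ord_def w using ord_mem unfolding ord_def by blast
  with w[of w] show False using mem_irrefl[of w] by blast
qed

end

context layer_base
begin

lemma no_coded_partitions: False
proof -
  have "df (\<lambda>s. next_layer (\<lambda>k y. ord_set k \<and> lt k (s 1) \<and> pr k y \<^bold>\<in> s 0) (s 1) (s 2))"
    unfolding layer_defs by (intro dfs)
  then obtain D where D: "df (\<lambda>s. D (s 0) (s 1))"
    "\<And>k x. ord_set k \<Longrightarrow> D k x \<longleftrightarrow> next_layer (\<lambda>k' y. ord_set k' \<and> lt k' k \<and> D k' y) k x"
    by (rule lt_recursion[where A = A]) (auto simp: next_layer_def)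
  interpret layers mem A E a b c D
    by unfold_locales (use D in blast)+
  show False by (rule contradiction)
qed

end

section \<open>From a bijection to a coding of partitions\<close>

context ZF
begin

text \<open>The support is the union of the finitely many non-singleton blocks, each of which is
  finite.\<close>

lemma B_fin_support:
  assumes "P \<^bold>\<in> B_fin A"
  shows "bnd (\<lambda>x. \<exists>y b. y \<noteq> x \<and> b \<^bold>\<in> P \<and> x \<^bold>\<in> b \<and> y \<^bold>\<in> b)"
proof -
  have P: "fin (ns P)" "\<And>b. b \<^bold>\<in> P \<Longrightarrow> fin b"
    using assms unfolding mem_B_fin finitary_partition_def by blast+
  have "bnd (\<lambda>x. \<exists>b. b \<^bold>\<in> ns P \<and> x \<^bold>\<in> b)"
  proof (rule bnd_UN[OF _ P(1)])
    show "df (\<lambda>s. s 1 \<^bold>\<in> s 0)" by (intro dfs)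
    show "\<And>b. b \<^bold>\<in> ns P \<Longrightarrow> bnd (\<lambda>x. x \<^bold>\<in> b)" using P(2) mem_ns by (intro bnd_fin) blast
  qed
  then show ?thesis by (rule bnd_mono) (use mem_ns in blast)
qed

lemma B_fin_eqI:
  assumes "P \<^bold>\<in> B_fin A" "P' \<^bold>\<in> B_fin A"
    and E: "\<And>x y. (\<exists>b. b \<^bold>\<in> P \<and> x \<^bold>\<in> b \<and> y \<^bold>\<in> b) \<longleftrightarrow> (\<exists>b. b \<^bold>\<in> P' \<and> x \<^bold>\<in> b \<and> y \<^bold>\<in> b)"
  shows "P = P'"
proof -
  have sub: "b \<^bold>\<in> P'" if P: "partition P A" "partition P' A"
    and E: "\<And>x y. (\<exists>b. b \<^bold>\<in> P \<and> x \<^bold>\<in> b \<and> y \<^bold>\<in> b) \<longleftrightarrow> (\<exists>b. b \<^bold>\<in> P' \<and> x \<^bold>\<in> b \<and> y \<^bold>\<in> b)"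
    and b: "b \<^bold>\<in> P" for b P P'
  proof -
    obtain x where x: "x \<^bold>\<in> b" using P(1) b unfolding partition_def is_empty_def by blast
    then obtain b' where b': "b' \<^bold>\<in> P'" "x \<^bold>\<in> b'" using E b by blast
    have "y \<^bold>\<in> b \<longleftrightarrow> (\<exists>b. b \<^bold>\<in> P \<and> x \<^bold>\<in> b \<and> y \<^bold>\<in> b)" for y
      using P(1) b x unfolding partition_def by blast
    moreover have "y \<^bold>\<in> b' \<longleftrightarrow> (\<exists>b. b \<^bold>\<in> P' \<and> x \<^bold>\<in> b \<and> y \<^bold>\<in> b)" for y
      using P(2) b' unfolding partition_def by blast
    ultimately have "b = b'" using E by (intro set_eqI) blast
    then show ?thesis using b' by simp
  qed
  have "partition P A" "partition P' A"
    using assms unfolding mem_B_fin finitary_partition_def by blast+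
  then show ?thesis using sub[of P P'] sub[of P' P] E by (intro set_eqI) blast
qed

text \<open>The blocks are the classes of \<open>Q\<close>. A block with two elements is included in
  the finite support; hence it is finite, and there are only finitely many such blocks.\<close>

lemma ex_B_fin:
  assumes Q: "df (\<lambda>s. Q (s 0) (s 1))" and in_A: "\<And>x y. Q x y \<Longrightarrow> x \<^bold>\<in> A"
    and refl: "\<And>x. x \<^bold>\<in> A \<Longrightarrow> Q x x" and sym: "\<And>x y. Q x y \<Longrightarrow> Q y x"
    and trans: "\<And>x y z. Q x y \<Longrightarrow> Q y z \<Longrightarrow> Q x z" and bnd: "bnd (\<lambda>x. \<exists>y. y \<noteq> x \<and> Q x y)"
  shows "\<exists>P. P \<^bold>\<in> B_fin A \<and> (\<forall>x y. (\<exists>b. b \<^bold>\<in> P \<and> x \<^bold>\<in> b \<and> y \<^bold>\<in> b) \<longleftrightarrow> Q x y)"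
proof -
  have Q': "df (\<lambda>s. Q (t s) (u s))" if "dt t" "dt u" for t u
    by (rule df_term2[where P = Q, OF Q that])
  define P where "P = SEP (power_set A) (\<lambda>b. \<exists>x. x \<^bold>\<in> b \<and> (\<forall>y. y \<^bold>\<in> b \<longleftrightarrow> Q x y))"
  have P: "b \<^bold>\<in> P \<longleftrightarrow> subset b A \<and> (\<exists>x. x \<^bold>\<in> b \<and> (\<forall>y. y \<^bold>\<in> b \<longleftrightarrow> Q x y))" for b
    unfolding P_def by (subst mem_SEP) (intro dfs Q', simp add: mem_power_set)
  define cl where "cl x = SEP A (Q x)" for x
  have cl: "y \<^bold>\<in> cl x \<longleftrightarrow> Q x y" for x y
    unfolding cl_def using in_A sym by (subst mem_SEP) (intro dfs Q', blast)
  have cl_P: "cl x \<^bold>\<in> P" if "x \<^bold>\<in> A" for x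
    unfolding P subset_def cl using refl[OF that] in_A[OF sym] by blast
  have P_Q: "Q x y" if "b \<^bold>\<in> P" "x \<^bold>\<in> b" "y \<^bold>\<in> b" for b x y
    using that sym trans unfolding P by blast
  have Q_P: "\<exists>b. b \<^bold>\<in> P \<and> x \<^bold>\<in> b \<and> y \<^bold>\<in> b" if "Q x y" for x y
    using cl_P[OF in_A[OF that]] cl that refl in_A by blast
  have "partition P A" unfolding partition_def
  proof (intro conjI allI impI)
    fix b assume "b \<^bold>\<in> P"
    then show "\<not> is_empty b" unfolding P is_empty_def by blast
  next
    fix b c assume bc: "b \<^bold>\<in> P \<and> c \<^bold>\<in> P \<and> b \<noteq> c"
    show "\<not> (\<exists>x. x \<^bold>\<in> b \<and> x \<^bold>\<in> c)"
    proof
      assume "\<exists>x. x \<^bold>\<in> b \<and> x \<^bold>\<in> c"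
      then obtain x where x: "x \<^bold>\<in> b" "x \<^bold>\<in> c" by blast
      have "y \<^bold>\<in> b \<longleftrightarrow> Q x y" if "b \<^bold>\<in> P" "x \<^bold>\<in> b" for y b
        using that sym trans unfolding P by blast
      then have "b = c" using bc x by (intro set_eqI) blast
      then show False using bc by simp
    qed
  next
    fix x
    show "x \<^bold>\<in> A \<longleftrightarrow> (\<exists>b. x \<^bold>\<in> b \<and> b \<^bold>\<in> P)"
      using Q_P[OF refl] P unfolding subset_def by blast
  qed
  moreover have "fin b" if "b \<^bold>\<in> P" for b
  proof -
    have "bnd (\<lambda>x. x \<^bold>\<in> b)"
    proof (cases "\<exists>x y. x \<^bold>\<in> b \<and> y \<^bold>\<in> b \<and> x \<noteq> y")
      case True
      then have "\<exists>y. y \<^bold>\<in> b \<and> y \<noteq> x" for x by blast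
      then show ?thesis using P_Q[OF that] by (intro bnd_mono[OF bnd]) blast
    next
      case False
      \<comment> \<open>\<open>SOME\<close> names the only element of a block with at most one
        element.\<close>
      then show ?thesis by (intro bnd_mono[OF bnd_eq[of "SOME x. x \<^bold>\<in> b"]]) (metis someI)
    qed
    then show ?thesis by (rule bnd_finD)
  qed
  moreover have "fin (ns P)"
  proof (rule bnd_finD, rule bnd_mono[OF bnd_Pow[OF bnd]])
    fix b x assume "b \<^bold>\<in> ns P"
    then have b: "b \<^bold>\<in> P" "\<exists>x y. x \<^bold>\<in> b \<and> y \<^bold>\<in> b \<and> x \<noteq> y" unfolding mem_ns by blast+
    then have "x \<^bold>\<in> b \<longrightarrow> (\<exists>y. y \<^bold>\<in> b \<and> y \<noteq> x)" for x by blast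
    then show "\<forall>x. x \<^bold>\<in> b \<longrightarrow> (\<exists>y. y \<noteq> x \<and> Q x y)" using P_Q[OF b(1)] by blast
  qed
  ultimately have "P \<^bold>\<in> B_fin A" unfolding mem_B_fin finitary_partition_def by blast
  then show ?thesis using P_Q Q_P by blast
qed

text \<open>\<open>T\<close> codes its image under \<open>f\<close>. As a partition is determined by
  its equivalence relation, injectivity and surjectivity of \<open>f\<close> become
  \<open>E_inj\<close> and \<open>E_surj\<close>.\<close>

lemma bijection_coded_partitions:
  assumes f: "bijection f (power_set A) (B_fin A)"
  shows "coded_partitions mem A (\<lambda>T x y. \<exists>P b. pr T P \<^bold>\<in> f \<and> b \<^bold>\<in> P \<and> x \<^bold>\<in> b \<and> y \<^bold>\<in> b)"
proof
  let ?E = "\<lambda>T x y. \<exists>P b. pr T P \<^bold>\<in> f \<and> b \<^bold>\<in> P \<and> x \<^bold>\<in> b \<and> y \<^bold>\<in> b"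
  have mem: "subset T A \<and> P \<^bold>\<in> B_fin A" if "pr T P \<^bold>\<in> f" for T P
    using f that unfolding bijection_iff by (fastforce simp: mem_power_set)
  have val: "\<exists>!P. pr T P \<^bold>\<in> f" if "subset T A" for T
    using f that unfolding bijection_iff mem_power_set by blast
  have inv: "\<exists>!T. pr T P \<^bold>\<in> f" if "P \<^bold>\<in> B_fin A" for P
    using f that unfolding bijection_iff by blast
  have E: "?E T x y \<longleftrightarrow> (\<exists>b. b \<^bold>\<in> P \<and> x \<^bold>\<in> b \<and> y \<^bold>\<in> b)" if "pr T P \<^bold>\<in> f" for T P x y
    using that val mem by blast
  have part: "partition P A" if "P \<^bold>\<in> B_fin A" for P
    using that unfolding mem_B_fin finitary_partition_def by blast
  show "df (\<lambda>s. ?E (s 0) (s 1) (s 2))" by (intro dfs)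
  fix T x y z
  show "subset T A \<and> x \<^bold>\<in> A \<and> y \<^bold>\<in> A" if "?E T x y"
    using that mem part unfolding partition_def by blast
  show "?E T x x" if "subset T A" "x \<^bold>\<in> A"
    using that val mem part unfolding partition_def by metis
  show "?E T y x" if "?E T x y" using that by blast
  show "?E T x z" if xy: "?E T x y" and yz: "?E T y z"
  proof -
    obtain P b where b: "pr T P \<^bold>\<in> f" "b \<^bold>\<in> P" "x \<^bold>\<in> b" "y \<^bold>\<in> b" using xy by blast
    then obtain c where c: "c \<^bold>\<in> P" "y \<^bold>\<in> c" "z \<^bold>\<in> c" using yz E by blast
    have "b = c" using b c part mem unfolding partition_def by blast
    then show ?thesis using b c by blast
  qed
  show "bnd (\<lambda>x. \<exists>y. y \<noteq> x \<and> ?E T x y)" if T: "subset T A"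
  proof -
    obtain P where P: "pr T P \<^bold>\<in> f" using val[OF T] by blast
    from B_fin_support[of P A] mem[OF P] show ?thesis
      by (rule_tac bnd_mono) (use E[OF P] in blast)+
  qed
  fix T'
  show "T = T'" if T: "subset T A" "subset T' A" and eq: "\<And>x y. ?E T x y \<longleftrightarrow> ?E T' x y"
  proof -
    obtain P P' where P: "pr T P \<^bold>\<in> f" "pr T' P' \<^bold>\<in> f" using val T by blast
    have "P = P'"
    proof (rule B_fin_eqI)
      show "P \<^bold>\<in> B_fin A" "P' \<^bold>\<in> B_fin A" using mem P by blast+
      fix x y
      show "(\<exists>b. b \<^bold>\<in> P \<and> x \<^bold>\<in> b \<and> y \<^bold>\<in> b) \<longleftrightarrow> (\<exists>b. b \<^bold>\<in> P' \<and> x \<^bold>\<in> b \<and> y \<^bold>\<in> b)"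
        using eq[of x y] unfolding E[OF P(1)] E[OF P(2)] .
    qed
    then show ?thesis using P inv mem by blast
  qed
next
  let ?E = "\<lambda>T x y. \<exists>P b. pr T P \<^bold>\<in> f \<and> b \<^bold>\<in> P \<and> x \<^bold>\<in> b \<and> y \<^bold>\<in> b"
  fix Q
  assume "df (\<lambda>s. Q (s 0) (s 1))" "\<And>x y. Q x y \<Longrightarrow> x \<^bold>\<in> A" "\<And>x. x \<^bold>\<in> A \<Longrightarrow> Q x x"
    "\<And>x y. Q x y \<Longrightarrow> Q y x" "\<And>x y z. Q x y \<Longrightarrow> Q y z \<Longrightarrow> Q x z" "bnd (\<lambda>x. \<exists>y. y \<noteq> x \<and> Q x y)"
  then have "\<exists>P. P \<^bold>\<in> B_fin A \<and> (\<forall>x y. (\<exists>b. b \<^bold>\<in> P \<and> x \<^bold>\<in> b \<and> y \<^bold>\<in> b) \<longleftrightarrow> Q x y)"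
    by (rule ex_B_fin)
  then obtain P where P: "P \<^bold>\<in> B_fin A"
    "\<And>x y. (\<exists>b. b \<^bold>\<in> P \<and> x \<^bold>\<in> b \<and> y \<^bold>\<in> b) \<longleftrightarrow> Q x y" by blast
  then obtain T where T: "pr T P \<^bold>\<in> f" using f unfolding bijection_iff by blast
  have "subset T A" using f T unfolding bijection_iff by (fastforce simp: mem_power_set)
  moreover from this have "P' = P" if "pr T P' \<^bold>\<in> f" for P'
    using f T that unfolding bijection_iff mem_power_set by blast
  ultimately show "\<exists>T. subset T A \<and> (\<forall>x y. ?E T x y \<longleftrightarrow> Q x y)" using T P(2) by blast
qed

end

context coded_partitions
begin

text \<open>If \<open>A = {a, b}\<close>, then the partition coded by \<open>T\<close> is determined by whether \<open>E T a b\<close>.\<close>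

lemma ex_three_elements:
  assumes "a \<^bold>\<in> A"
  shows "\<exists>a b c. a \<^bold>\<in> A \<and> b \<^bold>\<in> A \<and> c \<^bold>\<in> A \<and> a \<noteq> b \<and> a \<noteq> c \<and> b \<noteq> c"
proof (rule ccontr)
  assume no: "\<not> ?thesis"
  obtain b where b: "b \<^bold>\<in> A" "\<And>x. x \<^bold>\<in> A \<Longrightarrow> x = a \<or> x = b" using no assms by blast
  have *: "T = T'" if "subset T A" "subset T' A" "E T a b \<longleftrightarrow> E T' a b" for T T'
  proof (rule E_inj[OF that(1,2)])
    fix x y
    consider "\<not> (x \<^bold>\<in> A \<and> y \<^bold>\<in> A)" | "x \<^bold>\<in> A" "x = y" | "x = a" "y = b" | "x = b" "y = a"
      using b(2) by blast
    then show "E T x y \<longleftrightarrow> E T' x y"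
      using that E_in E_refl E_sym by cases blast+
  qed
  have s: "subset emp A" "subset (ins a emp) A" "subset A A" using assms by (auto simp: subset_def)
  have ne: "emp \<noteq> ins a emp" "emp \<noteq> A"
    using assms ins_neq_emp[of a emp, symmetric] by auto
  show False
  proof (cases "a = b")
    case True
    then have "emp = ins a emp" using *[of emp "ins a emp"] s E_refl assms by blast
    with ne show False by simp
  next
    case False
    then have "ins a emp \<noteq> A" using b(1) by (metis mem_emp mem_ins)
    \<comment> \<open>The subsets \<open>emp\<close>, \<open>ins a emp\<close> and \<open>A\<close>
      are distinct, but a single truth value would have to tell all three apart.\<close>
    then show False using *[of emp "ins a emp"] *[of emp A] *[of "ins a emp" A] s ne by blast
  qed
qed

end

context ZF
begin

lemma no_bijection:
  assumes "\<not> is_empty A"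
  shows "\<not> bijection f (power_set A) (B_fin A)"
proof
  let ?E = "\<lambda>T x y. \<exists>P b. pr T P \<^bold>\<in> f \<and> b \<^bold>\<in> P \<and> x \<^bold>\<in> b \<and> y \<^bold>\<in> b"
  assume "bijection f (power_set A) (B_fin A)"
  then interpret coded_partitions mem A ?E
    by (rule bijection_coded_partitions)
  obtain a where "a \<^bold>\<in> A" using assms unfolding is_empty_def by blast
  from ex_three_elements[OF this] obtain a b c where
    "a \<^bold>\<in> A" "b \<^bold>\<in> A" "c \<^bold>\<in> A" "a \<noteq> b" "a \<noteq> c" "b \<noteq> c" by blast
  then interpret layer_base mem A ?E a b c by unfold_locales
  show False by (rule no_coded_partitions)
qed

end

theorem theorem4p28:
  fixes mem :: "'v \<Rightarrow> 'v \<Rightarrow> bool" and A :: 'v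
  assumes "ZF mem"
    and "\<not> membership.is_empty mem A"
  shows "\<not> (\<exists>f. membership.bijection mem f (membership.power_set mem A) (membership.B_fin mem A))"
  using ZF.no_bijection[OF assms] by blast

end
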